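(* Let $\kappa_1,\dots,\kappa_k\ge1$ and let $S_{\kappa_1,\dots,\kappa_k}\subset\Gamma\backslash G$ be the set of points Diophantine of type $(\kappa_1,\dots,\kappa_k)$. Then $$\dim_H\big(S_{\kappa_1,\dots,\kappa_k}^{c}\big)=2+\frac{2}{\min\{\kappa_j+1:1\le j\le k\}}.$$ Moreover, if $\min\{\kappa_1,\dots,\kappa_k\}=1$, then $S_{\kappa_1,\dots,\kappa_k}$ has zero Haar measure but full Hausdorff dimension (namely $3$).
   Context: $G=\mathrm{PSL}(2,\mathbb R)$ acts on $\mathfrak H$ by Möbius transformations and linearly on $\mathbb R^2/\pm$; $\Gamma\backslash G$ carries its natural Riemannian metric. $\Gamma<G$ is a non-uniform lattice with $k$ inequivalent cusps $\eta_1,\dots,\eta_k$; $u(t)=\begin{pmatrix}1&t\\0&1\end{pmatrix}$, $N=\{u(t)\}$, $e_1=(1,0)^T$. Fix $\sigma_j\in G$ with $\lim_{t\to\infty}\sigma_j\cdot(it)=\eta_j$ and $\sigma_j^{-1}\Gamma\sigma_j\cap N$ a lattice in $N$; $\Gamma_j=\Gamma\cap\sigma_jN\sigma_j^{-1}$, $\pi_j:\Gamma_j\backslash G\to\Gamma\backslash G$ the projection, $m_j(\Gamma_jg)=g^{-1}\sigma_je_1\in\mathbb R^2/\pm$. $p$ is Diophantine of type $(\kappa_1,\dots,\kappa_k)$ if for each $j$ there exist $\mu_j,\nu_j>0$ such that every $(a,b)^T\in m_j(\pi_j^{-1}(p))$ satisfies $|b|\ge\mu_j$ or $|a|^{\kappa_j}|b|\ge\nu_j$.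 *)

theory Defs
  imports "HOL-Analysis.Analysis"
begin

definition hcontent :: "real \<Rightarrow> 'a::metric_space set \<Rightarrow> real" where
  "hcontent s C = (if C = {} then 0 else if s = 0 then 1 else diameter C powr s)"

definition hausdorff_pre :: "real \<Rightarrow> real \<Rightarrow> 'a::metric_space set \<Rightarrow> ennreal" where
  "hausdorff_pre s \<delta> E =
     (INF C \<in> {C :: nat \<Rightarrow> 'a set. E \<subseteq> (\<Union>i. C i) \<and> (\<forall>i. bounded (C i) \<and> diameter (C i) \<le> \<delta>)}.
        (\<Sum>i. ennreal (hcontent s (C i))))"

definition hausdorff_measure :: "real \<Rightarrow> 'a::metric_space set \<Rightarrow> ennreal" where
  "hausdorff_measure s E = (SUP \<delta> \<in> {0<..}. hausdorff_pre s \<delta> E)"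

definition hausdorff_dim :: "'a::metric_space set \<Rightarrow> ereal" where
  "hausdorff_dim E = Inf (ereal ` {s. 0 \<le> s \<and> hausdorff_measure s E = 0})"

definition SL2 :: "(real^2^2) set" where
  "SL2 = {A. det A = 1}"

definition umat :: "real \<Rightarrow> real^2^2" where
  "umat t = vector [vector [1, t], vector [0, 1]]"

definition amat :: "real \<Rightarrow> real^2^2" where
  "amat y = vector [vector [sqrt y, 0], vector [0, 1 / sqrt y]]"

definition kmat :: "real \<Rightarrow> real^2^2" where
  "kmat \<theta> = vector [vector [cos \<theta>, - sin \<theta>], vector [sin \<theta>, cos \<theta>]]"

definition e1 :: "real^2" where
  "e1 = vector [1, 0]"

definition iwasawa :: "real \<times> real \<times> real \<Rightarrow> real^2^2" where
  "iwasawa p = (case p of (x, y, \<theta>) \<Rightarrow> umat x ** amat y ** kmat \<theta>)"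

definition haar_SL2 :: "(real^2^2) measure" where
  "haar_SL2 = distr
     (density lborel (\<lambda>p. case p of (x, y, \<theta>) \<Rightarrow>
        indicator {p. case p of (x, y, \<theta>) \<Rightarrow> 0 < y \<and> 0 \<le> \<theta> \<and> \<theta> < 2 * pi} p * ennreal (1 / y\<^sup>2)))
     borel iwasawa"

definition mat_subgroup :: "(real^2^2) set \<Rightarrow> bool" where
  "mat_subgroup \<Gamma> \<longleftrightarrow> \<Gamma> \<subseteq> SL2 \<and> mat 1 \<in> \<Gamma> \<and>
     (\<forall>a\<in>\<Gamma>. \<forall>b\<in>\<Gamma>. a ** b \<in> \<Gamma>) \<and> (\<forall>a\<in>\<Gamma>. matrix_inv a \<in> \<Gamma>)"

definition discrete_set :: "(real^2^2) set \<Rightarrow> bool" where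
  "discrete_set \<Gamma> \<longleftrightarrow> (\<forall>g\<in>\<Gamma>. \<exists>e>0. \<forall>h\<in>\<Gamma>. dist h g < e \<longrightarrow> h = g)"

definition finite_covolume :: "(real^2^2) set \<Rightarrow> bool" where
  "finite_covolume \<Gamma> \<longleftrightarrow> (\<exists>F. F \<in> sets borel \<and> F \<subseteq> SL2 \<and>
     (\<forall>g\<in>SL2. \<exists>!\<gamma>. \<gamma> \<in> \<Gamma> \<and> matrix_inv \<gamma> ** g \<in> F) \<and> emeasure haar_SL2 F < \<infinity>)"

definition cocompact :: "(real^2^2) set \<Rightarrow> bool" where
  "cocompact \<Gamma> \<longleftrightarrow> (\<exists>C. compact C \<and> SL2 \<subseteq> (\<Union>\<gamma>\<in>\<Gamma>. (\<lambda>h. \<gamma> ** h) ` C))"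

text \<open>Gamma here is the full preimage in SL(2,R) of a lattice of PSL(2,R) (hence contains -I).\<close>
definition nonuniform_lattice :: "(real^2^2) set \<Rightarrow> bool" where
  "nonuniform_lattice \<Gamma> \<longleftrightarrow> mat_subgroup \<Gamma> \<and> - mat 1 \<in> \<Gamma> \<and> discrete_set \<Gamma> \<and>
     finite_covolume \<Gamma> \<and> \<not> cocompact \<Gamma>"

definition parabolic :: "real^2^2 \<Rightarrow> bool" where
  "parabolic \<gamma> \<longleftrightarrow> (trace \<gamma> = 2 \<or> trace \<gamma> = -2) \<and> \<gamma> \<noteq> mat 1 \<and> \<gamma> \<noteq> - mat 1"

definition cusp_normalizer :: "(real^2^2) set \<Rightarrow> real^2^2 \<Rightarrow> bool" where
  "cusp_normalizer \<Gamma> \<sigma> \<longleftrightarrow> \<sigma> \<in> SL2 \<and>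
     (\<exists>h>0. \<forall>t. (\<sigma> ** umat t ** matrix_inv \<sigma> \<in> \<Gamma>) \<longleftrightarrow> (\<exists>n::int. t = of_int n * h))"

text \<open>The cusps eta_j = sigma_j(infinity), j < k, form a complete system of
  Gamma-inequivalent cusps (boundary points are lines in R^2; sigma(infinity) is the line of sigma e1).\<close>
definition complete_cusp_system :: "(real^2^2) set \<Rightarrow> nat \<Rightarrow> (nat \<Rightarrow> real^2^2) \<Rightarrow> bool" where
  "complete_cusp_system \<Gamma> k \<sigma> \<longleftrightarrow>
     (\<forall>j<k. cusp_normalizer \<Gamma> (\<sigma> j)) \<and>
     (\<forall>i<k. \<forall>j<k. i \<noteq> j \<longrightarrow> \<not> (\<exists>\<delta>\<in>\<Gamma>. \<exists>c. (\<delta> ** \<sigma> j) *v e1 = c *s (\<sigma> i *v e1))) \<and>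
     (\<forall>\<gamma>\<in>\<Gamma>. parabolic \<gamma> \<longrightarrow>
        (\<exists>j<k. \<exists>\<delta>\<in>\<Gamma>. \<exists>c. \<gamma> *v ((\<delta> ** \<sigma> j) *v e1) = c *s ((\<delta> ** \<sigma> j) *v e1)))"

text \<open>g (a representative of p = Gamma g) is Diophantine of type kappa: the set
  m_j(pi_j^-1(p)) equals {g^-1 gamma sigma_j e1 : gamma in Gamma} (up to sign).\<close>
definition diophantine :: "(real^2^2) set \<Rightarrow> nat \<Rightarrow> (nat \<Rightarrow> real^2^2) \<Rightarrow> (nat \<Rightarrow> real) \<Rightarrow> real^2^2 \<Rightarrow> bool" where
  "diophantine \<Gamma> k \<sigma> \<kappa> g \<longleftrightarrow>
     (\<forall>j<k. \<exists>\<mu>>0. \<exists>\<nu>>0. \<forall>\<gamma>\<in>\<Gamma>.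
        (let v = (matrix_inv g ** \<gamma> ** \<sigma> j) *v e1 in
           \<mu> \<le> \<bar>v $ 2\<bar> \<or> \<nu> \<le> \<bar>v $ 1\<bar> powr \<kappa> j * \<bar>v $ 2\<bar>))"

text \<open>Preimage in SL(2,R) of S_kappa \<subseteq> Gamma\G.\<close>
definition dioph_set :: "(real^2^2) set \<Rightarrow> nat \<Rightarrow> (nat \<Rightarrow> real^2^2) \<Rightarrow> (nat \<Rightarrow> real) \<Rightarrow> (real^2^2) set" where
  "dioph_set \<Gamma> k \<sigma> \<kappa> = {g \<in> SL2. diophantine \<Gamma> k \<sigma> \<kappa> g}"

end

theory Submission
  imports Defs
begin

text \<open>Whether \<open>g\<close> is Diophantine depends only on the direction \<open>\<xi>\<close> of its first column: \<open>\<xi>\<close> must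
  not be too close to the directions of the vectors in the orbits \<open>\<Gamma> \<sigma>\<^sub>j e\<^sub>1\<close>. Both sets are therefore
  locally products of a set of directions with a plane, and two is added to the dimension.

  By Shimizu's lemma any two non-proportional orbit vectors span an area bounded below. Hence the
  orbit directions at scale \<open>R\<close> are \<open>R\<^sup>-\<^sup>2\<close>-separated, which gives the upper bound by a direct cover
  and full dimension of the badly approximable directions by deleting at most one subinterval per
  step of a Cantor construction.

  For the lower bound and the null set statement, let \<open>B\<close> consist of the points of the cuspidal
  region \<open>\<bar>a\<bar>, \<bar>b\<bar> < \<epsilon>\<close> whose orbits under the diagonal flow eventually leave that region. The flow
  preserves the finite measure on \<open>\<Gamma>\G\<close>, so \<open>B\<close> is null. As the cuspidal region contains points with
  almost every direction, almost every direction is approximable to order two with an arbitrarily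
  small constant, and the mass transference principle turns this into the dimension.\<close>

section \<open>Hausdorff null sets\<close>

text \<open>The value 2/(\<kappa>+1) is a count. At most about R^2 vectors have first coordinate
  about R and slope in a bounded range, and a direction that fails the condition of exponent
  \<kappa>, unless it is itself a slope, comes within a small multiple of R^(-(\<kappa>+1)) of such
  slopes for arbitrarily large R. Separation bounds the number of slopes only from above; that there
  are enough of them for a lower bound has to come from finite covolume. At exponent one the balls
  have radius 1/R^2, comparable to the guaranteed gaps, and recurrence alone, without ergodicity or
  counting, shows that they cover almost every direction. Larger exponents are reached by shrinking
  each radius r to r^\<tau> with \<tau> just above (\<kappa>+1)/2. Lower bounds for the dimension
  are obtained without constructing a measure: a hypothetical economical cover is given first, and
  nested intervals are chosen against it. Full dimension of the Diophantine set requires directions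
  that are good for all cusps simultaneously, hence a separation constant common to all orbits; the
  lower bound for the complement and the null set statement can concentrate on one cusp of least
  exponent.\<close>

definition hnull :: "real \<Rightarrow> 'a::metric_space set \<Rightarrow> bool" where
  "hnull s E \<longleftrightarrow> (\<forall>\<epsilon>>0. \<exists>U d. E \<subseteq> (\<Union>i::nat. U i) \<and>
     (\<forall>i. 0 < d i \<and> (\<forall>x\<in>U i. \<forall>y\<in>U i. dist x y \<le> d i)) \<and>
     summable (\<lambda>i. d i powr s) \<and> (\<Sum>i. d i powr s) < \<epsilon>)"

lemma hnull_subset: "hnull s E \<Longrightarrow> E' \<subseteq> E \<Longrightarrow> hnull s E'"
  unfolding hnull_def by (meson order_trans)

lemma powr_root_half_power:
  fixes e s :: real
  assumes "0 < e" "0 < s"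
  shows "(e * (1/2)^n) powr (1/s) > 0" "((e * (1/2)^n) powr (1/s)) powr s = e * (1/2)^n"
  using assms by (auto simp: powr_powr)

lemma suminf_half_power: "summable (\<lambda>n. e * (1/2)^n :: real)" "(\<Sum>n. e * (1/2)^n :: real) = 2 * e"
proof -
  have "(\<lambda>n. (1/2)^n :: real) sums (1 / (1 - 1/2))" by (rule geometric_sums) auto
  from sums_mult[OF this, of e] have "(\<lambda>n. e * (1/2)^n) sums (2 * e)" by (simp add: mult.commute)
  then show "summable (\<lambda>n. e * (1/2)^n :: real)" "(\<Sum>n. e * (1/2)^n :: real) = 2 * e"
    by (auto simp: sums_iff)
qed

lemma hnull_countableI:
  fixes E :: "'a::metric_space set"
  assumes s: "0 < s"
    and cov: "\<And>\<epsilon>. 0 < \<epsilon> \<Longrightarrow> \<exists>(I::'i set) U d. countable I \<and> E \<subseteq> (\<Union>i\<in>I. U i) \<and>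
      (\<forall>i\<in>I. 0 < d i \<and> (\<forall>x\<in>U i. \<forall>y\<in>U i. dist x y \<le> d i)) \<and>
      (\<forall>F. finite F \<longrightarrow> F \<subseteq> I \<longrightarrow> (\<Sum>i\<in>F. d i powr s) \<le> \<epsilon>)"
  shows "hnull s E"
  unfolding hnull_def
proof (intro allI impI)
  fix \<epsilon> :: real assume \<epsilon>: "\<epsilon> > 0"
  then have "\<epsilon>/4 > 0" by simp
  from cov[OF this] obtain I :: "'i set" and U d where I: "countable I" "E \<subseteq> (\<Union>i\<in>I. U i)"
    "\<And>i. i \<in> I \<Longrightarrow> 0 < d i" "\<And>i x y. i \<in> I \<Longrightarrow> x \<in> U i \<Longrightarrow> y \<in> U i \<Longrightarrow> dist x y \<le> d i"
    "\<And>F. finite F \<Longrightarrow> F \<subseteq> I \<Longrightarrow> (\<Sum>i\<in>F. d i powr s) \<le> \<epsilon>/4"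
    by metis
  define f where "f = to_nat_on I"
  have inj: "inj_on f I" using I(1) by (simp add: f_def inj_on_to_nat_on)
  define g where "g = the_inv_into I f"
  have gf: "g (f i) = i" if "i \<in> I" for i using inj that by (simp add: g_def the_inv_into_f_f)
  \<comment> \<open>The s-th powers of the fillers sum to \<epsilon>/4; with the \<epsilon>/4 of the
    cover the total stays strictly below \<epsilon>.\<close>
  define e where "e n = (\<epsilon>/4/2 * (1/2)^n) powr (1/s)" for n
  have e: "e n > 0" "e n powr s = \<epsilon>/4/2 * (1/2)^n" for n
    unfolding e_def using powr_root_half_power[of "\<epsilon>/4/2" s n] \<epsilon> s by auto
  define V where "V n = (if n \<in> f ` I then U (g n) else {})" for n
  define D where "D n = (if n \<in> f ` I then d (g n) else e n)" for n
  have part: "(\<Sum>n<N. D n powr s) \<le> \<epsilon>/2" for N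
  proof -
    have "(\<Sum>n<N. D n powr s) \<le> (\<Sum>n<N. (if n \<in> f ` I then d (g n) powr s else 0) + e n powr s)"
      by (rule sum_mono) (auto simp: D_def)
    also have "\<dots> = (\<Sum>n\<in>{..<N} \<inter> f ` I. d (g n) powr s) + (\<Sum>n<N. e n powr s)"
      by (simp add: sum.distrib sum.If_cases Int_def)
    also have "(\<Sum>n\<in>{..<N} \<inter> f ` I. d (g n) powr s) = (\<Sum>i\<in>g ` ({..<N} \<inter> f ` I). d i powr s)"
      by (subst sum.reindex) (auto intro!: inj_onI simp: gf)
    also have "\<dots> \<le> \<epsilon>/4" by (rule I(5)) (auto simp: gf)
    also have "(\<Sum>n<N. e n powr s) \<le> (\<Sum>n. \<epsilon>/4/2 * (1/2)^n)"
      unfolding e(2) using \<epsilon> by (intro sum_le_suminf suminf_half_power) auto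
    also have "\<dots> = \<epsilon>/4" by (subst suminf_half_power) simp
    finally show ?thesis by simp
  qed
  have sm: "summable (\<lambda>n. D n powr s)"
    by (rule summableI_nonneg_bounded[where x="\<epsilon>/2"]) (use part in auto)
  have "(\<Sum>n. D n powr s) \<le> \<epsilon>/2" by (rule suminf_le_const[OF sm part])
  then have "(\<Sum>n. D n powr s) < \<epsilon>" using \<epsilon> by simp
  moreover have "E \<subseteq> (\<Union>n. V n)" using I(2) by (force simp: V_def gf)
  moreover have "0 < D n \<and> (\<forall>x\<in>V n. \<forall>y\<in>V n. dist x y \<le> D n)" for n
    using I(3,4) e(1) gf by (auto simp: D_def V_def)
  ultimately show "\<exists>U d. E \<subseteq> (\<Union>i::nat. U i) \<and>
     (\<forall>i. 0 < d i \<and> (\<forall>x\<in>U i. \<forall>y\<in>U i. dist x y \<le> d i)) \<and>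
     summable (\<lambda>i. d i powr s) \<and> (\<Sum>i. d i powr s) < \<epsilon>"
    using sm by blast
qed

lemma hnull_Union:
  assumes s: "0 < s" and E: "\<And>n::nat. hnull s (E n)"
  shows "hnull s (\<Union>n. E n)"
proof (rule hnull_countableI[OF s, where ?'i = "nat \<times> nat"])
  fix \<epsilon> :: real assume \<epsilon>: "\<epsilon> > 0"
  have "\<forall>n. \<exists>U d. E n \<subseteq> (\<Union>i::nat. U i) \<and> (\<forall>i. 0 < d i \<and> (\<forall>x\<in>U i. \<forall>y\<in>U i. dist x y \<le> d i)) \<and>
     summable (\<lambda>i. d i powr s) \<and> (\<Sum>i. d i powr s) < \<epsilon>/2 * (1/2)^n"
    by (intro allI E[unfolded hnull_def, rule_format]) (use \<epsilon> in simp)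
  then obtain U d where Ud: "\<And>n. E n \<subseteq> (\<Union>i::nat. U n i)" "\<And>n i. 0 < d n i"
    "\<And>n i x y. x \<in> U n i \<Longrightarrow> y \<in> U n i \<Longrightarrow> dist x y \<le> d n i"
    "\<And>n. summable (\<lambda>i. d n i powr s)" "\<And>n. (\<Sum>i. d n i powr s) < \<epsilon>/2 * (1/2)^n"
    by metis
  have fin: "(\<Sum>p\<in>F. d (fst p) (snd p) powr s) \<le> \<epsilon>" if F: "finite F" for F
  proof -
    obtain N where N: "\<forall>k\<in>fst ` F \<union> snd ` F. k < N"
      using finite_nat_set_iff_bounded F by blast
    have "(\<Sum>p\<in>F. d (fst p) (snd p) powr s) \<le> (\<Sum>p\<in>{..<N}\<times>{..<N}. d (fst p) (snd p) powr s)"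
      using N by (intro sum_mono2) force+
    also have "\<dots> = (\<Sum>n<N. \<Sum>i<N. d n i powr s)"
      by (simp add: sum.cartesian_product case_prod_unfold)
    also have "\<dots> \<le> (\<Sum>n<N. \<epsilon>/2 * (1/2)^n)"
      by (intro sum_mono order_trans[OF sum_le_suminf less_imp_le[OF Ud(5)]] Ud(4)) auto
    also have "\<dots> \<le> (\<Sum>n. \<epsilon>/2 * (1/2)^n)"
      using \<epsilon> by (intro sum_le_suminf suminf_half_power) auto
    also have "\<dots> = \<epsilon>" by (subst suminf_half_power) simp
    finally show ?thesis .
  qed
  have "(\<Union>n. E n) \<subseteq> (\<Union>p\<in>UNIV. U (fst p) (snd p))" using Ud(1) by fastforce
  then show "\<exists>(I::(nat\<times>nat) set) V D. countable I \<and> (\<Union>n. E n) \<subseteq> (\<Union>i\<in>I. V i) \<and>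
      (\<forall>i\<in>I. 0 < D i \<and> (\<forall>x\<in>V i. \<forall>y\<in>V i. dist x y \<le> D i)) \<and>
      (\<forall>F. finite F \<longrightarrow> F \<subseteq> I \<longrightarrow> (\<Sum>i\<in>F. D i powr s) \<le> \<epsilon>)"
    using Ud(2,3) fin
    by (intro exI[of _ UNIV] exI[of _ "\<lambda>p. U (fst p) (snd p)"] exI[of _ "\<lambda>p. d (fst p) (snd p)"]) auto
qed

lemma hnull_singleton: "0 < s \<Longrightarrow> hnull s {x}"
proof (rule hnull_countableI[where ?'i = unit])
  fix \<epsilon> :: real assume "0 < s" "\<epsilon> > 0"
  then show "\<exists>(I::unit set) U d. countable I \<and> {x} \<subseteq> (\<Union>i\<in>I. U i) \<and>
      (\<forall>i\<in>I. 0 < d i \<and> (\<forall>x\<in>U i. \<forall>y\<in>U i. dist x y \<le> d i)) \<and>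
      (\<forall>F. finite F \<longrightarrow> F \<subseteq> I \<longrightarrow> (\<Sum>i\<in>F. d i powr s) \<le> \<epsilon>)"
    by (intro exI[of _ UNIV] exI[of _ "\<lambda>_. {x}"] exI[of _ "\<lambda>_. \<epsilon> powr (1/s)"])
       (auto simp: powr_powr UNIV_unit subset_singleton_iff)
qed

lemma hnull_empty: "0 < s \<Longrightarrow> hnull s {}"
  using hnull_singleton hnull_subset by blast

lemma hnull_countable:
  assumes "0 < s" "countable E"
  shows "hnull s E"
proof (cases "E = {}")
  case False
  have "hnull s (\<Union>n. {from_nat_into E n})" by (rule hnull_Union) (auto simp: assms hnull_singleton)
  then show ?thesis
    using range_from_nat_into[OF False assms(2)] by (metis UNION_singleton_eq_range)
qed (simp add: hnull_empty assms)

lemma hnull_Un: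
  assumes "0 < s" "hnull s E" "hnull s E'"
  shows "hnull s (E \<union> E')"
proof -
  have "hnull s (\<Union>n::nat. if n = 0 then E else E')" using assms by (intro hnull_Union) auto
  moreover have "E \<union> E' \<subseteq> (\<Union>n::nat. if n = 0 then E else E')" by (force split: if_splits)
  ultimately show ?thesis by (rule hnull_subset)
qed

lemma hnull_exponent_mono:
  assumes "0 < s" "s \<le> t" "hnull s E"
  shows "hnull t E"
  unfolding hnull_def
proof (intro allI impI)
  fix \<epsilon> :: real assume \<epsilon>: "\<epsilon> > 0"
  \<comment> \<open>Content below one forces every \<open>d i\<close> to be at most one, and there
    powers decrease as the exponent grows.\<close>
  then have "0 < min \<epsilon> 1" by simp
  from assms(3)[unfolded hnull_def, rule_format, OF this]
  obtain U d where Ud: "E \<subseteq> (\<Union>i::nat. U i)" "\<forall>i. 0 < d i \<and> (\<forall>x\<in>U i. \<forall>y\<in>U i. dist x y \<le> d i)"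
    "summable (\<lambda>i. d i powr s)" "(\<Sum>i. d i powr s) < min \<epsilon> 1"
    by metis
  have le: "d i powr t \<le> d i powr s" for i
  proof -
    have "d i powr s \<le> (\<Sum>i. d i powr s)"
      using sum_le_suminf[OF Ud(3), of "{i}"] by auto
    then have "d i powr s \<le> 1" using Ud(4) by simp
    then have "d i \<le> 1"
      using Ud(2) \<open>0 < s\<close> by (metis gr_one_powr linorder_not_less)
    then show ?thesis using Ud(2) \<open>s \<le> t\<close> by (simp add: powr_mono' less_imp_le)
  qed
  have sm: "summable (\<lambda>i. d i powr t)"
    by (rule summable_comparison_test'[OF Ud(3)]) (use le in auto)
  have "(\<Sum>i. d i powr t) \<le> (\<Sum>i. d i powr s)" by (intro suminf_le le sm Ud(3))
  then show "\<exists>U d. E \<subseteq> (\<Union>i::nat. U i) \<and>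
     (\<forall>i. 0 < d i \<and> (\<forall>x\<in>U i. \<forall>y\<in>U i. dist x y \<le> d i)) \<and>
     summable (\<lambda>i. d i powr t) \<and> (\<Sum>i. d i powr t) < \<epsilon>"
    using Ud sm by (metis le_less_trans min_less_iff_conj)
qed

lemma hnull_lipschitz_image:
  assumes "0 < L" and L: "\<And>x y. x \<in> E \<Longrightarrow> y \<in> E \<Longrightarrow> dist (f x) (f y) \<le> L * dist x y"
    and E: "hnull s E"
  shows "hnull s (f ` E)"
  unfolding hnull_def
proof (intro allI impI)
  fix \<epsilon> :: real assume \<epsilon>: "\<epsilon> > 0"
  then have "0 < \<epsilon> / L powr s" using \<open>0 < L\<close> by simp
  from E[unfolded hnull_def, rule_format, OF this]
  obtain U d where Ud: "E \<subseteq> (\<Union>i::nat. U i)" "\<And>i. 0 < d i" "\<And>i x y. x \<in> U i \<Longrightarrow> y \<in> U i \<Longrightarrow> dist x y \<le> d i"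
    "summable (\<lambda>i. d i powr s)" "(\<Sum>i. d i powr s) < \<epsilon> / L powr s"
    by metis
  have eq: "(L * d i) powr s = L powr s * d i powr s" for i
    using Ud(2) \<open>0 < L\<close> by (simp add: powr_mult less_imp_le)
  have "f ` E \<subseteq> (\<Union>i. f ` (U i \<inter> E))" using Ud(1) by blast
  moreover have "0 < L * d i" for i using Ud(2) \<open>0 < L\<close> by simp
  moreover have "dist u v \<le> L * d i" if "u \<in> f ` (U i \<inter> E)" "v \<in> f ` (U i \<inter> E)" for u v i
    using that L Ud(3)[of _ i] \<open>0 < L\<close>
    by (auto intro: order_trans[OF L] mult_left_mono)
  moreover have "summable (\<lambda>i. (L * d i) powr s)" unfolding eq by (intro summable_mult Ud)
  moreover have "(\<Sum>i. (L * d i) powr s) < \<epsilon>"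
    unfolding eq suminf_mult[OF Ud(4)] using Ud(5) \<open>0 < L\<close> by (simp add: pos_less_divide_eq mult.commute)
  ultimately show "\<exists>U d. f ` E \<subseteq> (\<Union>i::nat. U i) \<and>
     (\<forall>i. 0 < d i \<and> (\<forall>x\<in>U i. \<forall>y\<in>U i. dist x y \<le> d i)) \<and>
     summable (\<lambda>i. d i powr s) \<and> (\<Sum>i. d i powr s) < \<epsilon>"
    by (intro exI[of _ "\<lambda>i. f ` (U i \<inter> E)"] exI[of _ "\<lambda>i. L * d i"]) blast
qed

text \<open>The mesh bound in \<open>hausdorff_pre\<close> costs nothing for s > 0, since total
  content below \<open>\<delta> powr s\<close> keeps every set shorter than \<delta>. Conversely,
  diameters in a cover may vanish, so they are enlarged to positive numbers at arbitrarily small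
  cost.\<close>

lemma hausdorff_measure_eq_0_iff:
  fixes E :: "'a::metric_space set"
  assumes s: "0 < s"
  shows "hausdorff_measure s E = 0 \<longleftrightarrow> hnull s E"
proof
  assume "hausdorff_measure s E = 0"
  then have 0: "hausdorff_pre s 1 E = 0"
    unfolding hausdorff_measure_def by (metis SUP_upper greaterThan_iff le_zero_eq zero_less_one)
  show "hnull s E"
    unfolding hnull_def
  proof (intro allI impI)
    fix \<epsilon> :: real assume \<epsilon>: "\<epsilon> > 0"
    then have "hausdorff_pre s 1 E < ennreal (\<epsilon>/2)" by (simp add: 0)
    then obtain C where C: "E \<subseteq> (\<Union>i::nat. C i)" "\<And>i. bounded (C i)"
      "(\<Sum>i. ennreal (hcontent s (C i))) < ennreal (\<epsilon>/2)"
      unfolding hausdorff_pre_def INF_less_iff by blast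
    have nn: "0 \<le> hcontent s (C i)" for i by (simp add: hcontent_def)
    have sm: "summable (\<lambda>i. hcontent s (C i))"
      by (rule summable_suminf_not_top[OF nn]) (use C(3) in auto)
    have ss: "(\<Sum>i. hcontent s (C i)) < \<epsilon>/2"
      using C(3) by (simp add: suminf_ennreal2[OF nn sm] ennreal_less_iff suminf_nonneg[OF sm nn])
    define e where "e n = (\<epsilon>/8 * (1/2)^n) powr (1/s)" for n
    have e: "e n > 0" "e n powr s = \<epsilon>/8 * (1/2)^n" for n
      unfolding e_def using powr_root_half_power[of "\<epsilon>/8" s n] \<epsilon> s by auto
    define d where "d i = max (if C i = {} then 0 else diameter (C i)) (e i)" for i
    have d0: "0 < d i" for i using e(1)[of i] by (simp add: d_def)
    have d: "dist x y \<le> d i" if "x \<in> C i" "y \<in> C i" for x y i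
      using diameter_bounded_bound[OF C(2) that] that by (auto simp: d_def)
    have le: "d i powr s \<le> hcontent s (C i) + \<epsilon>/8 * (1/2)^i" for i
    proof (cases "C i = {} \<or> diameter (C i) \<le> e i")
      case True
      then have "d i = e i" using e(1)[of i] by (auto simp: d_def)
      then show ?thesis using e(2)[of i] nn[of i] by simp
    qed (use s \<epsilon> in \<open>auto simp: d_def hcontent_def\<close>)
    have sm2: "summable (\<lambda>i. hcontent s (C i) + \<epsilon>/8 * (1/2)^i)"
      by (intro summable_add sm suminf_half_power)
    have sm3: "summable (\<lambda>i. d i powr s)"
      by (rule summable_comparison_test'[OF sm2]) (use le in auto)
    have "(\<Sum>i. d i powr s) \<le> (\<Sum>i. hcontent s (C i) + \<epsilon>/8 * (1/2)^i)"
      by (intro suminf_le le sm3 sm2)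
    also have "\<dots> = (\<Sum>i. hcontent s (C i)) + \<epsilon>/4"
      by (subst suminf_add[symmetric, OF sm suminf_half_power(1)], subst suminf_half_power) simp
    also have "\<dots> < \<epsilon>" using ss \<epsilon> by simp
    finally show "\<exists>U d. E \<subseteq> (\<Union>i::nat. U i) \<and>
     (\<forall>i. 0 < d i \<and> (\<forall>x\<in>U i. \<forall>y\<in>U i. dist x y \<le> d i)) \<and>
     summable (\<lambda>i. d i powr s) \<and> (\<Sum>i. d i powr s) < \<epsilon>"
      using C(1) d0 d sm3 by blast
  qed
next
  assume E: "hnull s E"
  have "hausdorff_pre s \<delta> E \<le> 0" if \<delta>: "\<delta> > 0" for \<delta>
  proof (rule ennreal_le_epsilon)
    fix \<epsilon> :: real assume \<epsilon>: "\<epsilon> > 0"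
    then have "0 < min \<epsilon> (\<delta> powr s)" using \<delta> by simp
    from E[unfolded hnull_def, rule_format, OF this]
    obtain U d where Ud: "E \<subseteq> (\<Union>i::nat. U i)" "\<And>i. 0 < d i" "\<And>i x y. x \<in> U i \<Longrightarrow> y \<in> U i \<Longrightarrow> dist x y \<le> d i"
      "summable (\<lambda>i. d i powr s)" "(\<Sum>i. d i powr s) < min \<epsilon> (\<delta> powr s)"
      by metis
    have "d i powr s \<le> (\<Sum>i. d i powr s)" for i
      using sum_le_suminf[OF Ud(4), of "{i}"] by auto
    then have "d i powr s < \<delta> powr s" for i using Ud(5) by (meson le_less_trans min_less_iff_conj)
    then have d\<delta>: "d i < \<delta>" for i
      using powr_less_cancel2[OF s Ud(2)] \<delta> by auto
    have bdd: "bounded (U i)" for i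
    proof (cases "U i = {}")
      case False
      then obtain x where "x \<in> U i" by auto
      then show ?thesis using Ud(3)[of x i] by (auto intro!: boundedI simp: bounded_def)
    qed simp
    have diam: "diameter (U i) \<le> d i" if "U i \<noteq> {}" for i
      unfolding diameter_def using that Ud(3) by (auto intro!: cSUP_least)
    have dd: "diameter (U i) \<le> \<delta>" for i
      using diam[of i] d\<delta>[of i] \<delta> by (cases "U i = {}") (auto simp: less_imp_le)
    have hc: "hcontent s (U i) \<le> d i powr s" for i
      using diam[of i] s diameter_ge_0[OF bdd, of i] by (auto simp: hcontent_def intro!: powr_mono2)
    have "hausdorff_pre s \<delta> E \<le> (\<Sum>i. ennreal (hcontent s (U i)))"
      unfolding hausdorff_pre_def using Ud(1) bdd dd by (intro INF_lower) auto
    also have "\<dots> \<le> (\<Sum>i. ennreal (d i powr s))"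
      by (intro suminf_le hc ennreal_leI) auto
    also have "\<dots> = ennreal (\<Sum>i. d i powr s)"
      by (rule suminf_ennreal2[OF _ Ud(4)]) simp
    also have "\<dots> \<le> ennreal \<epsilon>" using Ud(5) by (intro ennreal_leI) simp
    finally show "hausdorff_pre s \<delta> E \<le> 0 + ennreal \<epsilon>" by simp
  qed
  then show "hausdorff_measure s E = 0"
    unfolding hausdorff_measure_def by (simp add: SUP_eq_const[OF _ ] antisym SUP_le_iff flip: bot_ennreal)
qed

text \<open>The infimum in \<open>hausdorff_dim\<close> also ranges over s = 0, where each nonempty
  set has content one and the comparison with \<open>hnull\<close> does not apply; this disposes of
  that exponent.\<close>

lemma hausdorff_measure_0_nonempty:
  assumes "E \<noteq> {}"
  shows "hausdorff_measure 0 E \<noteq> 0"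
proof -
  have "1 \<le> (\<Sum>i. ennreal (hcontent 0 (C i)))" if C: "E \<subseteq> (\<Union>i. C i)" for C :: "nat \<Rightarrow> _"
  proof -
    obtain i where "C i \<noteq> {}" using C assms by blast
    then have "1 = ennreal (hcontent 0 (C i))" by (simp add: hcontent_def)
    also have "\<dots> \<le> (\<Sum>i. ennreal (hcontent 0 (C i)))"
      using sum_le_suminf[of "\<lambda>i. ennreal (hcontent 0 (C i))" "{i}"] by simp
    finally show ?thesis .
  qed
  then have "1 \<le> hausdorff_pre 0 1 E"
    unfolding hausdorff_pre_def by (auto intro!: INF_greatest)
  also have "\<dots> \<le> hausdorff_measure 0 E"
    unfolding hausdorff_measure_def by (intro SUP_upper) auto
  finally show ?thesis by auto
qed

lemma hausdorff_dim_eqI: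
  assumes d: "0 < d"
    and upper: "\<And>s. d < s \<Longrightarrow> hnull s E"
    and lower: "\<And>s. 0 < s \<Longrightarrow> s < d \<Longrightarrow> \<not> hnull s E"
  shows "hausdorff_dim E = ereal d"
proof (rule antisym)
  have "hausdorff_dim E \<le> ereal s" if "d < s" for s
    unfolding hausdorff_dim_def using that upper[OF that] d
    by (intro Inf_lower) (auto simp: hausdorff_measure_eq_0_iff)
  then show "hausdorff_dim E \<le> ereal d"
    by (metis ereal_dense2 linorder_not_le less_ereal.simps(1))
next
  have "E \<noteq> {}" using lower[of "d/2"] d hnull_empty[of "d/2"] by auto
  then have "d \<le> s" if "0 \<le> s" "hausdorff_measure s E = 0" for s
    using that lower[of s] hausdorff_measure_0_nonempty[of E]
    by (cases "s = 0") (auto simp: hausdorff_measure_eq_0_iff not_less[symmetric])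
  then show "ereal d \<le> hausdorff_dim E"
    unfolding hausdorff_dim_def by (auto intro!: Inf_greatest)
qed

section \<open>Orbits of cusp vectors\<close>

definition det2 :: "real^2 \<Rightarrow> real^2 \<Rightarrow> real" where
  "det2 v w = v$1 * w$2 - v$2 * w$1"

definition mat2 :: "real \<Rightarrow> real \<Rightarrow> real \<Rightarrow> real \<Rightarrow> real^2^2" where
  "mat2 a b c d = vector [vector [a, b], vector [c, d]]"

lemma mat2_component [simp]:
  "mat2 a b c d $ 1 $ 1 = a" "mat2 a b c d $ 1 $ 2 = b"
  "mat2 a b c d $ 2 $ 1 = c" "mat2 a b c d $ 2 $ 2 = d"
  by (simp_all add: mat2_def)

lemma mat2_eq_iff: "(A :: real^2^2) = B \<longleftrightarrow> A$1$1 = B$1$1 \<and> A$1$2 = B$1$2 \<and> A$2$1 = B$2$1 \<and> A$2$2 = B$2$2"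
  by (auto simp: vec_eq_iff forall_2)

lemma vec2_eq_iff: "(v :: real^2) = w \<longleftrightarrow> v$1 = w$1 \<and> v$2 = w$2"
  by (auto simp: vec_eq_iff forall_2)

lemma matrix_mult_component2:
  "((A :: real^2^2) ** B) $ i $ j = A$i$1 * B$1$j + A$i$2 * B$2$j"
  by (simp add: matrix_matrix_mult_def sum_2)

lemma matrix_vector_component2:
  "((A :: real^2^2) *v w) $ i = A$i$1 * w$1 + A$i$2 * w$2"
  by (simp add: matrix_vector_mult_def sum_2)

lemma e1_component [simp]: "e1 $ 1 = 1" "e1 $ 2 = 0"
  by (simp_all add: e1_def)

lemma SL2_iff: "g \<in> SL2 \<longleftrightarrow> g$1$1 * g$2$2 - g$1$2 * g$2$1 = 1"
  by (simp add: SL2_def det_2)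

lemma SL2_mult: "g \<in> SL2 \<Longrightarrow> h \<in> SL2 \<Longrightarrow> g ** h \<in> SL2"
  by (simp add: SL2_def det_mul)

lemma matrix_inv_unique:
  fixes A B :: "real^2^2"
  assumes "A ** B = mat 1" "B ** A = mat 1"
  shows "matrix_inv A = B"
proof -
  have "A ** matrix_inv A = mat 1 \<and> matrix_inv A ** A = mat 1"
    unfolding matrix_inv_def by (rule someI[of _ B]) (use assms in blast)
  then show ?thesis by (metis assms(2) matrix_mul_assoc matrix_mul_lid matrix_mul_rid)
qed

lemma matrix_inv_SL2:
  assumes "g \<in> SL2"
  shows "matrix_inv g = mat2 (g$2$2) (- g$1$2) (- g$2$1) (g$1$1)"
  using assms
  by (intro matrix_inv_unique) (auto simp: mat2_eq_iff SL2_iff matrix_mult_component2 mat_def algebra_simps)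

lemma SL2_inv_cancel:
  assumes "g \<in> SL2"
  shows "matrix_inv g ** g = mat 1" "g ** matrix_inv g = mat 1"
    "matrix_inv g ** (g ** h) = h" "g ** (matrix_inv g ** h) = h" "matrix_inv (matrix_inv g) = g"
proof -
  show 1: "matrix_inv g ** g = mat 1" "g ** matrix_inv g = mat 1"
    using assms unfolding matrix_inv_SL2[OF assms]
    by (auto simp: mat2_eq_iff SL2_iff matrix_mult_component2 mat_def algebra_simps)
  then show "matrix_inv g ** (g ** h) = h" "g ** (matrix_inv g ** h) = h"
    by (simp_all add: matrix_mul_assoc)
  show "matrix_inv (matrix_inv g) = g" by (rule matrix_inv_unique) (rule 1)+
qed

lemma det2_SL2: "g \<in> SL2 \<Longrightarrow> det2 (g *v v) (g *v w) = det2 v w"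
proof -
  assume "g \<in> SL2"
  moreover have "det2 (g *v v) (g *v w) = (g$1$1 * g$2$2 - g$1$2 * g$2$1) * det2 v w"
    by (simp add: det2_def matrix_vector_component2 algebra_simps)
  ultimately show ?thesis by (simp add: SL2_iff)
qed

section \<open>Parabolic elements and Shimizu's lemma\<close>

definition par :: "real \<Rightarrow> real^2 \<Rightarrow> real^2^2" where
  "par h w = mat2 (1 - h * w$1 * w$2) (h * w$1 * w$1) (- h * w$2 * w$2) (1 + h * w$1 * w$2)"

lemma par_SL2: "par h w \<in> SL2"
  by (simp add: SL2_iff par_def algebra_simps)

text \<open>This shows \<open>par h w\<close> to be the transvection along w: it fixes w, and for w
  = \<open>e1\<close> it is \<open>umat h\<close>. Indexing parabolic elements by a fixed vector
  turns conjugation into the plain action on that vector.\<close>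

lemma par_apply: "par h w *v v = v + (h * det2 w v) *s w"
  by (simp add: vec2_eq_iff par_def det2_def matrix_vector_component2 algebra_simps)

lemma par_conj:
  assumes "g \<in> SL2"
  shows "g ** par h w ** matrix_inv g = par h (g *v w)"
proof -
  have "g ** par h w = par h (g *v w) ** g"
  proof -
    obtain a b c d x y where abcd: "g = mat2 a b c d" "w$1 = x" "w$2 = y"
      using mat2_eq_iff[of g "mat2 (g$1$1) (g$1$2) (g$2$1) (g$2$2)"] by simp
    have D: "a * d - b * c = 1" using assms by (simp add: SL2_iff abcd)
    have "a * (1 - h * x * y) + b * (- h * y * y) =
        (1 - h * (a * x + b * y) * (c * x + d * y)) * a + h * (a * x + b * y) * (a * x + b * y) * c"
      "a * (h * x * x) + b * (1 + h * x * y) =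
        (1 - h * (a * x + b * y) * (c * x + d * y)) * b + h * (a * x + b * y) * (a * x + b * y) * d"
      "c * (1 - h * x * y) + d * (- h * y * y) =
        - h * (c * x + d * y) * (c * x + d * y) * a + (1 + h * (a * x + b * y) * (c * x + d * y)) * c"
      "c * (h * x * x) + d * (1 + h * x * y) =
        - h * (c * x + d * y) * (c * x + d * y) * b + (1 + h * (a * x + b * y) * (c * x + d * y)) * d"
      using D by algebra+
    then show ?thesis
      by (simp add: mat2_eq_iff matrix_mult_component2 matrix_vector_component2 par_def abcd)
  qed
  then show ?thesis using assms by (simp add: SL2_inv_cancel matrix_mul_assoc[symmetric])
qed

lemma umat_conj:
  assumes "g \<in> SL2"
  shows "g ** umat t ** matrix_inv g = par t (g *v e1)"
proof -
  have "umat t = par t e1" by (simp add: mat2_eq_iff par_def umat_def)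
  then show ?thesis using par_conj[OF assms] by simp
qed

lemma par_scale: "par h (c *s w) = par (c\<^sup>2 * h) w"
  by (simp add: mat2_eq_iff par_def power2_eq_square)

lemma tendsto_par:
  assumes "f \<longlonglongrightarrow> w"
  shows "(\<lambda>n. par h (f n)) \<longlonglongrightarrow> par h w"
proof -
  have "(\<lambda>n. f n $ i) \<longlonglongrightarrow> w $ i" for i by (intro tendsto_vec_nth assms)
  note [tendsto_intros] = this
  have "(\<lambda>n. par h (f n) $ i $ j) \<longlonglongrightarrow> par h w $ i $ j" for i j
    using exhaust_2[of i] exhaust_2[of j]
    by (elim disjE; simp add: par_def; intro tendsto_intros)
  then show ?thesis by (intro vec_tendstoI)
qed

lemma subgroup_conj:
  assumes "mat_subgroup \<Gamma>" "g \<in> \<Gamma>" "h \<in> \<Gamma>"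
  shows "g ** h ** matrix_inv g \<in> \<Gamma>"
  using assms unfolding mat_subgroup_def by blast

text \<open>Shimizu's lemma: iterating \<open>B \<mapsto> B P B\<^sup>-\<^sup>1\<close> from the second parabolic would
  otherwise produce elements accumulating at the first one.\<close>

lemma shimizu:
  assumes G: "mat_subgroup \<Gamma>" "discrete_set \<Gamma>"
    and P: "par h w \<in> \<Gamma>" and Q: "par h' w' \<in> \<Gamma>" and D: "det2 w w' \<noteq> 0"
    and h: "h \<noteq> 0" "h' \<noteq> 0"
  shows "1 \<le> \<bar>h * h'\<bar> * (det2 w w')\<^sup>2"
proof (rule ccontr)
  assume "\<not> ?thesis"
  then have r1: "\<bar>h * h'\<bar> * (det2 w w')\<^sup>2 < 1" by simp
  define r where "r = \<bar>h * h'\<bar> * (det2 w w')\<^sup>2"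
  have r: "0 \<le> r" "r < 1" using r1 by (auto simp: r_def)
  \<comment> \<open>\<open>par h (f 0)\<close> is the conjugate of the first parabolic by the
    second, and each later one is the conjugate of \<open>par h w\<close> by its predecessor; only
    the fixed vectors have to be tracked.\<close>
  define f where "f = rec_nat (par h' w' *v w) (\<lambda>_ u. par h u *v w)"
  have f: "f 0 = par h' w' *v w" "f (Suc n) = par h (f n) *v w" for n by (simp_all add: f_def)
  have fS: "f (Suc n) = w + (h * det2 (f n) w) *s f n" for n by (simp add: f par_apply)
  have in\<Gamma>: "par h (f n) \<in> \<Gamma>" for n
    by (induction n) (auto simp: f par_conj[OF par_SL2, symmetric] intro!: subgroup_conj G P Q)
  have anti: "det2 x y = - det2 y x" for x y by (simp add: det2_def)
  have lin: "det2 w (w + c *s u) = c * det2 w u" for c u by (simp add: det2_def algebra_simps)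
  \<comment> \<open>Up to sign this quantity is squared at every step, and it starts with absolute
    value r < 1: it tends to zero without ever vanishing.\<close>
  define d where "d n = h * det2 w (f n)" for n
  have "d 0 = h * (h' * det2 w' w * det2 w w')" by (simp add: d_def f par_apply lin)
  then have "d 0 = - (h * h' * (det2 w w')\<^sup>2)" by (simp add: anti[of w' w] power2_eq_square)
  then have d0: "\<bar>d 0\<bar> = r" "d 0 \<noteq> 0" using D h by (simp_all add: r_def abs_mult)
  have dS: "d (Suc n) = - (d n)\<^sup>2" for n
  proof -
    have "d (Suc n) = h * (h * det2 (f n) w * det2 w (f n))" by (simp add: d_def fS lin)
    then show ?thesis by (simp add: anti[of "f n" w] d_def power2_eq_square)
  qed
  have dnz: "d n \<noteq> 0" for n by (induction n) (use d0 in \<open>auto simp: dS\<close>)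
  have dr: "\<bar>d n\<bar> \<le> r * r ^ n" for n
  proof (induction n)
    case (Suc n)
    have "\<bar>d (Suc n)\<bar> = \<bar>d n\<bar> * \<bar>d n\<bar>" by (simp add: dS power2_eq_square abs_mult)
    also have "\<dots> \<le> (r * r ^ n) * (r * r^n)" by (intro mult_mono Suc) (use r in auto)
    also have "\<dots> \<le> (r * r ^ n) * (r * 1)"
      using r by (intro mult_left_mono) (auto simp: power_le_one)
    finally show ?case by (simp add: mult_ac)
  qed (use d0 in simp)
  have fS': "f (Suc n) = w - d n *s f n" for n
    using anti[of "f n" w] by (simp add: fS d_def vec2_eq_iff)
  \<comment> \<open>The recursion bounds the next norm by \<open>norm w\<close> plus r times the
    present one, and \<open>norm w / (1 - r)\<close> is the fixed point of this bound.\<close>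
  define M where "M = max (norm (f 0)) (norm w / (1 - r))"
  have M: "norm (f n) \<le> M" for n
  proof (induction n)
    case (Suc n)
    have dnr: "\<bar>d n\<bar> \<le> r" using dr[of n] r mult_left_le[of "r^n" r] by (simp add: power_le_one)
    have "norm (f (Suc n)) \<le> norm w + norm (d n *\<^sub>R f n)"
      unfolding fS' scalar_mult_eq_scaleR by (rule norm_triangle_ineq4)
    also have "\<dots> \<le> norm w + r * M" using dnr Suc r by (auto intro!: mult_mono)
    also have "norm w \<le> (1 - r) * M"
      using r by (auto simp: M_def max_def field_simps)
    finally show ?case by (simp add: algebra_simps)
  qed (simp add: M_def)
  have d_lim: "d \<longlonglongrightarrow> 0"
  proof (rule Lim_null_comparison)
    show "\<forall>\<^sub>F n in sequentially. norm (d n) \<le> r * r^n" using dr by simp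
    show "(\<lambda>n. r * r^n) \<longlonglongrightarrow> 0" using r by (intro tendsto_mult_right_zero LIMSEQ_realpow_zero)
  qed
  have "(\<lambda>n. d n *s f n) \<longlonglongrightarrow> 0"
  proof (rule Lim_null_comparison)
    show "\<forall>\<^sub>F n in sequentially. norm (d n *s f n) \<le> \<bar>d n\<bar> * M"
      using M by (auto simp: scalar_mult_eq_scaleR mult_left_mono)
    show "(\<lambda>n. \<bar>d n\<bar> * M) \<longlonglongrightarrow> 0" using tendsto_mult_left_zero[OF tendsto_rabs_zero[OF d_lim]] by simp
  qed
  then have "(\<lambda>n. w - d n *s f n) \<longlonglongrightarrow> w - 0" by (intro tendsto_diff tendsto_const)
  then have "(\<lambda>n. f (Suc n)) \<longlonglongrightarrow> w" by (simp add: fS')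
  then have lim: "(\<lambda>n. par h (f (Suc n))) \<longlonglongrightarrow> par h w" by (rule tendsto_par)
  obtain e where e: "e > 0" "\<And>g. g \<in> \<Gamma> \<Longrightarrow> dist g (par h w) < e \<Longrightarrow> g = par h w"
    using G(2) P unfolding discrete_set_def by blast
  obtain n where "dist (par h (f (Suc n))) (par h w) < e"
    using lim e(1) unfolding lim_sequentially by blast
  then have "par h (f (Suc n)) = par h w" using e(2) in\<Gamma> by blast
  \<comment> \<open>\<open>par h w\<close> fixes w, whereas \<open>par h (f (Suc n))\<close> moves
    it, because w and f (Suc n) are not parallel.\<close>
  then have "par h (f (Suc n)) *v w = par h w *v w" by simp
  then have "(h * det2 (f (Suc n)) w) *s f (Suc n) = 0" by (simp add: par_apply det2_def)
  moreover have "det2 (f (Suc n)) w \<noteq> 0" using dnz[of "Suc n"] anti[of w "f (Suc n)"] by (auto simp: d_def)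
  moreover then have "f (Suc n) \<noteq> 0" by (auto simp: det2_def)
  ultimately show False using h by (simp add: vector_mul_eq_0)
qed

section \<open>Separation of the orbits of cusp vectors\<close>

definition orbit :: "(real^2^2) set \<Rightarrow> real^2^2 \<Rightarrow> (real^2) set" where
  "orbit \<Gamma> s = (\<lambda>\<gamma>. (\<gamma> ** s) *v e1) ` \<Gamma>"

text \<open>The exemption of - w is forced by -I in the lattice, which puts both signs into every
  orbit. Closure under negation lets later arguments assume first coordinates to be
  positive.\<close>

definition separated :: "real \<Rightarrow> (real^2) set \<Rightarrow> bool" where
  "separated c W \<longleftrightarrow> 0 < c \<and> 0 \<notin> W \<and> (\<forall>w\<in>W. - w \<in> W) \<and>
     (\<forall>w\<in>W. \<forall>w'\<in>W. w' = w \<or> w' = - w \<or> c \<le> \<bar>det2 w w'\<bar>)"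

lemma parallel_if_det2_0:
  assumes "det2 v w = 0" "v \<noteq> 0"
  obtains c where "w = c *s v"
proof (cases "v$1 = 0")
  case True
  then have "v$2 \<noteq> 0" using assms by (auto simp: vec2_eq_iff)
  then show ?thesis using assms True by (intro that[of "w$2 / v$2"]) (auto simp: vec2_eq_iff det2_def)
next
  case False
  then show ?thesis using assms by (intro that[of "w$1 / v$1"]) (auto simp: vec2_eq_iff det2_def field_simps)
qed

lemma SL2_apply_nonzero:
  assumes "g \<in> SL2" "v \<noteq> 0" shows "g *v v \<noteq> 0"
proof
  assume "g *v v = 0"
  then have "matrix_inv g *v (g *v v) = 0" by simp
  then show False using assms by (simp add: matrix_vector_mul_assoc SL2_inv_cancel)
qed

lemma e1_nonzero: "e1 \<noteq> 0" by (simp add: vec2_eq_iff)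

text \<open>Conjugation by \<delta> multiplies the parameter of a parabolic at the cusp vector by
  c^2, and the parameters that occur in the lattice are the multiples of h. So c^2 is an integer,
  and the inverse of \<delta> shows the same for its reciprocal.\<close>

lemma cusp_stabilizer:
  assumes G: "mat_subgroup \<Gamma>" and s: "cusp_normalizer \<Gamma> s"
    and \<delta>: "\<delta> \<in> \<Gamma>" "\<delta> *v (s *v e1) = c *s (s *v e1)"
  shows "c = 1 \<or> c = -1"
proof -
  have sS: "s \<in> SL2" and sub: "\<Gamma> \<subseteq> SL2" using s G by (auto simp: cusp_normalizer_def mat_subgroup_def)
  obtain h where h: "h > 0" "\<And>t. par t (s *v e1) \<in> \<Gamma> \<longleftrightarrow> (\<exists>n::int. t = of_int n * h)"
    using s by (auto simp: cusp_normalizer_def umat_conj)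
  have int: "c'\<^sup>2 \<in> \<int>" if "\<delta>' \<in> \<Gamma>" "\<delta>' *v (s *v e1) = c' *s (s *v e1)" for \<delta>' c'
  proof -
    have "par h (s *v e1) \<in> \<Gamma>" using h(2)[of h] by (metis mult_1 of_int_1)
    then have "par h (\<delta>' *v (s *v e1)) \<in> \<Gamma>"
      using subgroup_conj[OF G that(1)] par_conj[of \<delta>'] that(1) sub by (metis subsetD)
    then have "par (c'\<^sup>2 * h) (s *v e1) \<in> \<Gamma>" by (simp add: that par_scale)
    then show ?thesis using h by auto
  qed
  have inv: "matrix_inv \<delta> \<in> \<Gamma>" using \<delta> G by (simp add: mat_subgroup_def)
  have \<delta>S: "\<delta> \<in> SL2" using \<delta> sub by auto
  have c0: "c \<noteq> 0" using \<delta>(2) SL2_apply_nonzero[OF \<delta>S SL2_apply_nonzero[OF sS e1_nonzero]] by auto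
  have "matrix_inv \<delta> *v (c *s (s *v e1)) = s *v e1"
    unfolding \<delta>(2)[symmetric] using \<delta>S by (simp add: matrix_vector_mul_assoc SL2_inv_cancel matrix_mul_assoc)
  then have "c *s (matrix_inv \<delta> *v (s *v e1)) = s *v e1" by (simp add: matrix_vector_mult_scaleR scalar_mult_eq_scaleR)
  then have "matrix_inv \<delta> *v (s *v e1) = inverse c *s (s *v e1)"
    using c0 by (auto simp: vec2_eq_iff field_simps)
  from int[OF inv this] int[OF \<delta>] obtain m n :: int where mn: "c\<^sup>2 = m" "(inverse c)\<^sup>2 = n"
    by (auto elim!: Ints_cases)
  have "c\<^sup>2 * (inverse c)\<^sup>2 = 1" using c0 by (simp add: power_mult_distrib[symmetric])
  then have "real_of_int (m * n) = 1" using mn by simp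
  then have "m * n = 1" by linarith
  moreover have "0 \<le> m" using mn(1) by (metis of_int_0_le_iff zero_le_power2)
  ultimately have "m = 1" by (metis pos_zmult_eq_1_iff zmult_eq_1_iff neg_0_le_iff_le not_one_le_zero)
  then show ?thesis using mn(1) by (simp add: power2_eq_1_iff)
qed

lemma orbit_uminus:
  assumes G: "mat_subgroup \<Gamma>" "- mat 1 \<in> \<Gamma>" and w: "w \<in> orbit \<Gamma> s"
  shows "- w \<in> orbit \<Gamma> s"
proof -
  obtain \<gamma> where \<gamma>: "\<gamma> \<in> \<Gamma>" "w = (\<gamma> ** s) *v e1" using w by (auto simp: orbit_def)
  have "- mat 1 ** \<gamma> \<in> \<Gamma>" using G \<gamma> by (simp add: mat_subgroup_def)
  moreover have "- w = (- mat 1 ** \<gamma> ** s) *v e1"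
    by (simp add: \<gamma> vec2_eq_iff matrix_vector_component2 matrix_mult_component2 mat_def)
  ultimately show ?thesis unfolding orbit_def by blast
qed

text \<open>Parallel vectors belong to the same cusp by inequivalence, and then differ by a sign by
  \<open>cusp_stabilizer\<close>. All other pairs, also across different cusps, obey Shimizu's
  inequality; a common bound H for the cusp widths yields the constant 1/H.\<close>

lemma orbit_separated:
  assumes G: "mat_subgroup \<Gamma>" "discrete_set \<Gamma>" "- mat 1 \<in> \<Gamma>"
    and cusp: "complete_cusp_system \<Gamma> k \<sigma>"
  obtains c where "separated c (\<Union>j<k. orbit \<Gamma> (\<sigma> j))"
proof -
  have sub: "\<Gamma> \<subseteq> SL2" using G by (simp add: mat_subgroup_def)
  have cn: "cusp_normalizer \<Gamma> (\<sigma> j)" if "j < k" for j using cusp that by (simp add: complete_cusp_system_def)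
  then have \<sigma>S: "\<sigma> j \<in> SL2" if "j < k" for j using that by (simp add: cusp_normalizer_def)
  have "\<forall>j. \<exists>h>0. j < k \<longrightarrow> par h (\<sigma> j *v e1) \<in> \<Gamma>"
  proof (intro allI)
    fix j show "\<exists>h>0. j < k \<longrightarrow> par h (\<sigma> j *v e1) \<in> \<Gamma>"
    proof (cases "j < k")
      case True
      then obtain h where h: "h > 0" "\<And>t. par t (\<sigma> j *v e1) \<in> \<Gamma> \<longleftrightarrow> (\<exists>n::int. t = of_int n * h)"
        using cn[OF True] by (auto simp: cusp_normalizer_def umat_conj)
      then show ?thesis by (metis mult_1 of_int_1)
    qed (auto intro: exI[of _ 1])
  qed
  then obtain h where h: "\<And>j. h j > 0" "\<And>j. j < k \<Longrightarrow> par (h j) (\<sigma> j *v e1) \<in> \<Gamma>" by metis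
  define H where "H = (\<Sum>j<k. h j) + 1"
  have H: "0 < h j" "h j \<le> H" if "j < k" for j
    using h that member_le_sum[of j "{..<k}" h] by (auto simp: H_def less_imp_le add_increasing2)
  have H0: "H > 0" using h by (simp add: H_def add_nonneg_pos sum_nonneg less_imp_le)
  have orb: "\<exists>\<gamma>\<in>\<Gamma>. w = \<gamma> *v (\<sigma> j *v e1)" if "w \<in> orbit \<Gamma> (\<sigma> j)" for w j
    using that by (auto simp: orbit_def matrix_vector_mul_assoc)
  have par\<Gamma>: "par (h j) w \<in> \<Gamma>" if w: "w \<in> orbit \<Gamma> (\<sigma> j)" "j < k" for w j
  proof -
    obtain \<gamma> where "\<gamma> \<in> \<Gamma>" "w = \<gamma> *v (\<sigma> j *v e1)" using orb[OF w(1)] by blast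
    then show ?thesis using subgroup_conj[OF G(1) _ h(2)[OF w(2)], of \<gamma>] par_conj[of \<gamma>] sub
      by (auto dest: subsetD)
  qed
  have nz: "w \<noteq> 0" if w: "w \<in> orbit \<Gamma> (\<sigma> j)" "j < k" for w j
    using orb[OF w(1)] sub SL2_apply_nonzero e1_nonzero \<sigma>S[OF w(2)] by (metis subsetD)
  have uminus: "- w \<in> orbit \<Gamma> (\<sigma> j)" if "w \<in> orbit \<Gamma> (\<sigma> j)" for w j
    using orbit_uminus[OF G(1,3) that] .
  have par: "w' = w \<or> w' = - w"
    if w: "w \<in> orbit \<Gamma> (\<sigma> i)" "i < k" and w': "w' \<in> orbit \<Gamma> (\<sigma> j)" "j < k" and 0: "det2 w w' = 0" for w w' i j
  proof -
    obtain c where c: "w' = c *s w" using parallel_if_det2_0[OF 0 nz[OF w]] by blast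
    obtain \<gamma> where \<gamma>: "\<gamma> \<in> \<Gamma>" "w = \<gamma> *v (\<sigma> i *v e1)" using orb[OF w(1)] by blast
    obtain \<gamma>' where \<gamma>': "\<gamma>' \<in> \<Gamma>" "w' = \<gamma>' *v (\<sigma> j *v e1)" using orb[OF w'(1)] by blast
    let ?d = "matrix_inv \<gamma> ** \<gamma>'"
    have \<gamma>S: "\<gamma> \<in> SL2" using \<gamma> sub by auto
    have d: "?d \<in> \<Gamma>" using G(1) \<gamma> \<gamma>' by (simp add: mat_subgroup_def)
    have "matrix_inv \<gamma> *v w' = c *s (matrix_inv \<gamma> *v w)"
      by (simp add: c matrix_vector_mult_scaleR scalar_mult_eq_scaleR)
    moreover have "matrix_inv \<gamma> *v w = \<sigma> i *v e1"
      using \<gamma>S by (simp add: \<gamma> matrix_vector_mul_assoc SL2_inv_cancel matrix_mul_assoc)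
    ultimately have eq: "?d *v (\<sigma> j *v e1) = c *s (\<sigma> i *v e1)"
      by (simp add: \<gamma>' matrix_vector_mul_assoc matrix_mul_assoc)
    then have "i = j"
      using cusp w(2) w'(2) d unfolding complete_cusp_system_def
      by (metis matrix_vector_mul_assoc)
    then have "c = 1 \<or> c = -1" using cusp_stabilizer[OF G(1) cn[OF w(2)] d] eq by simp
    then show ?thesis using c by (auto simp: vec2_eq_iff)
  qed
  have det: "1 / H \<le> \<bar>det2 w w'\<bar>"
    if w: "w \<in> orbit \<Gamma> (\<sigma> i)" "i < k" and w': "w' \<in> orbit \<Gamma> (\<sigma> j)" "j < k" and nz: "det2 w w' \<noteq> 0" for w w' i j
  proof -
    have "1 \<le> \<bar>h i * h j\<bar> * (det2 w w')\<^sup>2"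
      by (rule shimizu[OF G(1,2) par\<Gamma>[OF w] par\<Gamma>[OF w'] nz]) (use h(1)[of i] h(1)[of j] in auto)
    also have "\<dots> \<le> (H * H) * (det2 w w')\<^sup>2"
      using H w w' H0 by (intro mult_right_mono) (auto simp: abs_mult less_imp_le intro!: mult_mono)
    finally have "1\<^sup>2 \<le> (H * \<bar>det2 w w'\<bar>)\<^sup>2" by (simp add: power2_eq_square mult_ac)
    then have "1 \<le> H * \<bar>det2 w w'\<bar>" by (rule power2_le_imp_le) (use H0 in simp)
    then show ?thesis using H0 by (simp add: field_simps)
  qed
  have "separated (1 / H) (\<Union>j<k. orbit \<Gamma> (\<sigma> j))"
    unfolding separated_def using H0 nz uminus par det by (auto 0 0; blast)
  then show ?thesis by (rule that)
qed

lemma separated_subset: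
  assumes "separated c W" "W' \<subseteq> W" "\<And>w. w \<in> W' \<Longrightarrow> - w \<in> W'"
  shows "separated c W'"
  using assms unfolding separated_def by (intro conjI ballI; blast)

lemma det2_le_norm: "\<bar>det2 v w\<bar> \<le> 2 * norm v * norm w"
proof -
  have "\<bar>det2 v w\<bar> \<le> \<bar>v$1\<bar> * \<bar>w$2\<bar> + \<bar>v$2\<bar> * \<bar>w$1\<bar>"
    unfolding det2_def by (metis abs_mult abs_triangle_ineq4)
  also have "\<dots> \<le> norm v * norm w + norm v * norm w"
    by (intro add_mono mult_mono component_le_norm_cart) auto
  finally show ?thesis by simp
qed

text \<open>Infinitely many vectors in a disc accumulate, and nearby vectors span a small area
  because det2 w w' = det2 w (w' - w).\<close>

lemma separated_finite:
  assumes W: "separated c W"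
  shows "finite (W \<inter> cball 0 R)"
proof (rule ccontr)
  assume inf: "infinite (W \<inter> cball 0 R)"
  have R: "0 \<le> R" using inf by (metis cball_empty finite.emptyI inf_bot_right linorder_not_le)
  obtain x where x: "x islimpt (W \<inter> cball 0 R)"
    by (rule bounded_infinite_imp_islimpt[OF order_refl _ inf]) (simp add: bounded_Int)
  have c: "c > 0" using W by (simp add: separated_def)
  \<comment> \<open>Two vectors of the disc that lie in a common ball of radius e span at most 4 (R
    + 1) e = c/2.\<close>
  define e where "e = c / (8 * (R + 1))"
  have e: "e > 0" using c R by (simp add: e_def)
  have inf': "infinite (W \<inter> cball 0 R \<inter> ball x e)"
    using x e islimpt_eq_infinite_ball by blast
  then obtain w where w: "w \<in> W \<inter> cball 0 R \<inter> ball x e" by (metis all_not_in_conv finite.emptyI)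
  have "infinite (W \<inter> cball 0 R \<inter> ball x e - {w, -w})" using inf' by simp
  then obtain w' where w': "w' \<in> W \<inter> cball 0 R \<inter> ball x e" "w' \<noteq> w" "w' \<noteq> -w"
    by (metis DiffE all_not_in_conv finite.emptyI insertCI)
  have "c \<le> \<bar>det2 w w'\<bar>" using W w w' unfolding separated_def by blast
  also have "det2 w w' = det2 w (w' - w)" by (simp add: det2_def algebra_simps)
  also have "\<bar>\<dots>\<bar> \<le> 2 * norm w * norm (w' - w)" by (rule det2_le_norm)
  also have "norm (w' - w) \<le> e + e"
    using w w' dist_triangle_half_r[of x w' "2*e" w] by (auto simp: dist_norm norm_minus_commute)
  also have "2 * norm w * (e + e) \<le> 2 * (R + 1) * (e + e)"
    using w e by (intro mult_right_mono) auto
  also have "\<dots> = c / 2"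
  proof -
    have "e * (8 * (R + 1)) = c" using R by (simp add: e_def)
    then show ?thesis by (simp add: algebra_simps)
  qed
  finally show False using c e by (simp add: mult_left_mono)
qed

lemma separated_countable:
  assumes W: "separated c W"
  shows "countable W"
proof -
  have "W \<subseteq> (\<Union>n::nat. W \<inter> cball 0 (real n))"
  proof
    fix w assume "w \<in> W"
    moreover obtain n where "norm w \<le> real n" using real_arch_simple by blast
    ultimately show "w \<in> (\<Union>n::nat. W \<inter> cball 0 (real n))" by auto
  qed
  moreover have "countable (\<Union>n::nat. W \<inter> cball 0 (real n))"
    by (rule countable_UN) (auto intro: countable_finite separated_finite[OF W])
  ultimately show ?thesis by (rule countable_subset)
qed

section \<open>Reduction to directions\<close>

text \<open>The expressions are the coordinates of g^(-1) w for unimodular g, written through the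
  entries of g.\<close>

definition dioph_for :: "(real^2) set \<Rightarrow> real \<Rightarrow> real^2^2 \<Rightarrow> bool" where
  "dioph_for W \<kappa> g \<longleftrightarrow> (\<exists>\<mu>>0. \<exists>\<nu>>0. \<forall>w\<in>W. \<mu> \<le> \<bar>g$1$1 * w$2 - g$2$1 * w$1\<bar> \<or>
     \<nu> \<le> \<bar>g$2$2 * w$1 - g$1$2 * w$2\<bar> powr \<kappa> * \<bar>g$1$1 * w$2 - g$2$1 * w$1\<bar>)"

text \<open>This is the condition for the lower unipotent matrix with first column (1,
  \<xi>).\<close>

definition dir_dioph :: "(real^2) set \<Rightarrow> real \<Rightarrow> real \<Rightarrow> bool" where
  "dir_dioph W \<kappa> \<xi> \<longleftrightarrow> (\<exists>\<mu>>0. \<exists>\<nu>>0. \<forall>w\<in>W. \<mu> \<le> \<bar>w$2 - \<xi> * w$1\<bar> \<or>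
     \<nu> \<le> \<bar>w$1\<bar> powr \<kappa> * \<bar>w$2 - \<xi> * w$1\<bar>)"

lemma diophantine_iff:
  assumes "g \<in> SL2"
  shows "diophantine \<Gamma> k \<sigma> \<kappa> g \<longleftrightarrow> (\<forall>j<k. dioph_for (orbit \<Gamma> (\<sigma> j)) (\<kappa> j) g)"
proof -
  have eq: "(matrix_inv g ** \<gamma> ** s) *v e1 = matrix_inv g *v ((\<gamma> ** s) *v e1)" for \<gamma> s
    by (simp add: matrix_vector_mul_assoc matrix_mul_assoc)
  have c: "(matrix_inv g *v w)$1 = g$2$2 * w$1 - g$1$2 * w$2"
    "(matrix_inv g *v w)$2 = g$1$1 * w$2 - g$2$1 * w$1" for w
    by (simp_all add: matrix_vector_component2 matrix_inv_SL2[OF assms])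
  show ?thesis
    unfolding diophantine_def dioph_for_def orbit_def Let_def eq c ball_simps ..
qed

text \<open>Once |y| is below a small threshold, the Diophantine inequality itself makes |x| large
  compared with |y|, so adding a multiple of y costs at most half of \<alpha> x.\<close>

lemma dioph_linear_transfer:
  fixes x y x' y' :: "'w \<Rightarrow> real"
  assumes \<alpha>: "\<alpha> \<noteq> 0" and \<gamma>: "\<gamma> \<noteq> 0" and \<kappa>: "0 < \<kappa>"
    and D: "\<exists>\<mu>>0. \<exists>\<nu>>0. \<forall>w\<in>W. \<mu> \<le> \<bar>y w\<bar> \<or> \<nu> \<le> \<bar>x w\<bar> powr \<kappa> * \<bar>y w\<bar>"
    and x': "\<And>w. x' w = \<alpha> * x w + \<beta> * y w" and y': "\<And>w. y' w = \<gamma> * y w"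
  shows "\<exists>\<mu>>0. \<exists>\<nu>>0. \<forall>w\<in>W. \<mu> \<le> \<bar>y' w\<bar> \<or> \<nu> \<le> \<bar>x' w\<bar> powr \<kappa> * \<bar>y' w\<bar>"
proof -
  obtain \<mu> \<nu> where \<mu>: "\<mu> > 0" and \<nu>: "\<nu> > 0"
    and D: "\<And>w. w \<in> W \<Longrightarrow> \<mu> \<le> \<bar>y w\<bar> \<or> \<nu> \<le> \<bar>x w\<bar> powr \<kappa> * \<bar>y w\<bar>" using D by blast
  \<comment> \<open>K |\<alpha>| exceeds 2 |\<beta>|, and the threshold \<open>\<delta>\<close> is
    so small that |x| < K |y| would violate the lower bound \<nu>.\<close>
  define K where "K = 2 * \<bar>\<beta>\<bar> / \<bar>\<alpha>\<bar> + 1"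
  have K: "K > 0" by (simp add: K_def add_nonneg_pos)
  define \<delta> where "\<delta> = min 1 (min \<mu> (\<nu> / K powr \<kappa>))"
  have \<delta>: "\<delta> > 0" using \<mu> \<nu> K by (simp add: \<delta>_def)
  have main: "\<bar>\<gamma>\<bar> * \<delta> \<le> \<bar>y' w\<bar> \<or> (\<bar>\<alpha>\<bar> / 2) powr \<kappa> * (\<bar>\<gamma>\<bar> * \<nu>) \<le> \<bar>x' w\<bar> powr \<kappa> * \<bar>y' w\<bar>" if w: "w \<in> W" for w
  proof (cases "\<delta> \<le> \<bar>y w\<bar>")
    case True
    then show ?thesis by (auto simp: y' abs_mult mult_left_mono)
  next
    case False
    then have y: "\<bar>y w\<bar> < 1" "\<bar>y w\<bar> < \<mu>" "\<bar>y w\<bar> < \<nu> / K powr \<kappa>" by (auto simp: \<delta>_def)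
    then have \<nu>': "\<nu> \<le> \<bar>x w\<bar> powr \<kappa> * \<bar>y w\<bar>" using D[OF w] by auto
    have "K * \<bar>y w\<bar> \<le> \<bar>x w\<bar>"
    proof (rule ccontr)
      assume "\<not> ?thesis"
      then have "\<bar>x w\<bar> \<le> K * 1" using y K mult_left_mono[of "\<bar>y w\<bar>" 1 K] by linarith
      then have "\<bar>x w\<bar> powr \<kappa> * \<bar>y w\<bar> \<le> K powr \<kappa> * \<bar>y w\<bar>"
        using \<kappa> by (intro mult_right_mono powr_mono2) auto
      also have "\<dots> < \<nu>" using y(3) K by (simp add: field_simps)
      finally show False using \<nu>' by simp
    qed
    moreover have "\<bar>\<alpha>\<bar> * (K * \<bar>y w\<bar>) = 2 * (\<bar>\<beta>\<bar> * \<bar>y w\<bar>) + \<bar>\<alpha>\<bar> * \<bar>y w\<bar>"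
      using \<alpha> by (simp add: K_def field_simps)
    ultimately have "2 * (\<bar>\<beta>\<bar> * \<bar>y w\<bar>) \<le> \<bar>\<alpha>\<bar> * \<bar>x w\<bar>"
      using mult_left_mono[of "K * \<bar>y w\<bar>" "\<bar>x w\<bar>" "\<bar>\<alpha>\<bar>"] mult_nonneg_nonneg[of "\<bar>\<alpha>\<bar>" "\<bar>y w\<bar>"] by linarith
    moreover have "\<bar>\<alpha>\<bar> * \<bar>x w\<bar> - \<bar>\<beta>\<bar> * \<bar>y w\<bar> \<le> \<bar>x' w\<bar>"
      unfolding x' by (metis abs_mult abs_triangle_ineq2 abs_minus_cancel diff_minus_eq_add)
    ultimately have "\<bar>\<alpha>\<bar> / 2 * \<bar>x w\<bar> \<le> \<bar>x' w\<bar>" by simp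
    then have "(\<bar>\<alpha>\<bar> / 2 * \<bar>x w\<bar>) powr \<kappa> \<le> \<bar>x' w\<bar> powr \<kappa>"
      using \<kappa> by (intro powr_mono2) auto
    then have "(\<bar>\<alpha>\<bar> / 2) powr \<kappa> * \<bar>x w\<bar> powr \<kappa> \<le> \<bar>x' w\<bar> powr \<kappa>"
      unfolding powr_mult .
    then have "(\<bar>\<alpha>\<bar> / 2) powr \<kappa> * \<bar>x w\<bar> powr \<kappa> * (\<bar>\<gamma>\<bar> * \<bar>y w\<bar>) \<le> \<bar>x' w\<bar> powr \<kappa> * \<bar>y' w\<bar>"
      by (simp add: y' abs_mult mult_right_mono)
    moreover have "(\<bar>\<alpha>\<bar> / 2) powr \<kappa> * (\<bar>\<gamma>\<bar> * \<nu>) \<le> (\<bar>\<alpha>\<bar> / 2) powr \<kappa> * (\<bar>\<gamma>\<bar> * (\<bar>x w\<bar> powr \<kappa> * \<bar>y w\<bar>))"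
      by (intro mult_left_mono \<nu>') auto
    ultimately show ?thesis by (simp add: mult_ac)
  qed
  show ?thesis
    using main \<gamma> \<alpha> \<delta> \<nu>
    by (intro exI[of _ "\<bar>\<gamma>\<bar> * \<delta>"] conjI exI[of _ "(\<bar>\<alpha>\<bar> / 2) powr \<kappa> * (\<bar>\<gamma>\<bar> * \<nu>)"] ballI)
       auto
qed

text \<open>A matrix with nonzero first entry is the lower unipotent matrix of slope \<xi> times an
  upper triangular one. The inverse of the triangular factor rescales the second coordinate and adds
  a multiple of it to the rescaled first one.\<close>

lemma dioph_for_iff_dir:
  assumes g: "g \<in> SL2" "g$1$1 \<noteq> 0" and \<kappa>: "0 < \<kappa>"
  shows "dioph_for W \<kappa> g \<longleftrightarrow> dir_dioph W \<kappa> (g$2$1 / g$1$1)"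
proof -
  let ?p = "g$1$1" and ?q = "g$1$2" and ?\<xi> = "g$2$1 / g$1$1"
  have g22: "g$2$2 = 1 / ?p + ?\<xi> * ?q" using g by (simp add: SL2_iff field_simps)
  show ?thesis
  proof
    assume "dioph_for W \<kappa> g"
    then show "dir_dioph W \<kappa> ?\<xi>"
      unfolding dioph_for_def dir_dioph_def
      by (rule dioph_linear_transfer[where \<alpha>="?p" and \<gamma>="1/?p" and \<beta>="?q", rotated 3])
         (use g \<kappa> in \<open>auto simp: g22 field_simps\<close>)
  next
    assume "dir_dioph W \<kappa> ?\<xi>"
    then show "dioph_for W \<kappa> g"
      unfolding dioph_for_def dir_dioph_def
      by (rule dioph_linear_transfer[where \<alpha>="1/?p" and \<gamma>="?p" and \<beta>="-?q", rotated 3])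
         (use g \<kappa> in \<open>auto simp: g22 field_simps\<close>)
  qed
qed

section \<open>Sets of directions times a plane\<close>

lemma norm_mat2_le:
  "norm (A :: real^2^2) \<le> \<bar>A$1$1\<bar> + \<bar>A$1$2\<bar> + \<bar>A$2$1\<bar> + \<bar>A$2$2\<bar>"
proof -
  have v: "norm (v :: real^2) \<le> \<bar>v$1\<bar> + \<bar>v$2\<bar>" for v
    using norm_le_l1_cart[of v] by (simp add: sum_2)
  have "norm A \<le> norm (A$1) + norm (A$2)"
    using L2_set_le_sum[of UNIV "\<lambda>i. norm (A$i)"] unfolding norm_vec_def[of A] by (simp add: sum_2)
  then show ?thesis using v[of "A$1"] v[of "A$2"] by linarith
qed

lemma mat2_component_dist: "\<bar>(A :: real^2^2)$i$j - B$i$j\<bar> \<le> dist A B"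
proof -
  have "\<bar>(A - B)$i$j\<bar> \<le> norm ((A - B)$i)" by (rule component_le_norm_cart)
  also have "\<dots> \<le> norm (A - B)" by (rule Finite_Cartesian_Product.norm_nth_le)
  finally show ?thesis by (simp add: dist_norm)
qed

text \<open>The lower unipotent matrix of slope \<xi> times the upper triangular matrix with first
  row (p, q); only the middle coordinate matters for the Diophantine condition.\<close>

definition chart :: "real \<times> real \<times> real \<Rightarrow> real^2^2" where
  "chart t = (case t of (p, \<xi>, q) \<Rightarrow> mat2 p q (p * \<xi>) (1 / p + \<xi> * q))"

lemma chart_SL2: "p \<noteq> 0 \<Longrightarrow> chart (p, \<xi>, q) \<in> SL2"
  by (simp add: chart_def SL2_iff field_simps)

lemma chart_coordinates:
  assumes "g \<in> SL2" "g$1$1 \<noteq> 0"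
  shows "g = chart (g$1$1, g$2$1 / g$1$1, g$1$2)"
  using assms by (simp add: chart_def mat2_eq_iff SL2_iff field_simps)

lemma chart_lipschitz:
  assumes M: "M > 0" and x: "1/M \<le> \<bar>p\<bar>" "\<bar>p\<bar> \<le> M" "\<bar>\<xi>\<bar> \<le> M" "\<bar>q\<bar> \<le> M"
    and y: "1/M \<le> \<bar>p'\<bar>" "\<bar>p'\<bar> \<le> M" "\<bar>\<xi>'\<bar> \<le> M" "\<bar>q'\<bar> \<le> M"
  shows "dist (chart (p, \<xi>, q)) (chart (p', \<xi>', q')) \<le> (2 + 4 * M + M\<^sup>2) * dist (p, \<xi>, q) (p', \<xi>', q')"
proof -
  define D where "D = dist (p, \<xi>, q) (p', \<xi>', q')"
  have "dist p p' \<le> D" "dist (\<xi>, q) (\<xi>', q') \<le> D"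
    using dist_fst_le[of "(p, \<xi>, q)" "(p', \<xi>', q')"] dist_snd_le[of "(p, \<xi>, q)" "(p', \<xi>', q')"]
    by (simp_all add: D_def)
  moreover from this(2) have "dist \<xi> \<xi>' \<le> D" "dist q q' \<le> D"
    using dist_fst_le[of "(\<xi>, q)" "(\<xi>', q')"] dist_snd_le[of "(\<xi>, q)" "(\<xi>', q')"] by simp_all
  ultimately have D: "\<bar>p - p'\<bar> \<le> D" "\<bar>\<xi> - \<xi>'\<bar> \<le> D" "\<bar>q - q'\<bar> \<le> D" by (simp_all add: dist_real_def)
  have prod: "\<bar>a * b - a' * b'\<bar> \<le> M * D + M * D"
    if "\<bar>a - a'\<bar> \<le> D" "\<bar>b - b'\<bar> \<le> D" "\<bar>a\<bar> \<le> M" "\<bar>b'\<bar> \<le> M" for a b a' b'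
  proof -
    have "a * b - a' * b' = a * (b - b') + (a - a') * b'" by (simp add: algebra_simps)
    then have "\<bar>a * b - a' * b'\<bar> \<le> \<bar>a\<bar> * \<bar>b - b'\<bar> + \<bar>a - a'\<bar> * \<bar>b'\<bar>"
      by (metis abs_mult abs_triangle_ineq)
    also have "\<dots> \<le> M * D + D * M" using that by (intro add_mono mult_mono) auto
    finally show ?thesis by (simp add: mult.commute)
  qed
  have p0: "p \<noteq> 0" "p' \<noteq> 0" using x y M by (auto simp: field_simps)
  have inv: "\<bar>1 / p - 1 / p'\<bar> \<le> M\<^sup>2 * D"
  proof -
    have "\<bar>1 / p - 1 / p'\<bar> = (1 / \<bar>p\<bar>) * (1 / \<bar>p'\<bar>) * \<bar>p - p'\<bar>"
    proof -
      have "1 / p - 1 / p' = (1 / p) * (1 / p') * (p' - p)" using p0 by (simp add: field_simps)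
      then show ?thesis by (simp only: abs_mult abs_divide abs_one abs_minus_commute)
    qed
    also have "\<dots> \<le> M * M * D"
      using x y M D p0 by (intro mult_mono) (auto simp: field_simps)
    finally show ?thesis by (simp add: power2_eq_square)
  qed
  have "dist (chart (p, \<xi>, q)) (chart (p', \<xi>', q')) \<le>
      \<bar>p - p'\<bar> + \<bar>q - q'\<bar> + \<bar>p * \<xi> - p' * \<xi>'\<bar> + \<bar>(1 / p + \<xi> * q) - (1 / p' + \<xi>' * q')\<bar>"
    using norm_mat2_le[of "chart (p, \<xi>, q) - chart (p', \<xi>', q')"] by (simp add: dist_norm chart_def)
  also have "\<dots> \<le> D + D + (M * D + M * D) + (M\<^sup>2 * D + (M * D + M * D))"
  proof -
    have "\<bar>p * \<xi> - p' * \<xi>'\<bar> \<le> M * D + M * D" "\<bar>\<xi> * q - \<xi>' * q'\<bar> \<le> M * D + M * D"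
      by (intro prod D x y)+
    moreover from this(2) have "\<bar>(1 / p + \<xi> * q) - (1 / p' + \<xi>' * q')\<bar> \<le> M\<^sup>2 * D + (M * D + M * D)"
      using inv unfolding abs_le_iff by linarith
    ultimately show ?thesis using D by (intro add_mono)
  qed
  also have "\<dots> = (2 + 4 * M + M\<^sup>2) * D" by (simp add: algebra_simps)
  finally show ?thesis unfolding D_def .
qed

text \<open>Over a covering set of size d the (p, q)-square is divided into about d^(-2) cells of
  side d; that many boxes of size d have (s+2)-content about d^s.\<close>

lemma hnull_prod:
  fixes E :: "real set"
  assumes s: "0 < s" and M: "0 < (M::real)" and E: "hnull s E"
  shows "hnull (s + 2) ({-M..M} \<times> E \<times> {-M..M})"
proof (rule hnull_countableI[where ?'i = "nat \<times> nat \<times> nat"])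
  fix \<epsilon> :: real assume \<epsilon>: "\<epsilon> > 0"
  \<comment> \<open>(2 M + 1)^2 d^(-2) bounds the number of cells, and a box with three sides of
    size d has diameter at most 3 d.\<close>
  define C where "C = (2 * M + 1)\<^sup>2 * 3 powr (s + 2)"
  have C: "C > 0" using M by (simp add: C_def)
  \<comment> \<open>The cap one gives \<open>d i\<close> at most one, so that rounding up the number
    of cells is absorbed by 1 / d i.\<close>
  then have "0 < min (\<epsilon> / C) 1" using \<epsilon> by simp
  from E[unfolded hnull_def, rule_format, OF this]
  obtain U d where Ud: "E \<subseteq> (\<Union>i::nat. U i)" "\<And>i. 0 < d i" "\<And>i x y. x \<in> U i \<Longrightarrow> y \<in> U i \<Longrightarrow> dist x y \<le> d i"
    "summable (\<lambda>i. d i powr s)" "(\<Sum>i. d i powr s) < min (\<epsilon> / C) 1"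
    by metis
  have d1: "d i \<le> 1" for i
  proof -
    have "d i powr s \<le> (\<Sum>i. d i powr s)" using sum_le_suminf[OF Ud(4), of "{i}"] by auto
    then have "d i powr s \<le> 1" using Ud(5) by simp
    then show ?thesis using Ud(2) s by (metis gr_one_powr linorder_not_less)
  qed
  define N where "N i = Suc (nat \<lfloor>2 * M / d i\<rfloor>)" for i
  have N: "real (N i) \<le> (2 * M + 1) / d i" for i
  proof -
    have "0 \<le> 2 * M / d i" using M Ud(2)[of i] by simp
    then have "real (N i) \<le> 2 * M / d i + 1" unfolding N_def by linarith
    also have "\<dots> \<le> 2 * M / d i + 1 / d i" using d1[of i] Ud(2)[of i] by (simp add: field_simps)
    finally show ?thesis by (simp add: add_divide_distrib)
  qed
  define J where "J i j = {-M + real j * d i .. -M + real (Suc j) * d i}" for i j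
  have J: "\<exists>j<N i. x \<in> J i j" if "x \<in> {-M..M}" for x i
  proof -
    have d0: "d i > 0" by (rule Ud)
    define y where "y = (x + M) / d i"
    have y: "0 \<le> y" "y \<le> 2 * M / d i" using that d0 by (auto simp: y_def divide_right_mono)
    have "real (nat \<lfloor>y\<rfloor>) \<le> y" "y \<le> real (Suc (nat \<lfloor>y\<rfloor>))" using y by linarith+
    then have "real (nat \<lfloor>y\<rfloor>) * d i \<le> y * d i" "y * d i \<le> real (Suc (nat \<lfloor>y\<rfloor>)) * d i"
      using d0 by (auto intro!: mult_right_mono)
    moreover have "y * d i = x + M" using d0 by (simp add: y_def)
    ultimately have "x \<in> J i (nat \<lfloor>y\<rfloor>)" by (simp add: J_def)
    moreover have "nat \<lfloor>y\<rfloor> < N i" unfolding N_def using y(2) by (simp add: less_Suc_eq_le nat_mono floor_mono)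
    ultimately show ?thesis by blast
  qed
  have Jd: "dist x y \<le> d i" if "x \<in> J i j" "y \<in> J i j" for x y i j
    using that by (auto simp: J_def dist_real_def algebra_simps)
  define I where "I = {(i, j, k). j < N i \<and> k < N i}"
  define V where "V = (\<lambda>(i, j, k). J i j \<times> (U i \<times> J i k))"
  define D where "D = (\<lambda>(i::nat, j::nat, k::nat). 3 * d i)"
  have "{-M..M} \<times> E \<times> {-M..M} \<subseteq> (\<Union>i\<in>I. V i)"
  proof
    fix t assume t: "t \<in> {-M..M} \<times> E \<times> {-M..M}"
    obtain p \<xi> q where pq: "t = (p, \<xi>, q)" by (metis prod.exhaust)
    obtain i where i: "\<xi> \<in> U i" using t Ud(1) by (auto simp: pq)
    obtain j k where "j < N i" "p \<in> J i j" "k < N i" "q \<in> J i k" using J t by (auto simp: pq) blast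
    then have "(i, j, k) \<in> I" "t \<in> V (i, j, k)" using i by (auto simp: I_def V_def pq)
    then show "t \<in> (\<Union>i\<in>I. V i)" by blast
  qed
  moreover have "0 < D i" for i using Ud(2) by (auto simp: D_def split: prod.split)
  moreover have "dist x y \<le> D i" if "x \<in> V i" "y \<in> V i" for x y i
  proof -
    obtain i' j k where i: "i = (i', j, k)" by (metis prod.exhaust)
    obtain p \<xi> q p' \<xi>' q' where xy: "x = (p, \<xi>, q)" "y = (p', \<xi>', q')" by (metis prod.exhaust)
    have "dist (a, b) (a', b') \<le> dist a a' + dist b b'" for a a' :: real and b b' :: "'b::metric_space"
      by (simp add: dist_Pair_Pair sqrt_sum_squares_le_sum)
    then have "dist x y \<le> dist p p' + (dist \<xi> \<xi>' + dist q q')"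
      unfolding xy by (smt (verit) dist_Pair_Pair sqrt_sum_squares_le_sum zero_le_dist)
    also have "\<dots> \<le> d i' + (d i' + d i')"
      using that by (intro add_mono Jd Ud(3)) (auto simp: V_def i xy)
    finally show ?thesis by (simp add: D_def i)
  qed
  moreover have "(\<Sum>i\<in>F. D i powr (s + 2)) \<le> \<epsilon>" if F: "finite F" "F \<subseteq> I" for F
  proof -
    obtain n where n: "\<forall>i\<in>fst ` F. i < n"
      using finite_nat_set_iff_bounded F by blast
    have "(\<Sum>i\<in>F. D i powr (s + 2)) \<le> (\<Sum>t\<in>Sigma {..<n} (\<lambda>i. {..<N i} \<times> {..<N i}). D t powr (s + 2))"
      using n F(2) by (intro sum_mono2) (force simp: I_def)+
    also have "\<dots> = (\<Sum>i<n. \<Sum>jk\<in>{..<N i} \<times> {..<N i}. D (i, jk) powr (s + 2))"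
      by (subst sum.Sigma) auto
    also have "\<dots> = (\<Sum>i<n. (real (N i))\<^sup>2 * (3 * d i) powr (s + 2))"
      by (simp add: D_def case_prod_unfold power2_eq_square)
    also have "\<dots> \<le> (\<Sum>i<n. C * d i powr s)"
    proof (rule sum_mono)
      fix i
      have "(real (N i))\<^sup>2 * (3 * d i) powr (s + 2) \<le> ((2 * M + 1) / d i)\<^sup>2 * (3 * d i) powr (s + 2)"
        by (intro mult_right_mono power_mono N) auto
      also have "\<dots> = C * d i powr s"
        using Ud(2)[of i] by (simp add: C_def powr_mult powr_add power_divide)
      finally show "(real (N i))\<^sup>2 * (3 * d i) powr (s + 2) \<le> C * d i powr s" .
    qed
    also have "\<dots> = C * (\<Sum>i<n. d i powr s)" by (simp add: sum_distrib_left)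
    also have "\<dots> \<le> C * (\<epsilon> / C)"
      using C Ud(5) by (intro mult_left_mono order_trans[OF sum_le_suminf[OF Ud(4)]]) auto
    finally show ?thesis using C by simp
  qed
  ultimately show "\<exists>(I::(nat\<times>nat\<times>nat) set) V D. countable I \<and> {-M..M} \<times> E \<times> {-M..M} \<subseteq> (\<Union>i\<in>I. V i) \<and>
      (\<forall>i\<in>I. 0 < D i \<and> (\<forall>x\<in>V i. \<forall>y\<in>V i. dist x y \<le> D i)) \<and>
      (\<forall>F. finite F \<longrightarrow> F \<subseteq> I \<longrightarrow> (\<Sum>i\<in>F. D i powr (s + 2)) \<le> \<epsilon>)"
    by (intro exI[of _ I] exI[of _ V] exI[of _ D]) auto
qed (use s in simp)

text \<open>The chart is Lipschitz only where p stays away from zero and all coordinates are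
  bounded, so the set is exhausted by countably many such pieces.\<close>

lemma hnull_fibered:
  assumes s: "0 < s" and E: "hnull s E"
  shows "hnull (s + 2) {g \<in> SL2. g$1$1 \<noteq> 0 \<and> g$2$1 / g$1$1 \<in> E}" (is "hnull _ ?X")
proof -
  define A where "A n = {(p, \<xi>, q). (p, \<xi>, q) \<in> {-real (Suc n)..real (Suc n)} \<times> (E \<inter> {-real (Suc n)..real (Suc n)}) \<times> {-real (Suc n)..real (Suc n)} \<and>
    1 / real (Suc n) \<le> \<bar>p\<bar>}" for n
  have "hnull (s + 2) (chart ` A n)" for n
  proof (rule hnull_lipschitz_image)
    show "0 < 2 + 4 * real (Suc n) + (real (Suc n))\<^sup>2" by (simp add: add_pos_nonneg)
    show "hnull (s + 2) (A n)"
      by (rule hnull_subset[OF hnull_prod[OF s _ E, of "real (Suc n)"]]) (auto simp: A_def)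
    fix x y assume xy: "x \<in> A n" "y \<in> A n"
    obtain p \<xi> q p' \<xi>' q' where pq: "x = (p, \<xi>, q)" "y = (p', \<xi>', q')" by (metis prod.exhaust)
    show "dist (chart x) (chart y) \<le> (2 + 4 * real (Suc n) + (real (Suc n))\<^sup>2) * dist x y"
      unfolding pq by (rule chart_lipschitz) (use xy in \<open>auto simp: A_def pq\<close>)
  qed
  then have "hnull (s + 2) (\<Union>n. chart ` A n)" using s by (intro hnull_Union) auto
  moreover have "?X \<subseteq> (\<Union>n. chart ` A n)"
  proof
    fix g assume g: "g \<in> ?X"
    let ?p = "g$1$1" and ?\<xi> = "g$2$1 / g$1$1" and ?q = "g$1$2"
    obtain n where n: "\<bar>?p\<bar> + \<bar>?\<xi>\<bar> + \<bar>?q\<bar> + 1 / \<bar>?p\<bar> \<le> real n" using real_arch_simple by blast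
    have p: "1 / \<bar>?p\<bar> > 0" using g by simp
    have "1 / \<bar>?p\<bar> \<le> real (Suc n)" "\<bar>?p\<bar> \<le> real (Suc n)" "\<bar>?\<xi>\<bar> \<le> real (Suc n)" "\<bar>?q\<bar> \<le> real (Suc n)"
      using n p by linarith+
    moreover from this(1) have "1 / real (Suc n) \<le> \<bar>?p\<bar>" using g by (simp add: field_simps)
    ultimately have "(?p, ?\<xi>, ?q) \<in> A n" using g unfolding A_def abs_le_iff by auto
    moreover have "g = chart (?p, ?\<xi>, ?q)" using g by (intro chart_coordinates) auto
    ultimately show "g \<in> (\<Union>n. chart ` A n)" by blast
  qed
  ultimately show ?thesis by (rule hnull_subset)
qed

text \<open>A Fubini argument. A set of diameter at most d is met only by slices whose (p, q) lies
  in a square of area 4 d^2. Integrated over (p, q), the s-content of the slices is therefore at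
  most four times the (s+2)-content of the cover, and some slice is no worse than the
  average.\<close>

lemma hnull_slice:
  fixes E :: "real set"
  assumes s: "0 < s" and X: "hnull (s + 2) X"
    and EX: "\<And>p \<xi> q. p \<in> {1..2} \<Longrightarrow> \<xi> \<in> E \<Longrightarrow> q \<in> {0..1} \<Longrightarrow> chart (p, \<xi>, q) \<in> X"
  shows "hnull s E"
proof (rule hnull_countableI[OF s, where ?'i = nat])
  fix \<epsilon> :: real assume \<epsilon>: "\<epsilon> > 0"
  then have "0 < \<epsilon> / 4" by simp
  from X[unfolded hnull_def, rule_format, OF this]
  obtain U d where Ud: "X \<subseteq> (\<Union>i::nat. U i)" "\<And>i. 0 < d i" "\<And>i x y. x \<in> U i \<Longrightarrow> y \<in> U i \<Longrightarrow> dist x y \<le> d i"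
    "summable (\<lambda>i. d i powr (s + 2))" "(\<Sum>i. d i powr (s + 2)) < \<epsilon> / 4"
    by metis
  define g where "g i = (SOME x. x \<in> U i)" for i
  have g: "g i \<in> U i" if "x \<in> U i" for x i using that unfolding g_def by (rule someI)
  define B where "B i = {g i$1$1 - d i..g i$1$1 + d i} \<times> {g i$1$2 - d i..g i$1$2 + d i}" for i
  have B_sets [measurable]: "B i \<in> sets borel" for i
    unfolding B_def by (intro borel_closed closed_Times closed_atLeastAtMost)
  have B_measure: "emeasure lborel (B i) = ennreal (4 * (d i)\<^sup>2)" for i
  proof -
    have "emeasure lborel (B i) = emeasure (lborel \<Otimes>\<^sub>M lborel) (B i)" by (simp add: lborel_prod)
    also have "\<dots> = ennreal (2 * d i) * ennreal (2 * d i)"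
      unfolding B_def using Ud(2)[of i]
      by (subst lborel.emeasure_pair_measure_Times) (auto simp: less_imp_le)
    finally show ?thesis using Ud(2)[of i] by (simp add: ennreal_mult[symmetric] power2_eq_square less_imp_le)
  qed
  define h where "h z = (\<Sum>i. ennreal (d i powr s) * indicator (B i) z)" for z
  have "(\<integral>\<^sup>+z. h z \<partial>lborel) = (\<Sum>i. ennreal (d i powr s) * emeasure lborel (B i))"
    unfolding h_def by (subst nn_integral_suminf) (auto simp: nn_integral_cmult_indicator)
  also have "\<dots> = (\<Sum>i. ennreal (4 * d i powr (s + 2)))"
  proof (rule suminf_cong)
    fix i
    have "d i powr (s + 2) = d i powr s * (d i)\<^sup>2" using Ud(2)[of i] by (simp add: powr_add)
    then show "ennreal (d i powr s) * emeasure lborel (B i) = ennreal (4 * d i powr (s + 2))"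
      by (simp add: B_measure ennreal_mult[symmetric] mult_ac)
  qed
  also have "\<dots> = ennreal (4 * (\<Sum>i. d i powr (s + 2)))"
    by (subst suminf_ennreal2) (auto simp: Ud(4) suminf_mult intro: summable_mult)
  also have "\<dots> < ennreal \<epsilon>"
    using Ud(5) \<epsilon> by (intro ennreal_lessI) auto
  finally have int: "(\<integral>\<^sup>+z. h z \<partial>lborel) < ennreal \<epsilon>" .
  \<comment> \<open>The rectangle of parameters has area one, so h exceeding \<epsilon> on all of it
    would make the integral at least \<epsilon>.\<close>
  have "\<exists>z\<in>{1..2}\<times>{0..1}. h z \<le> ennreal \<epsilon>"
  proof (rule ccontr)
    assume "\<not> ?thesis"
    then have "ennreal \<epsilon> * indicator ({1..2}\<times>{0..1}) z \<le> h z" for z :: "real \<times> real"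
      by (auto simp: indicator_def not_le less_imp_le)
    then have "(\<integral>\<^sup>+z. ennreal \<epsilon> * indicator ({1..2::real}\<times>{0..1::real}) z \<partial>lborel) \<le> (\<integral>\<^sup>+z. h z \<partial>lborel)"
      by (intro nn_integral_mono) auto
    moreover have "(\<integral>\<^sup>+z. ennreal \<epsilon> * indicator ({1..2::real}\<times>{0..1::real}) z \<partial>lborel) = ennreal \<epsilon>"
    proof -
      have "emeasure lborel ({1..2::real}\<times>{0..1::real}) = emeasure (lborel \<Otimes>\<^sub>M lborel) ({1..2::real}\<times>{0..1::real})"
        by (simp add: lborel_prod)
      also have "\<dots> = 1" by (subst lborel.emeasure_pair_measure_Times) auto
      finally have 1: "emeasure lborel ({1..2::real}\<times>{0..1::real}) = 1" .
      have "{1..2::real}\<times>{0..1::real} \<in> sets lborel"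
        unfolding sets_lborel by (intro borel_closed closed_Times closed_atLeastAtMost)
      then show ?thesis by (simp add: nn_integral_cmult_indicator 1)
    qed
    ultimately show False using int by simp
  qed
  then obtain p q where pq: "p \<in> {1..2}" "q \<in> {0..1}" "h (p, q) \<le> ennreal \<epsilon>" by auto
  define I where "I = {i. (p, q) \<in> B i}"
  define V where "V i = {\<xi>\<in>E. chart (p, \<xi>, q) \<in> U i}" for i
  have "E \<subseteq> (\<Union>i\<in>I. V i)"
  proof
    fix \<xi> assume \<xi>: "\<xi> \<in> E"
    then obtain i where i: "chart (p, \<xi>, q) \<in> U i" using EX[OF pq(1) \<xi> pq(2)] Ud(1) by auto
    then have "dist (chart (p, \<xi>, q)) (g i) \<le> d i" by (intro Ud(3) g)
    then have "\<bar>p - g i$1$1\<bar> \<le> d i" "\<bar>q - g i$1$2\<bar> \<le> d i"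
      using mat2_component_dist[of "chart (p, \<xi>, q)" 1 1 "g i"] mat2_component_dist[of "chart (p, \<xi>, q)" 1 2 "g i"]
      by (simp_all add: chart_def)
    then have "i \<in> I" by (auto simp: I_def B_def)
    then show "\<xi> \<in> (\<Union>i\<in>I. V i)" using i \<xi> by (auto simp: V_def)
  qed
  \<comment> \<open>The lower left entry of the chart is p \<xi>, and p is at least one.\<close>
  moreover have "dist \<xi> \<xi>' \<le> d i" if "\<xi> \<in> V i" "\<xi>' \<in> V i" for \<xi> \<xi>' i
  proof -
    have "\<bar>p * \<xi> - p * \<xi>'\<bar> \<le> dist (chart (p, \<xi>, q)) (chart (p, \<xi>', q))"
      using mat2_component_dist[of "chart (p, \<xi>, q)" 2 1 "chart (p, \<xi>', q)"] by (simp add: chart_def)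
    also have "\<dots> \<le> d i" using that by (intro Ud(3)) (auto simp: V_def)
    finally have "p * \<bar>\<xi> - \<xi>'\<bar> \<le> d i" using pq(1) by (simp add: abs_mult flip: right_diff_distrib)
    moreover have "1 * \<bar>\<xi> - \<xi>'\<bar> \<le> p * \<bar>\<xi> - \<xi>'\<bar>" using pq(1) by (intro mult_right_mono) auto
    ultimately show ?thesis by (simp add: dist_real_def)
  qed
  moreover have "(\<Sum>i\<in>F. d i powr s) \<le> \<epsilon>" if F: "finite F" "F \<subseteq> I" for F
  proof -
    have "ennreal (\<Sum>i\<in>F. d i powr s) = (\<Sum>i\<in>F. ennreal (d i powr s))" by (simp add: sum_ennreal)
    also have "\<dots> = (\<Sum>i\<in>F. ennreal (d i powr s) * indicator (B i) (p, q))"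
      using F(2) by (intro sum.cong refl) (auto simp: I_def)
    also have "\<dots> \<le> h (p, q)" unfolding h_def using F(1) by (intro sum_le_suminf) auto
    also have "\<dots> \<le> ennreal \<epsilon>" by (rule pq)
    finally show ?thesis using \<epsilon> by (simp add: sum_nonneg)
  qed
  ultimately show "\<exists>(I::nat set) V d. countable I \<and> E \<subseteq> (\<Union>i\<in>I. V i) \<and>
      (\<forall>i\<in>I. 0 < d i \<and> (\<forall>x\<in>V i. \<forall>y\<in>V i. dist x y \<le> d i)) \<and>
      (\<forall>F. finite F \<longrightarrow> F \<subseteq> I \<longrightarrow> (\<Sum>i\<in>F. d i powr s) \<le> \<epsilon>)"
    using Ud(2) by (intro exI[of _ I] exI[of _ V] exI[of _ d]) auto
qed

section \<open>Upper bound for the exceptional directions\<close>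

lemma separated_card_le:
  fixes X :: "real set"
  assumes X: "finite X" "X \<subseteq> {-A..A}" and \<delta>: "0 < \<delta>"
    and sep: "\<And>x y. x \<in> X \<Longrightarrow> y \<in> X \<Longrightarrow> x < y \<Longrightarrow> \<delta> \<le> y - x" and A: "0 \<le> A"
  shows "real (card X) \<le> 2 * A / \<delta> + 1"
proof -
  define f where "f x = nat \<lfloor>(x + A) / \<delta>\<rfloor>" for x
  have lt: "f x < f y" if "x \<in> X" "y \<in> X" "x < y" for x y
  proof -
    have "0 \<le> (x + A) / \<delta>" using X(2) that \<delta> by auto
    moreover have "(x + A) / \<delta> + 1 \<le> (y + A) / \<delta>" proof -
      have "(x + A) / \<delta> + 1 = (x + A + \<delta>) / \<delta>" using \<delta> by (simp add: add_divide_distrib)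
      also have "\<dots> \<le> (y + A) / \<delta>" using sep[OF that] \<delta> by (intro divide_right_mono) auto
      finally show ?thesis .
    qed
    ultimately show ?thesis unfolding f_def by linarith
  qed
  have "inj_on f X" by (rule linorder_inj_onI) (use lt in \<open>auto simp: less_imp_neq\<close>)
  moreover have "f ` X \<subseteq> {..nat \<lfloor>2 * A / \<delta>\<rfloor>}"
  proof
    fix n assume "n \<in> f ` X"
    then obtain x where x: "x \<in> X" "n = f x" by blast
    then have "(x + A) / \<delta> \<le> 2 * A / \<delta>" using X(2) \<delta> by (intro divide_right_mono) auto
    then show "n \<in> {..nat \<lfloor>2 * A / \<delta>\<rfloor>}" by (simp add: x f_def nat_mono floor_mono)
  qed
  ultimately have "card X \<le> card {..nat \<lfloor>2 * A / \<delta>\<rfloor>}"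
    by (metis card_inj_on_le finite_atMost)
  then have "real (card X) \<le> real (nat \<lfloor>2 * A / \<delta>\<rfloor>) + 1" by simp
  moreover have "0 \<le> 2 * A / \<delta>" using A \<delta> by simp
  ultimately show ?thesis by linarith
qed

text \<open>The difference of the slopes is the determinant divided by the product of the first
  coordinates, whose positivity excludes w' = - w.\<close>

lemma separated_slope:
  assumes W: "separated c W" and w: "w \<in> W" "w' \<in> W" "0 < w$1" "0 < w'$1" "w \<noteq> w'"
  shows "c / (w$1 * w'$1) \<le> \<bar>w$2 / w$1 - w'$2 / w'$1\<bar>"
proof -
  have "w' \<noteq> - w" using w by auto
  moreover have "w' = w \<or> w' = - w \<or> c \<le> \<bar>det2 w w'\<bar>" using W w(1,2) by (simp add: separated_def)
  ultimately have "c \<le> \<bar>det2 w w'\<bar>" using w(5) by auto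
  also have "det2 w w' = (w$1 * w'$1) * (w'$2 / w'$1 - w$2 / w$1)"
    using w(3,4) by (simp add: det2_def right_diff_distrib)
  also have "\<bar>\<dots>\<bar> = (w$1 * w'$1) * \<bar>w$2 / w$1 - w'$2 / w'$1\<bar>"
    using w(3,4) by (simp add: abs_mult abs_minus_commute)
  finally show ?thesis using w(3,4) by (simp add: pos_divide_le_eq mult.commute)
qed

lemma finite_bounded_vectors:
  assumes W: "separated c W"
  shows "finite {w\<in>W. \<bar>w$1\<bar> \<le> A \<and> \<bar>w$2\<bar> \<le> B}"
proof (rule finite_subset[OF _ separated_finite[OF W, of "A + B"]])
  have "norm (w :: real^2) \<le> \<bar>w$1\<bar> + \<bar>w$2\<bar>" for w
    using norm_le_l1_cart[of w] by (simp add: sum_2)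
  then have "norm (w :: real^2) \<le> A + B" if "\<bar>w$1\<bar> \<le> A" "\<bar>w$2\<bar> \<le> B" for w
    using that by (meson add_mono order_trans)
  then show "{w\<in>W. \<bar>w$1\<bar> \<le> A \<and> \<bar>w$2\<bar> \<le> B} \<subseteq> W \<inter> cball 0 (A + B)" by auto
qed

text \<open>Unless \<open>\<xi>\<close> is itself the slope of some vector, the discreteness of \<open>W\<close> turns a
  small second coordinate into a large first one.\<close>

lemma not_dir_dioph_large:
  assumes W: "separated c W" and \<xi>: "\<not> dir_dioph W \<kappa> \<xi>" "\<xi> \<notin> (\<lambda>w. w$2 / w$1) ` W" and \<nu>: "0 < \<nu>"
  obtains w where "w \<in> W" "R \<le> w$1" "\<bar>w$2 - \<xi> * w$1\<bar> < 1" "\<bar>w$1\<bar> powr \<kappa> * \<bar>w$2 - \<xi> * w$1\<bar> < \<nu>"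
proof -
  let ?b = "\<lambda>w :: real^2. \<bar>w$2 - \<xi> * w$1\<bar>"
  define R' where "R' = \<bar>R\<bar>"
  define Z where "Z = {w\<in>W. \<bar>w$1\<bar> \<le> R' \<and> \<bar>w$2\<bar> \<le> 1 + \<bar>\<xi>\<bar> * R'}"
  have fin: "finite Z" unfolding Z_def by (rule finite_bounded_vectors[OF W])
  have b0: "0 < ?b w" if "w \<in> W" for w
  proof (cases "w$1 = 0")
    case True
    have "w \<noteq> 0" using that W by (auto simp: separated_def)
    then have "w$2 \<noteq> 0" using True by (auto simp: vec2_eq_iff)
    then show ?thesis using True by simp
  next
    case False
    have "\<xi> \<noteq> w$2 / w$1" using \<xi>(2) that by blast
    then show ?thesis using False by (auto simp: eq_divide_eq)
  qed
  \<comment> \<open>Below the second coordinate of each of the finitely many vectors in Z, so that a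
    vector violating the condition with this \<mu> lies outside Z and must have a large first
    coordinate.\<close>
  define \<mu> where "\<mu> = Min (insert 1 (?b ` Z))"
  have \<mu>: "0 < \<mu>" "\<mu> \<le> 1" unfolding \<mu>_def using fin b0 by (auto simp: Z_def)
  have \<mu>Z: "\<mu> \<le> ?b w" if "w \<in> Z" for w unfolding \<mu>_def using fin that by (intro Min_le) auto
  obtain w where w: "w \<in> W" "?b w < \<mu>" "\<bar>w$1\<bar> powr \<kappa> * ?b w < \<nu>"
    using \<xi>(1) \<mu> \<nu> unfolding dir_dioph_def by (meson not_le)
  have "w \<notin> Z" using \<mu>Z w(2) by fastforce
  have large: "R' < \<bar>w$1\<bar>"
  proof (rule ccontr)
    assume a: "\<not> ?thesis"
    have "\<bar>w$2\<bar> \<le> ?b w + \<bar>\<xi> * w$1\<bar>" by linarith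
    also have "\<bar>\<xi> * w$1\<bar> \<le> \<bar>\<xi>\<bar> * R'" unfolding abs_mult using a by (intro mult_left_mono) auto
    finally have "w \<in> Z" using a w \<mu> by (auto simp: Z_def)
    with \<open>w \<notin> Z\<close> show False by simp
  qed
  show ?thesis
  proof (cases "0 \<le> w$1")
    case True
    then show ?thesis using w large \<mu> by (intro that[of w]) (auto simp: R'_def)
  next
    case False
    have "- w \<in> W" using W w by (simp add: separated_def)
    moreover have "\<bar>- w$2 + \<xi> * w$1\<bar> = ?b w" by linarith
    ultimately show ?thesis using w large False \<mu> by (intro that[of "- w"]) (auto simp: R'_def)
  qed
qed

text \<open>Vectors with first coordinate between 2^n and 2^(n+1) have slopes at least c / 4^(n+1)
  apart, so there are at most (8 A / c + 1) 4^n of them, each contributing at most 2^(- n t). For t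
  > 2 the shells form a convergent geometric series.\<close>

lemma shell_sum_le:
  assumes W: "separated c W" and A: "0 \<le> A" and F: "finite F" "F \<subseteq> {w\<in>W. 2 ^ n0 \<le> w$1 \<and> \<bar>w$2 / w$1\<bar> \<le> A}"
    and t: "2 < t"
  shows "(\<Sum>w\<in>F. (w$1) powr (- t)) \<le> (8 * A / c + 1) * ((2 powr (2 - t)) ^ n0 / (1 - 2 powr (2 - t)))"
proof -
  have c: "c > 0" using W by (simp add: separated_def)
  define l where "l w = nat \<lfloor>log 2 (w$1)\<rfloor>" for w :: "real^2"
  have l: "2 ^ l w \<le> w$1" "w$1 < 2 ^ Suc (l w)" "n0 \<le> l w" if "w \<in> F" for w
  proof -
    have w: "2 ^ n0 \<le> w$1" using F that by auto
    then have w1: "1 \<le> w$1" by (meson one_le_numeral one_le_power order_trans)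
    have "real n0 \<le> log 2 (w$1)" using w w1 by (simp add: le_log_iff powr_realpow)
    then show "n0 \<le> l w" unfolding l_def by linarith
    have "0 \<le> log 2 (w$1)" using w1 by simp
    then have "real (l w) \<le> log 2 (w$1)" "log 2 (w$1) < real (Suc (l w))" unfolding l_def by linarith+
    then show "2 ^ l w \<le> w$1" "w$1 < 2 ^ Suc (l w)"
      using w1 by (simp_all add: le_log_iff log_less_iff powr_realpow[symmetric] del: power_Suc)
  qed
  obtain N where N: "\<forall>n\<in>l ` F. n < N" using finite_nat_set_iff_bounded F(1) by blast
  define \<rho> where "\<rho> = 2 powr (2 - t)"
  have \<rho>: "0 < \<rho>" "\<rho> < 1" using t by (auto simp: \<rho>_def powr_less_one)
  have shell: "(\<Sum>w\<in>{w\<in>F. l w = n}. (w$1) powr (- t)) \<le> (8 * A / c + 1) * \<rho> ^ n" for n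
  proof -
    let ?S = "{w\<in>F. l w = n}" and ?f = "\<lambda>w :: real^2. w$2 / w$1"
    have pos: "0 < w$1" if "w \<in> ?S" for w using l(1)[of w] that by (auto intro: less_le_trans[rotated])
    have sep: "c / 4 ^ Suc n \<le> \<bar>?f w - ?f w'\<bar>" if w: "w \<in> ?S" "w' \<in> ?S" "w \<noteq> w'" for w w'
    proof -
      have "w$1 * w'$1 \<le> 2 ^ Suc n * 2 ^ Suc n"
        using l(2)[of w] l(2)[of w'] w pos[of w] pos[of w'] by (intro mult_mono) auto
      also have "\<dots> = 4 ^ Suc n" by (simp flip: power_mult_distrib)
      finally have "c / 4 ^ Suc n \<le> c / (w$1 * w'$1)" using pos w c by (intro divide_left_mono) auto
      also have "\<dots> \<le> \<bar>?f w - ?f w'\<bar>" using w F pos by (intro separated_slope[OF W]) auto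
      finally show ?thesis .
    qed
    have inj: "inj_on ?f ?S"
    proof (rule inj_onI, rule ccontr)
      fix w w' assume "w \<in> ?S" "w' \<in> ?S" "?f w = ?f w'" "w \<noteq> w'"
      then have "c / 4 ^ Suc n \<le> 0" using sep[of w w'] by simp
      moreover have "0 < c / 4 ^ Suc n" using c by simp
      ultimately show False by linarith
    qed
    have "real (card ?S) = real (card (?f ` ?S))" using inj by (simp add: card_image)
    also have "\<dots> \<le> 2 * A / (c / 4 ^ Suc n) + 1"
    proof (rule separated_card_le)
      have "\<bar>?f w\<bar> \<le> A" if "w \<in> ?S" for w using F that by auto
      then show "?f ` ?S \<subseteq> {-A..A}" unfolding abs_le_iff by force
      fix x y assume xy: "x \<in> ?f ` ?S" "y \<in> ?f ` ?S" "x < y"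
      then obtain w w' where "w \<in> ?S" "w' \<in> ?S" "x = ?f w" "y = ?f w'" by blast
      then show "c / 4 ^ Suc n \<le> y - x" using sep[of w w'] xy(3) by auto
    qed (use F A c in auto)
    also have "\<dots> \<le> (8 * A / c + 1) * 4 ^ n" using c A by (simp add: field_simps)
    finally have card: "real (card ?S) \<le> (8 * A / c + 1) * 4 ^ n" .
    have "(w$1) powr (- t) \<le> (2 ^ n) powr (- t)" if "w \<in> ?S" for w
      using l(1)[of w] that t by (intro powr_mono2') auto
    then have "(\<Sum>w\<in>?S. (w$1) powr (- t)) \<le> real (card ?S) * (2 ^ n) powr (- t)"
      by (rule sum_bounded_above)
    also have "\<dots> \<le> ((8 * A / c + 1) * 4 ^ n) * (2 ^ n) powr (- t)"
      by (intro mult_right_mono card) auto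
    also have "4 ^ n * (2 ^ n) powr (- t) = \<rho> ^ n"
    proof -
      have "2 powr (2 * real n) = (2 powr 2) powr real n" by (simp only: powr_powr)
      then have "(4::real) ^ n = 2 powr (2 * real n)" by (simp add: powr_realpow)
      moreover have "(2 ^ n :: real) powr (- t) = 2 powr (- t * real n)"
        by (simp add: powr_powr mult.commute flip: powr_realpow)
      moreover have "\<rho> ^ n = 2 powr ((2 - t) * real n)" by (simp add: \<rho>_def powr_powr flip: powr_realpow)
      ultimately show ?thesis by (simp add: algebra_simps flip: powr_add)
    qed
    then have "((8 * A / c + 1) * 4 ^ n) * (2 ^ n) powr (- t) = (8 * A / c + 1) * \<rho> ^ n" by (simp add: mult.assoc)
    finally show ?thesis .
  qed
  have "(\<Sum>w\<in>F. (w$1) powr (- t)) = (\<Sum>n\<in>{n0..<N}. \<Sum>w\<in>{w\<in>F. l w = n}. (w$1) powr (- t))"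
    using F(1) N l(3) by (intro sum.group[symmetric]) auto
  also have "\<dots> \<le> (\<Sum>n\<in>{n0..<N}. (8 * A / c + 1) * \<rho> ^ n)" by (intro sum_mono shell)
  also have "\<dots> = (8 * A / c + 1) * (\<Sum>n\<in>{n0..<N}. \<rho> ^ n)" by (simp add: sum_distrib_left)
  also have "\<dots> \<le> (8 * A / c + 1) * (\<rho> ^ n0 / (1 - \<rho>))"
  proof (rule mult_left_mono)
    have "(\<Sum>n\<in>{n0..<N}. \<rho> ^ n) \<le> (\<Sum>k<N. \<rho> ^ (k + n0))"
    proof -
      have "(\<Sum>n\<in>{n0..<N}. \<rho> ^ n) = (\<Sum>k<N - n0. \<rho> ^ (k + n0))"
        by (rule sum.reindex_bij_witness[of _ "\<lambda>k. k + n0" "\<lambda>n. n - n0"]) auto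
      also have "\<dots> \<le> (\<Sum>k<N. \<rho> ^ (k + n0))" using \<rho> by (intro sum_mono2) auto
      finally show ?thesis .
    qed
    also have "\<dots> = \<rho> ^ n0 * (\<Sum>k<N. \<rho> ^ k)" by (simp add: power_add sum_distrib_left mult.commute)
    also have "\<dots> \<le> \<rho> ^ n0 * (1 / (1 - \<rho>))"
    proof (rule mult_left_mono)
      have "(\<Sum>k<N. \<rho> ^ k) \<le> (\<Sum>k. \<rho> ^ k)" using \<rho> by (intro sum_le_suminf summable_geometric) auto
      then show "(\<Sum>k<N. \<rho> ^ k) \<le> 1 / (1 - \<rho>)" using \<rho> by (simp add: suminf_geometric)
    qed (use \<rho> in simp)
    finally show "(\<Sum>n\<in>{n0..<N}. \<rho> ^ n) \<le> \<rho> ^ n0 / (1 - \<rho>)" by simp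
  qed (use A c in simp)
  finally show ?thesis by (simp add: \<rho>_def)
qed

text \<open>Outside the countable set of slopes, a failing direction is covered by the ball of
  radius w1^(-(\<kappa>+1)) about the slope of vectors with arbitrarily large first coordinate w1.
  The s-content of these balls is a tail of a series that converges because (\<kappa>+1) s >
  2.\<close>

lemma hnull_not_dir_dioph:
  assumes W: "separated c W" and \<kappa>: "0 < \<kappa>" and s: "2 / (\<kappa> + 1) < s"
  shows "hnull s {\<xi>. \<not> dir_dioph W \<kappa> \<xi>}"
proof -
  have s0: "0 < s" using s \<kappa> by (smt (verit) divide_pos_pos)
  define t where "t = (\<kappa> + 1) * s"
  have t: "2 < t" using s \<kappa> by (simp add: t_def field_simps)
  let ?f = "\<lambda>w :: real^2. w$2 / w$1"
  have part: "hnull s {\<xi>. \<not> dir_dioph W \<kappa> \<xi> \<and> \<xi> \<notin> ?f ` W \<and> \<bar>\<xi>\<bar> \<le> real M}" (is "hnull s ?E") for M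
  proof (rule hnull_countableI[OF s0, where ?'i = "real^2"])
    fix \<epsilon> :: real assume \<epsilon>: "\<epsilon> > 0"
    \<comment> \<open>The approximating slope is within distance one of a direction bounded by
      M.\<close>
    define A where "A = real M + 1"
    define K where "K = 2 powr s * (8 * A / c + 1) / (1 - 2 powr (2 - t))"
    have "(\<lambda>n. K * (2 powr (2 - t)) ^ n) \<longlonglongrightarrow> 0"
      using t by (intro tendsto_mult_right_zero LIMSEQ_realpow_zero) (auto simp: powr_less_one)
    then obtain n0 where "K * (2 powr (2 - t)) ^ n0 < \<epsilon>"
      using order_tendstoD(2)[OF _ \<epsilon>] by (metis eventually_sequentially order_refl)
    then have n0: "2 powr s * ((8 * A / c + 1) * ((2 powr (2 - t)) ^ n0 / (1 - 2 powr (2 - t)))) < \<epsilon>"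
      by (simp add: K_def mult_ac)
    define I where "I = {w\<in>W. 2 ^ n0 \<le> w$1 \<and> \<bar>?f w\<bar> \<le> A}"
    define d where "d w = 2 * (w$1) powr (- (\<kappa> + 1))" for w :: "real^2"
    define U where "U w = {\<xi>. \<bar>\<xi> - ?f w\<bar> \<le> (w$1) powr (- (\<kappa> + 1))}" for w :: "real^2"
    have "?E \<subseteq> (\<Union>w\<in>I. U w)"
    proof
      fix \<xi> assume \<xi>: "\<xi> \<in> ?E"
      then have "\<not> dir_dioph W \<kappa> \<xi>" "\<xi> \<notin> ?f ` W" by auto
      then obtain w where w: "w \<in> W" "2 ^ n0 \<le> w$1" "\<bar>w$2 - \<xi> * w$1\<bar> < 1" "\<bar>w$1\<bar> powr \<kappa> * \<bar>w$2 - \<xi> * w$1\<bar> < 1"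
        by (rule not_dir_dioph_large[OF W, where \<nu>=1]) auto
      have w1: "1 \<le> w$1" using w(2) by (meson one_le_numeral one_le_power order_trans)
      have eq: "\<bar>w$2 - \<xi> * w$1\<bar> = w$1 * \<bar>\<xi> - ?f w\<bar>"
      proof -
        have "w$2 - \<xi> * w$1 = - (w$1 * (\<xi> - ?f w))" using w1 by (simp add: field_simps)
        then show ?thesis using w1 by (simp add: abs_mult)
      qed
      have "1 * \<bar>\<xi> - ?f w\<bar> \<le> w$1 * \<bar>\<xi> - ?f w\<bar>" using w1 by (intro mult_right_mono) auto
      then have "\<bar>\<xi> - ?f w\<bar> \<le> \<bar>w$2 - \<xi> * w$1\<bar>" unfolding eq by simp
      then have "\<bar>\<xi> - ?f w\<bar> < 1" using w(3) by (rule le_less_trans)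
      then have "\<bar>?f w\<bar> \<le> A" using \<xi> by (auto simp: A_def)
      then have "w \<in> I" using w by (simp add: I_def)
      moreover have "\<bar>\<xi> - ?f w\<bar> \<le> (w$1) powr (- (\<kappa> + 1))"
      proof -
        have "(w$1) powr (\<kappa> + 1) * \<bar>\<xi> - ?f w\<bar> < 1"
          using w(4) w1 unfolding eq by (simp add: powr_add mult_ac)
        moreover have "0 < (w$1) powr (\<kappa> + 1)" using w1 by simp
        ultimately show ?thesis unfolding powr_minus_divide by (simp add: pos_le_divide_eq mult.commute)
      qed
      ultimately show "\<xi> \<in> (\<Union>w\<in>I. U w)" by (auto simp: U_def)
    qed
    moreover have pos: "0 < w$1" if "w \<in> I" for w
      using that by (auto simp: I_def intro: less_le_trans[rotated])
    moreover have "0 < d w" if "w \<in> I" for w using pos[OF that] by (simp add: d_def)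
    moreover have "dist x y \<le> d w" if "x \<in> U w" "y \<in> U w" for x y w
      using that by (auto simp: U_def d_def dist_real_def)
    moreover have "(\<Sum>w\<in>F. d w powr s) \<le> \<epsilon>" if F: "finite F" "F \<subseteq> I" for F
    proof -
      have "(\<Sum>w\<in>F. d w powr s) = 2 powr s * (\<Sum>w\<in>F. (w$1) powr (- t))"
        unfolding d_def powr_mult powr_powr t_def sum_distrib_left mult_minus_left ..
      also have "\<dots> \<le> 2 powr s * ((8 * A / c + 1) * ((2 powr (2 - t)) ^ n0 / (1 - 2 powr (2 - t))))"
        using F by (intro mult_left_mono shell_sum_le[OF W _ _ _ t]) (auto simp: I_def A_def)
      finally show ?thesis using n0 by simp
    qed
    moreover have "countable I"
      using separated_countable[OF W] by (rule countable_subset[rotated]) (auto simp: I_def)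
    ultimately show "\<exists>(I::(real^2) set) U d. countable I \<and> ?E \<subseteq> (\<Union>i\<in>I. U i) \<and>
      (\<forall>i\<in>I. 0 < d i \<and> (\<forall>x\<in>U i. \<forall>y\<in>U i. dist x y \<le> d i)) \<and>
      (\<forall>F. finite F \<longrightarrow> F \<subseteq> I \<longrightarrow> (\<Sum>i\<in>F. d i powr s) \<le> \<epsilon>)"
      by (intro exI[of _ I] exI[of _ U] exI[of _ d]) blast
  qed
  have "hnull s (?f ` W \<union> (\<Union>M. {\<xi>. \<not> dir_dioph W \<kappa> \<xi> \<and> \<xi> \<notin> ?f ` W \<and> \<bar>\<xi>\<bar> \<le> real M}))"
    by (intro hnull_Un hnull_Union hnull_countable countable_image separated_countable[OF W] s0 part)
  moreover have "{\<xi>. \<not> dir_dioph W \<kappa> \<xi>} \<subseteq> (?f ` W \<union> (\<Union>M. {\<xi>. \<not> dir_dioph W \<kappa> \<xi> \<and> \<xi> \<notin> ?f ` W \<and> \<bar>\<xi>\<bar> \<le> real M}))"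
    using real_arch_simple by auto
  ultimately show ?thesis by (rule hnull_subset)
qed

section \<open>Nested intervals\<close>

text \<open>The content of the part of the cover that meets A. Its smallness relative to the length
  of A is the invariant of both nested constructions.\<close>

definition hit_sum :: "real \<Rightarrow> (nat \<Rightarrow> 'a set) \<Rightarrow> (nat \<Rightarrow> real) \<Rightarrow> 'a set \<Rightarrow> real" where
  "hit_sum s U d A = (\<Sum>i. if U i \<inter> A \<noteq> {} then d i powr s else 0)"

lemma hit_sum_summable:
  assumes "summable (\<lambda>i. d i powr s :: real)"
  shows "summable (\<lambda>i. if U i \<inter> A \<noteq> {} then d i powr s else 0)"
  by (rule summable_comparison_test'[OF assms]) auto

lemma hit_sum_sum_le:
  assumes sm: "summable (\<lambda>i. d i powr s)" and F: "finite F" "\<And>i. i \<in> F \<Longrightarrow> U i \<inter> A \<noteq> {}"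
  shows "(\<Sum>i\<in>F. d i powr s) \<le> hit_sum s U d A"
proof -
  have "(\<Sum>i\<in>F. d i powr s) = (\<Sum>i\<in>F. if U i \<inter> A \<noteq> {} then d i powr s else 0)"
    using F(2) by (intro sum.cong) auto
  also have "\<dots> \<le> hit_sum s U d A"
    unfolding hit_sum_def by (intro sum_le_suminf hit_sum_summable[OF sm] F(1)) auto
  finally show ?thesis .
qed

text \<open>One term of a sum of s-th powers is at most the whole; taking roots, the invariant
  limits the size of every covering set that still meets the current interval.\<close>

lemma hit_sum_bound:
  assumes sm: "summable (\<lambda>i. d i powr s)" and s: "0 < s" and d: "0 < d i" and hit: "U i \<inter> A \<noteq> {}"
    and le: "hit_sum s U d A \<le> e powr s * L powr s" and e: "0 \<le> e" "0 \<le> L"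
  shows "d i \<le> e * L"
proof -
  have "d i powr s \<le> hit_sum s U d A" using hit_sum_sum_le[OF sm, of "{i}" U A] hit by simp
  also have "\<dots> \<le> (e * L) powr s" using le by (simp add: powr_mult)
  finally show ?thesis using s d e by (meson less_imp_le mult_nonneg_nonneg not_le powr_less_mono2)
qed

text \<open>If every piece had too much relative content, the pieces together would exceed the
  content of J: no covering set is counted twice, and by \<open>ge\<close> the pieces together lose
  no s-dimensional size.\<close>

lemma hit_sum_pick:
  assumes sm: "summable (\<lambda>i. d i powr s)" and I: "finite I" and L: "0 < L" and \<epsilon>: "0 < \<epsilon>"
    and sub: "\<And>w. w \<in> I \<Longrightarrow> A w \<subseteq> J"
    and one: "\<And>i w w'. w \<in> I \<Longrightarrow> w' \<in> I \<Longrightarrow> U i \<inter> A w \<noteq> {} \<Longrightarrow> U i \<inter> A w' \<noteq> {} \<Longrightarrow> w = w'"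
    and ge: "L powr s \<le> (\<Sum>w\<in>I. l w powr s)" and hit: "hit_sum s U d J \<le> \<epsilon> * L powr s"
  shows "\<exists>w\<in>I. hit_sum s U d (A w) \<le> \<epsilon> * l w powr s"
proof (rule ccontr)
  assume "\<not> ?thesis"
  then have lt: "\<epsilon> * l w powr s < hit_sum s U d (A w)" if "w \<in> I" for w using that by (meson not_le)
  have "0 < L powr s" using L by simp
  then have "I \<noteq> {}" using ge by auto
  have "\<epsilon> * L powr s \<le> \<epsilon> * (\<Sum>w\<in>I. l w powr s)" using ge \<epsilon> by (intro mult_left_mono) auto
  also have "\<dots> = (\<Sum>w\<in>I. \<epsilon> * l w powr s)" by (simp add: sum_distrib_left)
  also have "\<dots> < (\<Sum>w\<in>I. hit_sum s U d (A w))" by (rule sum_strict_mono[OF I \<open>I \<noteq> {}\<close> lt])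
  also have "\<dots> = (\<Sum>i. \<Sum>w\<in>I. if U i \<inter> A w \<noteq> {} then d i powr s else 0)"
    unfolding hit_sum_def by (rule suminf_sum[symmetric]) (rule hit_sum_summable[OF sm])
  also have "\<dots> \<le> hit_sum s U d J"
    unfolding hit_sum_def
  proof (rule suminf_le)
    fix i
    show "(\<Sum>w\<in>I. if U i \<inter> A w \<noteq> {} then d i powr s else 0) \<le> (if U i \<inter> J \<noteq> {} then d i powr s else 0)"
    proof (cases "\<exists>w\<in>I. U i \<inter> A w \<noteq> {}")
      case True
      then obtain w where w: "w \<in> I" "U i \<inter> A w \<noteq> {}" by blast
      have "(\<Sum>w\<in>I. if U i \<inter> A w \<noteq> {} then d i powr s else 0) = (\<Sum>w'\<in>I. if w' = w then d i powr s else 0)"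
        using one w by (intro sum.cong) auto
      also have "\<dots> = d i powr s" using w I by simp
      finally show ?thesis using w sub[OF w(1)] by auto
    next
      case False
      then have "(\<Sum>w\<in>I. if U i \<inter> A w \<noteq> {} then d i powr s else 0) = 0" by (intro sum.neutral) auto
      then show ?thesis by simp
    qed
  qed (intro summable_sum hit_sum_summable[OF sm])+
  finally show False using hit by simp
qed

text \<open>Given a cover \<open>U\<close> of small total content, a nested sequence of intervals is
  chosen so that the sets meeting the current interval keep a small content relative to its
  length; the limit point then lies in no \<open>U i\<close>.\<close>

lemma not_hnull_nested:
  fixes E :: "real set" and P :: "nat \<Rightarrow> real \<Rightarrow> real \<Rightarrow> bool"
  assumes s: "0 < s" and \<epsilon>: "0 < \<epsilon>" and start: "P 0 a0 b0"
    and len: "\<And>n a b. P n a b \<Longrightarrow> a < b \<and> b - a \<le> (1/2) ^ n"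
    and step: "\<And>n a b U d. P n a b \<Longrightarrow> (\<And>i. 0 < d i) \<Longrightarrow>
      (\<And>i x y. x \<in> U i \<Longrightarrow> y \<in> U i \<Longrightarrow> \<bar>x - y\<bar> \<le> d i) \<Longrightarrow> summable (\<lambda>i. d i powr s) \<Longrightarrow>
      hit_sum s U d {a..b} \<le> \<epsilon> * (b - a) powr s \<Longrightarrow>
      \<exists>a' b'. a \<le> a' \<and> b' \<le> b \<and> P (Suc n) a' b' \<and> hit_sum s U d {a'..b'} \<le> \<epsilon> * (b' - a') powr s"
    and E: "\<And>a b x. (\<And>n. P n (a n) (b n)) \<Longrightarrow> (\<And>n. a n \<le> x \<and> x \<le> b n) \<Longrightarrow> x \<in> E"
  shows "\<not> hnull s E"
proof
  assume "hnull s E"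
  moreover have l0: "0 < \<epsilon> * (b0 - a0) powr s" using len[OF start] \<epsilon> by simp
  ultimately obtain U d where Ud: "E \<subseteq> (\<Union>i::nat. U i)" "\<And>i. 0 < d i"
    "\<And>i x y. x \<in> U i \<Longrightarrow> y \<in> U i \<Longrightarrow> \<bar>x - y\<bar> \<le> d i"
    "summable (\<lambda>i. d i powr s)" "(\<Sum>i. d i powr s) < \<epsilon> * (b0 - a0) powr s"
    unfolding hnull_def dist_real_def by metis
  define Q where "Q n t \<longleftrightarrow> P n (fst t) (snd t) \<and> hit_sum s U d {fst t..snd t} \<le> \<epsilon> * (snd t - fst t) powr s" for n t
  have "\<exists>f. \<forall>n. Q n (f n) \<and> (fst (f n) \<le> fst (f (Suc n)) \<and> snd (f (Suc n)) \<le> snd (f n))"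
  proof (rule dependent_nat_choice)
    have "hit_sum s U d {a0..b0} \<le> (\<Sum>i. d i powr s)"
      unfolding hit_sum_def by (intro suminf_le hit_sum_summable Ud(4)) auto
    then show "\<exists>t. Q 0 t" using start Ud(5) by (intro exI[of _ "(a0, b0)"]) (auto simp: Q_def)
  next
    fix t n assume t: "Q n t"
    have "\<exists>a' b'. fst t \<le> a' \<and> b' \<le> snd t \<and> P (Suc n) a' b' \<and> hit_sum s U d {a'..b'} \<le> \<epsilon> * (b' - a') powr s"
      by (rule step[of n "fst t" "snd t" d U]) (use t Ud in \<open>auto simp: Q_def\<close>)
    then show "\<exists>t'. Q (Suc n) t' \<and> fst t \<le> fst t' \<and> snd t' \<le> snd t"
      unfolding Q_def by (metis fst_conv snd_conv)
  qed
  then obtain f where f: "\<And>n. Q n (f n)" "\<And>n. fst (f n) \<le> fst (f (Suc n))" "\<And>n. snd (f (Suc n)) \<le> snd (f n)"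
    by blast
  define a b where "a n = fst (f n)" and "b n = snd (f n)" for n
  have ab: "P n (a n) (b n)" "hit_sum s U d {a n..b n} \<le> \<epsilon> * (b n - a n) powr s" for n
    using f(1)[of n] by (auto simp: Q_def a_def b_def)
  have mono: "a m \<le> a n" "b n \<le> b m" if "m \<le> n" for m n
    using lift_Suc_mono_le[of a m n] lift_Suc_antimono_le[of b m n] f(2,3) that by (auto simp: a_def b_def)
  have lt: "a n < b n" "b n - a n \<le> (1/2) ^ n" for n using len[OF ab(1)[of n]] by auto
  have le: "a m \<le> b n" for m n
    using mono(1)[of m "max m n"] mono(2)[of n "max m n"] lt(1)[of "max m n"] by simp
  define x where "x = (SUP n. a n)"
  have x: "a n \<le> x \<and> x \<le> b n" for n
    unfolding x_def using le by (intro conjI cSUP_upper cSUP_least bdd_aboveI2[where M="b 0"]) auto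
  then have "x \<in> E" using E ab(1) by blast
  then obtain i where i: "x \<in> U i" using Ud(1) by blast
  \<comment> \<open>A covering set containing x meets every interval of the sequence, so its fixed
    positive content is bounded by quantities tending to zero.\<close>
  have "d i powr s \<le> \<epsilon> * ((1/2) powr s) ^ n" for n
  proof -
    have "d i powr s \<le> hit_sum s U d {a n..b n}"
    proof -
      have "U i \<inter> {a n..b n} \<noteq> {}" using i x[of n] by auto
      then show ?thesis using hit_sum_sum_le[OF Ud(4), of "{i}" U "{a n..b n}"] by simp
    qed
    also have "\<dots> \<le> \<epsilon> * (b n - a n) powr s" by (rule ab)
    also have "\<dots> \<le> \<epsilon> * ((1/2) ^ n) powr s"
      using lt[of n] s \<epsilon> by (intro mult_left_mono powr_mono2) auto
    also have "((1/2) ^ n) powr s = ((1/2 :: real) powr s) ^ n"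
      by (simp add: powr_powr mult.commute flip: powr_realpow)
    finally show ?thesis .
  qed
  moreover have "(\<lambda>n. \<epsilon> * ((1/2 :: real) powr s) ^ n) \<longlonglongrightarrow> 0"
    using s powr_less_mono2[of s "1/2" 1] by (intro tendsto_mult_right_zero LIMSEQ_realpow_zero) auto
  ultimately have "d i powr s \<le> 0" by (intro LIMSEQ_le_const) auto
  then show False using Ud(2)[of i] by simp
qed

section \<open>Mass transference for balls on the line\<close>

lemma sum_disjoint_intervals_le:
  fixes f r :: "'i \<Rightarrow> real"
  assumes I: "finite I" and r: "\<And>w. w \<in> I \<Longrightarrow> 0 < r w"
    and disj: "\<And>w w'. w \<in> I \<Longrightarrow> w' \<in> I \<Longrightarrow> w \<noteq> w' \<Longrightarrow> cball (f w) (r w) \<inter> cball (f w') (r w') = {}"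
    and sub: "\<And>w. w \<in> I \<Longrightarrow> cball (f w) (r w) \<subseteq> {p..q}" and pq: "p \<le> q"
  shows "(\<Sum>w\<in>I. 2 * r w) \<le> q - p"
proof -
  have "ennreal (\<Sum>w\<in>I. 2 * r w) = (\<Sum>w\<in>I. ennreal (2 * r w))"
    using r by (intro sum_ennreal[symmetric]) (auto simp: less_imp_le)
  also have "\<dots> = (\<Sum>w\<in>I. emeasure lborel (cball (f w) (r w)))"
    using r by (intro sum.cong) (auto simp: cball_eq_atLeastAtMost less_imp_le)
  also have "\<dots> = emeasure lborel (\<Union>w\<in>I. cball (f w) (r w))"
    using disj I by (intro sum_emeasure) (auto simp: disjoint_family_on_def)
  also have "\<dots> \<le> emeasure lborel {p..q}" using sub by (intro emeasure_mono) auto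
  also have "\<dots> = ennreal (q - p)" using pq by simp
  finally show ?thesis using pq by simp
qed

text \<open>A weak form of the mass transference principle. Inside each interval the large balls carry a
  fixed proportion of the length. The balls whose shrunken core is met by a covering set that also
  meets another core have small total length and are discarded; every covering set then meets at
  most one of the remaining cores, and averaging yields a core that is covered economically.\<close>

theorem not_hnull_limsup:
  fixes f r :: "'i \<Rightarrow> real" and V :: "'i set"
  assumes s: "0 < s" and \<tau>: "1 \<le> \<tau>" "s * \<tau> < 1" and r: "\<And>w. w \<in> V \<Longrightarrow> 0 < r w"
    and pack: "\<And>a b \<eta>. 0 \<le> a \<Longrightarrow> a < b \<Longrightarrow> b \<le> 1 \<Longrightarrow> 0 < \<eta> \<Longrightarrow> \<exists>I. finite I \<and> I \<subseteq> V \<and>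
      (\<forall>w\<in>I. r w < \<eta> \<and> cball (f w) (r w) \<subseteq> {a..b}) \<and>
      (\<forall>w\<in>I. \<forall>w'\<in>I. w \<noteq> w' \<longrightarrow> cball (f w) (r w) \<inter> cball (f w') (r w') = {}) \<and>
      (b - a) / 4 \<le> (\<Sum>w\<in>I. r w)"
  shows "\<not> hnull s {x\<in>{0..1}. \<forall>\<eta>>0. \<exists>w\<in>V. r w < \<eta> \<and> \<bar>x - f w\<bar> \<le> r w powr \<tau>}"
proof -
  have s1: "s < 1" using mult_left_mono[OF \<tau>(1) less_imp_le[OF s]] \<tau>(2) by linarith
  \<comment> \<open>The unit interval from which the construction starts lies in no core, so level
    zero imposes no approximation.\<close>
  define P where "P n a b \<longleftrightarrow> 0 \<le> a \<and> a < b \<and> b \<le> 1 \<and> b - a \<le> (1/2) ^ n \<and>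
    (0 < n \<longrightarrow> (\<exists>w\<in>V. r w < (1/2) ^ n \<and> (\<forall>x\<in>{a..b}. \<bar>x - f w\<bar> \<le> r w powr \<tau>)))" for n a b
  show ?thesis
  \<comment> \<open>With this \<epsilon> a covering set meeting the current interval of length L has
    size at most L/32. The number 32 keeps the discarded radii below L/8, half of the L/4 supplied
    by the packing.\<close>
  proof (rule not_hnull_nested[where P=P and \<epsilon>="(1/32) powr s" and ?a0.0=0 and ?b0.0=1])
    show "P 0 0 1" by (simp add: P_def)
    show "a < b \<and> b - a \<le> (1/2) ^ n" if "P n a b" for n a b using that by (simp add: P_def)
    show "x \<in> {x\<in>{0..1}. \<forall>\<eta>>0. \<exists>w\<in>V. r w < \<eta> \<and> \<bar>x - f w\<bar> \<le> r w powr \<tau>}"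
      if P: "\<And>n. P n (a n) (b n)" and x: "\<And>n. a n \<le> x \<and> x \<le> b n" for a b x
    proof -
      have "\<exists>w\<in>V. r w < \<eta> \<and> \<bar>x - f w\<bar> \<le> r w powr \<tau>" if \<eta>: "0 < \<eta>" for \<eta>
      proof -
        obtain n where n: "(1/2) ^ n < \<eta>" using real_arch_pow_inv[OF \<eta>, of "1/2"] by auto
        have "(1/2 :: real) ^ Suc n \<le> (1/2) ^ n" by (rule power_decreasing) auto
        then show ?thesis using P[of "Suc n"] x[of "Suc n"] n unfolding P_def by force
      qed
      then show ?thesis using P[of 0] x[of 0] by (auto simp: P_def)
    qed
  next
    fix n a b U and d :: "nat \<Rightarrow> real"
    assume P: "P n a b" and d: "\<And>i. 0 < d i" and U: "\<And>i x y. x \<in> U i \<Longrightarrow> y \<in> U i \<Longrightarrow> \<bar>x - y\<bar> \<le> d i"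
      and sm: "summable (\<lambda>i. d i powr s)" and hit: "hit_sum s U d {a..b} \<le> (1/32) powr s * (b - a) powr s"
    define L where "L = b - a"
    have L: "0 < L" "L \<le> 1" using P by (auto simp: P_def L_def)
    \<comment> \<open>Radii below e0 satisfy 8 L^(s-1) r <= r^(s \<tau>). This is where s \<tau> < 1
      enters: cores of small balls are rich in s-dimensional content compared with the lengths of
      the balls.\<close>
    define e0 where "e0 = (L powr (1 - s) / 8) powr (1 / (1 - s * \<tau>))"
    have e0: "0 < e0" using L by (simp add: e0_def)
    define \<eta> where "\<eta> = min e0 ((1/2) ^ Suc n)"
    have \<eta>: "0 < \<eta>" using e0 by (simp add: \<eta>_def)
    obtain I where I: "finite I" "I \<subseteq> V" "\<And>w. w \<in> I \<Longrightarrow> r w < \<eta>" "\<And>w. w \<in> I \<Longrightarrow> cball (f w) (r w) \<subseteq> {a..b}"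
      "\<And>w w'. w \<in> I \<Longrightarrow> w' \<in> I \<Longrightarrow> w \<noteq> w' \<Longrightarrow> cball (f w) (r w) \<inter> cball (f w') (r w') = {}"
      "L / 4 \<le> (\<Sum>w\<in>I. r w)"
      using pack[of a b \<eta>] P \<eta> unfolding P_def L_def by metis
    have rI: "0 < r w" "r w < 1" if "w \<in> I" for w
    proof -
      have "(1/2 :: real) ^ Suc n \<le> 1" by (rule power_le_one) auto
      then show "0 < r w" "r w < 1" using that I(2) r I(3)[OF that] by (auto simp: \<eta>_def)
    qed
    \<comment> \<open>The core has length r^\<tau> and stays within r/2 of the centre, which leaves
      a margin r/2 to the boundary of the ball.\<close>
    define A where "A w = cball (f w) (r w powr \<tau> / 2)" for w
    have half: "r w powr \<tau> / 2 \<le> r w / 2" if "w \<in> I" for w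
      using powr_mono'[of 1 \<tau> "r w"] \<tau> rI[OF that] by simp
    have A: "A w \<subseteq> cball (f w) (r w)" if "w \<in> I" for w
      unfolding A_def using half[OF that] rI[OF that] by (intro subset_cball) simp
    define bad where "bad w i \<longleftrightarrow> U i \<inter> A w \<noteq> {} \<and> (\<exists>w'\<in>I. w' \<noteq> w \<and> U i \<inter> A w' \<noteq> {})" for w i
    have dL: "d i \<le> L / 32" if "bad w i" "w \<in> I" for w i
    proof -
      have "U i \<inter> {a..b} \<noteq> {}" using that A[OF that(2)] I(4)[OF that(2)] by (auto simp: bad_def)
      then show ?thesis using hit_sum_bound[OF sm s d _ hit] P by (simp add: P_def L_def)
    qed
    \<comment> \<open>A covering set that meets the core of w and another core has to cross the
      margin around the former.\<close>
    have bad_r: "r w / 2 \<le> d i" if bad: "bad w i" and w: "w \<in> I" for w i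
    proof -
      obtain x w' y where x: "x \<in> U i" "x \<in> A w" "w' \<in> I" "w' \<noteq> w" "y \<in> U i" "y \<in> A w'"
        using bad by (auto simp: bad_def)
      have "y \<notin> cball (f w) (r w)" using I(5)[OF w x(3)] x(4,6) A[OF x(3)] by blast
      then have "r w < \<bar>f w - y\<bar>" by (simp add: dist_real_def)
      moreover have "\<bar>f w - x\<bar> \<le> r w / 2" using x(2) half[OF w] by (simp add: A_def dist_real_def)
      moreover have "\<bar>x - y\<bar> \<le> d i" using U x by blast
      ultimately show ?thesis by linarith
    qed
    define Bad where "Bad = {w\<in>I. \<exists>i. bad w i}"
    \<comment> \<open>Each discarded ball is charged to one covering set responsible for it.\<close>
    define \<iota> where "\<iota> w = (SOME i. bad w i)" for w
    have \<iota>: "bad w (\<iota> w)" if "w \<in> Bad" for w using that unfolding Bad_def \<iota>_def by (auto intro: someI)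
    have BadI: "Bad \<subseteq> I" by (auto simp: Bad_def)
    have finB: "finite Bad" using BadI I(1) by (rule finite_subset)
    \<comment> \<open>The balls charged to one set have radius at most 2 d i and lie within 4 d i of
      a point of that set; being disjoint, they have total length at most 8 d i.\<close>
    have fiber: "(\<Sum>w\<in>{w\<in>Bad. \<iota> w = i}. r w) \<le> 4 * d i" if i: "i \<in> \<iota> ` Bad" for i
    proof -
      obtain w0 where w0: "w0 \<in> Bad" "\<iota> w0 = i" using i by blast
      obtain x where x: "x \<in> U i" using \<iota>[OF w0(1)] w0(2) by (auto simp: bad_def)
      have "(\<Sum>w\<in>{w\<in>Bad. \<iota> w = i}. 2 * r w) \<le> (x + 4 * d i) - (x - 4 * d i)"
      proof (rule sum_disjoint_intervals_le[where f=f])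
        fix w assume w: "w \<in> {w\<in>Bad. \<iota> w = i}"
        then have wI: "w \<in> I" and bw: "bad w i" using BadI \<iota>[of w] by auto
        obtain y where y: "y \<in> U i" "y \<in> A w" using bw by (auto simp: bad_def)
        have "\<bar>f w - y\<bar> \<le> r w / 2" using y(2) half[OF wI] by (simp add: A_def dist_real_def)
        moreover have "\<bar>x - y\<bar> \<le> d i" using U x y by blast
        ultimately have "x - 4 * d i \<le> f w - r w" "f w + r w \<le> x + 4 * d i"
          using bad_r[OF bw wI] d[of i] unfolding abs_le_iff by linarith+
        then show "cball (f w) (r w) \<subseteq> {x - 4 * d i..x + 4 * d i}"
          by (auto simp: cball_eq_atLeastAtMost)
      next
        fix w w' assume "w \<in> {w\<in>Bad. \<iota> w = i}" "w' \<in> {w\<in>Bad. \<iota> w = i}" "w \<noteq> w'"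
        then show "cball (f w) (r w) \<inter> cball (f w') (r w') = {}" using I(5) BadI by blast
      qed (use finB BadI rI d[of i] in \<open>auto simp: less_imp_le\<close>)
      then show ?thesis by (simp add: sum_distrib_left[symmetric])
    qed
    have "(\<Sum>w\<in>Bad. r w) = (\<Sum>i\<in>\<iota> ` Bad. \<Sum>w\<in>{w\<in>Bad. \<iota> w = i}. r w)"
      by (rule sum.image_gen[OF finB])
    also have "\<dots> \<le> (\<Sum>i\<in>\<iota> ` Bad. 4 * d i)" by (intro sum_mono fiber)
    \<comment> \<open>Because s < 1 and the sets are no longer than L/32, their lengths are
      controlled by their content through d = d^(1-s) d^s.\<close>
    also have "\<dots> \<le> (\<Sum>i\<in>\<iota> ` Bad. 4 * ((L / 32) powr (1 - s) * d i powr s))"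
    proof (rule sum_mono)
      fix i assume "i \<in> \<iota> ` Bad"
      then have "d i \<le> L / 32" using dL \<iota> BadI by blast
      then have "d i powr (1 - s) \<le> (L / 32) powr (1 - s)" using s1 d[of i] by (intro powr_mono2) auto
      then have "d i powr (1 - s) * d i powr s \<le> (L / 32) powr (1 - s) * d i powr s" by (intro mult_right_mono) auto
      then show "4 * d i \<le> 4 * ((L / 32) powr (1 - s) * d i powr s)"
        using d[of i] by (simp flip: powr_add)
    qed
    also have "\<dots> = 4 * ((L / 32) powr (1 - s) * (\<Sum>i\<in>\<iota> ` Bad. d i powr s))" by (simp add: sum_distrib_left)
    also have "\<dots> \<le> 4 * ((L / 32) powr (1 - s) * (L / 32) powr s)"
    proof -
      have "(\<Sum>i\<in>\<iota> ` Bad. d i powr s) \<le> hit_sum s U d {a..b}"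
      proof (rule hit_sum_sum_le[OF sm])
        fix i assume "i \<in> \<iota> ` Bad"
        then obtain w where "w \<in> I" "bad w i" using \<iota> BadI by blast
        then show "U i \<inter> {a..b} \<noteq> {}" using A[of w] I(4)[of w] by (auto simp: bad_def)
      qed (use finB in simp)
      also have "\<dots> \<le> (L / 32) powr s" using hit L by (simp add: L_def powr_mult[symmetric])
      finally show ?thesis by (intro mult_left_mono) auto
    qed
    also have "\<dots> = L / 8" using L by (simp flip: powr_add)
    finally have Bad_sum: "(\<Sum>w\<in>Bad. r w) \<le> L / 8" .
    define G where "G = I - Bad"
    have G: "L / 8 \<le> (\<Sum>w\<in>G. r w)"
      unfolding G_def using sum_diff[OF I(1) BadI, of r] I(6) Bad_sum by simp
    have "\<exists>w\<in>G. hit_sum s U d (A w) \<le> (1/32) powr s * (r w powr \<tau>) powr s"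
    proof (rule hit_sum_pick[OF sm])
      show "finite G" using I(1) by (simp add: G_def)
      show "A w \<subseteq> {a..b}" if "w \<in> G" for w using A[of w] I(4)[of w] that by (auto simp: G_def)
      show "w = w'" if "w \<in> G" "w' \<in> G" "U i \<inter> A w \<noteq> {}" "U i \<inter> A w' \<noteq> {}" for i w w'
        using that unfolding G_def Bad_def bad_def by blast
      show "hit_sum s U d {a..b} \<le> (1/32) powr s * L powr s" using hit by (simp add: L_def)
      have "L powr s = 8 / L powr (1 - s) * (L / 8)"
      proof -
        have "L powr s * L powr (1 - s) = L" using L by (simp flip: powr_add)
        then show ?thesis using L by (simp add: field_simps)
      qed
      also have "\<dots> \<le> 8 / L powr (1 - s) * (\<Sum>w\<in>G. r w)" by (intro mult_left_mono G) auto
      also have "\<dots> = (\<Sum>w\<in>G. 8 / L powr (1 - s) * r w)" by (simp add: sum_distrib_left)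
      also have "\<dots> \<le> (\<Sum>w\<in>G. (r w powr \<tau>) powr s)"
      proof (rule sum_mono)
        fix w assume w: "w \<in> G"
        then have rw: "0 < r w" "r w < e0" using rI[of w] I(3)[of w] by (auto simp: G_def \<eta>_def)
        have "r w powr (1 - s * \<tau>) \<le> e0 powr (1 - s * \<tau>)" using rw \<tau> by (intro powr_mono2) auto
        also have "\<dots> = L powr (1 - s) / 8" unfolding e0_def powr_powr using \<tau>(2) L by simp
        finally have le: "r w powr (1 - s * \<tau>) \<le> L powr (1 - s) / 8" .
        have "8 / L powr (1 - s) * r w = (8 / L powr (1 - s) * r w powr (1 - s * \<tau>)) * r w powr (s * \<tau>)"
          using rw by (simp add: mult.assoc flip: powr_add)
        also have "\<dots> \<le> 1 * r w powr (s * \<tau>)"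
          using le L by (intro mult_right_mono) (auto simp: field_simps)
        finally show "8 / L powr (1 - s) * r w \<le> (r w powr \<tau>) powr s" by (simp add: powr_powr mult.commute)
      qed
      finally show "L powr s \<le> (\<Sum>w\<in>G. (r w powr \<tau>) powr s)" .
    qed (use L in auto)
    then obtain w where w: "w \<in> G" "hit_sum s U d (A w) \<le> (1/32) powr s * (r w powr \<tau>) powr s" by blast
    have wI: "w \<in> I" using w(1) by (simp add: G_def)
    define a' b' where "a' = f w - r w powr \<tau> / 2" and "b' = f w + r w powr \<tau> / 2"
    have Aab: "A w = {a'..b'}" by (simp add: A_def a'_def b'_def cball_eq_atLeastAtMost)
    have rp: "0 < r w powr \<tau>" using rI[OF wI] by simp
    have rle: "r w powr \<tau> \<le> r w" using half[OF wI] by simp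
    have rn: "r w < (1/2) ^ Suc n" using I(3)[OF wI] by (simp add: \<eta>_def)
    have "{a'..b'} \<subseteq> {a..b}" using A[OF wI] I(4)[OF wI] unfolding Aab by (rule order_trans)
    moreover have "a' < b'" using rp by (simp add: a'_def b'_def)
    ultimately have sub: "a \<le> a'" "b' \<le> b" by auto
    have len: "b' - a' = r w powr \<tau>" by (simp add: a'_def b'_def)
    have "P (Suc n) a' b'"
      unfolding P_def
    proof (intro conjI impI bexI[of _ w] ballI)
      fix x assume "x \<in> {a'..b'}"
      then show "\<bar>x - f w\<bar> \<le> r w powr \<tau>" using rp unfolding a'_def b'_def abs_le_iff by auto
    qed (use P sub len rle rn rp wI I(2) \<open>a' < b'\<close> in \<open>auto simp: P_def\<close>)
    moreover have "hit_sum s U d {a'..b'} \<le> (1/32) powr s * (b' - a') powr s"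
      using w(2) unfolding Aab len .
    ultimately show "\<exists>a' b'. a \<le> a' \<and> b' \<le> b \<and> P (Suc n) a' b' \<and> hit_sum s U d {a'..b'} \<le> (1/32) powr s * (b' - a') powr s"
      using sub by blast
  qed (use s in auto)
qed

section \<open>Badly approximable directions have full dimension\<close>

lemma subinterval_avoiding_finite:
  fixes Z :: "real set"
  assumes "finite Z"
  obtains a b where "0 \<le> a" "a < b" "b \<le> 1" "{a..b} \<inter> Z = {}"
proof -
  have "infinite ({0<..<1::real} - Z)" using assms by (simp add: infinite_Ioo)
  then obtain x where x: "x \<in> {0<..<1} - Z" by (metis all_not_in_conv finite.emptyI)
  have "open ({0<..<1} - Z)" by (intro open_Diff finite_imp_closed assms) auto
  then obtain e where e: "e > 0" "cball x e \<subseteq> {0<..<1} - Z" using x open_contains_cball by blast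
  have sub: "{x - e..x + e} \<subseteq> {0<..<1} - Z" using e(2) by (simp add: cball_eq_atLeastAtMost)
  moreover have "x - e \<in> {0<..<1}" "x + e \<in> {0<..<1}"
    using subsetD[OF sub, of "x - e"] subsetD[OF sub, of "x + e"] e(1) by auto
  ultimately show ?thesis using e(1) by (intro that[of "x - e" "x + e"]) auto
qed

text \<open>Splitting an interval into \<open>2m\<close> pieces and keeping every other one, at most one
  piece is too close to a slope of the next scale, because these slopes are separated.\<close>

theorem not_hnull_dir_dioph:
  assumes W: "separated c W" and s: "0 < s" "s < 1"
  shows "\<not> hnull s {\<xi>\<in>{0..1}. dir_dioph W 1 \<xi>}"
proof -
  have c: "0 < c" using W by (simp add: separated_def)
  \<comment> \<open>Large enough for (2 m)^s <= m - 1: the pieces surviving a step, at least m - 1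
    of relative length 1/(2 m), retain the s-dimensional size of the interval.\<close>
  obtain m0 :: nat where m0: "(2 powr (s + 1)) powr (1 / (1 - s)) \<le> real m0" using real_arch_simple by blast
  define m where "m = m0 + 2"
  define N where "N = 2 * real m"
  have N: "4 \<le> N" by (simp add: N_def m_def)
  have mN: "N powr s \<le> real m - 1"
  proof -
    have "2 powr (s + 1) = ((2 powr (s + 1)) powr (1 / (1 - s))) powr (1 - s)"
      using s by (simp add: powr_powr)
    also have "\<dots> \<le> real m powr (1 - s)" using m0 s by (intro powr_mono2) (auto simp: m_def)
    finally have "real m powr s * 2 powr (s + 1) \<le> real m powr s * real m powr (1 - s)"
      by (intro mult_left_mono) auto
    also have "\<dots> = real m" by (simp add: m_def flip: powr_add)
    finally have "2 * N powr s \<le> real m" by (simp add: N_def powr_mult powr_add mult_ac)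
    then show ?thesis by (simp add: m_def)
  qed
  let ?f = "\<lambda>w :: real^2. w$2 / w$1"
  \<comment> \<open>Vectors too short for the multiscale construction; the starting interval avoids
    their slopes once and for all.\<close>
  define Z where "Z = {w\<in>W. \<bar>w$1\<bar> \<le> 1 \<and> \<bar>w$2\<bar> \<le> 2}"
  have finZ: "finite Z" unfolding Z_def by (rule finite_bounded_vectors[OF W])
  obtain a1 b1 where ab1: "0 \<le> a1" "a1 < b1" "b1 \<le> 1" "{a1..b1} \<inter> ?f ` Z = {}"
    using subinterval_avoiding_finite[of "?f ` Z"] finZ by auto
  \<comment> \<open>An interval of level n has length \<delta> / N^n. The factor 4 makes two slopes
    near it closer than c / N^(n+1), which is impossible for distinct vectors with positive first
    coordinates whose squares are below N^(n+1).\<close>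
  define \<delta> where "\<delta> = min (b1 - a1) (c / (4 * N))"
  have \<delta>: "0 < \<delta>" "\<delta> \<le> b1 - a1" "\<delta> \<le> c / (4 * N)" using ab1 c N by (auto simp: \<delta>_def)
  \<comment> \<open>At level n the distance \<eta> / N^n is half a piece, so two points near the
    same slope are closer than the gap between kept pieces.\<close>
  define \<eta> where "\<eta> = \<delta> / (2 * N)"
  have \<eta>: "0 < \<eta>" "\<eta> \<le> \<delta>" using \<delta> N by (auto simp: \<eta>_def field_simps)
  define P where "P n a b \<longleftrightarrow> a1 \<le> a \<and> b \<le> b1 \<and> b - a = \<delta> / N ^ n \<and>
    (\<forall>x\<in>{a..b}. \<forall>w\<in>W. 1 \<le> w$1 \<and> (w$1)\<^sup>2 < N ^ n \<longrightarrow> \<eta> \<le> (w$1)\<^sup>2 * \<bar>x - ?f w\<bar>)" for n a b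
  show ?thesis
  \<comment> \<open>This \<epsilon> keeps covering sets to at most half a piece, too short to meet
    two kept pieces.\<close>
  proof (rule not_hnull_nested[where P=P and \<epsilon>="(1 / (2 * N)) powr s" and ?a0.0=a1 and ?b0.0="a1 + \<delta>"])
    \<comment> \<open>Level zero is vacuous: no vector falls into the range handled so far.\<close>
    have "False" if "1 \<le> w$1" "(w$1)\<^sup>2 < 1" for w :: "real^2"
      using that one_le_power[of "w$1" 2] by linarith
    then show "P 0 a1 (a1 + \<delta>)" using \<delta> by (auto simp: P_def)
    show "a < b \<and> b - a \<le> (1/2) ^ n" if P: "P n a b" for n a b
    proof -
      have ba: "b - a = \<delta> / N ^ n" using P by (simp add: P_def)
      have "0 < \<delta> / N ^ n" using \<delta> N by simp
      moreover have "\<delta> / N ^ n \<le> 1 / 2 ^ n"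
        using \<delta> ab1 N by (intro frac_le power_mono) auto
      ultimately show ?thesis using ba by (simp add: power_one_over)
    qed
    show "x \<in> {\<xi>\<in>{0..1}. dir_dioph W 1 \<xi>}" if P: "\<And>n. P n (a n) (b n)" and x: "\<And>n. a n \<le> x \<and> x \<le> b n" for a b x
    proof -
      have x1: "x \<in> {a1..b1}" using P[of 0] x[of 0] by (auto simp: P_def)
      have pos: "\<eta> \<le> w$1 * \<bar>w$2 - x * w$1\<bar>" if w: "w \<in> W" "1 \<le> w$1" for w
      proof -
        obtain n where n: "(w$1)\<^sup>2 < N ^ n" using real_arch_pow[of N "(w$1)\<^sup>2"] N by auto
        have "\<eta> \<le> (w$1)\<^sup>2 * \<bar>x - ?f w\<bar>" using P[of n] x[of n] w n unfolding P_def by auto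
        also have "\<dots> = w$1 * \<bar>w$1 * (x - ?f w)\<bar>" using w by (simp add: abs_mult power2_eq_square)
        also have "w$1 * (x - ?f w) = - (w$2 - x * w$1)" using w by (simp add: right_diff_distrib)
        finally show ?thesis by (simp only: abs_minus_cancel)
      qed
      define \<mu> where "\<mu> = Min (insert 1 ((\<lambda>w. \<bar>w$2 - x * w$1\<bar>) ` Z))"
      have nz: "0 < \<bar>w$2 - x * w$1\<bar>" if w: "w \<in> Z" for w
      proof (cases "w$1 = 0")
        case True
        have "w \<noteq> 0" using w W by (auto simp: Z_def separated_def)
        then show ?thesis using True by (auto simp: vec2_eq_iff)
      next
        case False
        have "x \<noteq> ?f w" using x1 ab1(4) w by blast
        then show ?thesis using False by (auto simp: eq_divide_eq)
      qed
      have \<mu>: "0 < \<mu>" "\<mu> \<le> 1" unfolding \<mu>_def using finZ nz by auto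
      have "\<mu> \<le> \<bar>w$2 - x * w$1\<bar> \<or> \<eta> \<le> \<bar>w$1\<bar> powr 1 * \<bar>w$2 - x * w$1\<bar>" if w: "w \<in> W" for w
      proof -
        \<comment> \<open>In the last case |w2 - x w1| > 1, because x lies in the unit
          interval.\<close>
        consider "1 \<le> w$1" | "w$1 \<le> -1" | "w \<in> Z" | "\<bar>w$1\<bar> < 1" "2 < \<bar>w$2\<bar>"
          using w by (fastforce simp: Z_def)
        then show ?thesis
        proof cases
          case 1 then show ?thesis using pos[OF w] by simp
        next
          case 2
          have "- w \<in> W" using W w by (simp add: separated_def)
          from pos[OF this] 2 have "\<eta> \<le> \<bar>w$1\<bar> * \<bar>- w$2 + x * w$1\<bar>" by simp
          also have "\<bar>- w$2 + x * w$1\<bar> = \<bar>w$2 - x * w$1\<bar>" by linarith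
          finally show ?thesis by simp
        next
          case 3
          then have "\<mu> \<le> \<bar>w$2 - x * w$1\<bar>" unfolding \<mu>_def using finZ by (intro Min_le) auto
          then show ?thesis ..
        next
          case 4
          have "\<bar>x * w$1\<bar> \<le> 1 * 1" unfolding abs_mult using x1 ab1 4 by (intro mult_mono) auto
          then have "\<mu> \<le> \<bar>w$2 - x * w$1\<bar>" using 4 \<mu> by linarith
          then show ?thesis ..
        qed
      qed
      then have "dir_dioph W 1 x" unfolding dir_dioph_def using \<mu> \<eta> by blast
      then show ?thesis using x1 ab1 by auto
    qed
  next
    fix n a b U and d :: "nat \<Rightarrow> real"
    assume P: "P n a b" and d: "\<And>i. 0 < d i" and U: "\<And>i x y. x \<in> U i \<Longrightarrow> y \<in> U i \<Longrightarrow> \<bar>x - y\<bar> \<le> d i"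
      and sm: "summable (\<lambda>i. d i powr s)" and hit: "hit_sum s U d {a..b} \<le> (1 / (2 * N)) powr s * (b - a) powr s"
    define L where "L = b - a"
    define l where "l = L / N"
    have Ln: "L = \<delta> / N ^ n" using P by (simp add: L_def P_def)
    have L: "0 < L" using Ln \<delta> N by simp
    have l: "0 < l" "N * l = L" using L N by (simp_all add: l_def)
    have lN: "l = \<delta> / N ^ Suc n" by (simp add: l_def Ln mult.commute)
    have \<eta>l: "2 * (\<eta> / N ^ n) = l" using N by (simp add: \<eta>_def lN)
    \<comment> \<open>Every other piece of length l, so that distinct ones are at least l
      apart.\<close>
    define A where "A j = {a + 2 * real j * l .. a + (2 * real j + 1) * l}" for j
    have Asub: "A j \<subseteq> {a..b}" if "j < m" for j
    proof -
      have "(2 * real j + 1) * l \<le> N * l" using that l by (intro mult_right_mono) (auto simp: N_def)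
      moreover have "0 \<le> 2 * real j * l" using l by simp
      ultimately show ?thesis using l(2) by (auto simp: A_def L_def)
    qed
    have gap: "l \<le> \<bar>x - y\<bar>" if "x \<in> A i" "y \<in> A j" "i \<noteq> j" for x y i j
    proof -
      have *: "l \<le> y' - x'" if "x' \<in> A i'" "y' \<in> A j'" "i' < j'" for x' y' i' j'
      proof -
        have "(2 * real i' + 2) * l \<le> 2 * real j' * l" using that l by (intro mult_right_mono) auto
        then show ?thesis using that by (simp add: A_def algebra_simps)
      qed
      show ?thesis using *[of x i y j] *[of y j x i] that by (cases i j rule: linorder_cases) auto
    qed
    define bad where "bad x w \<longleftrightarrow> w \<in> W \<and> 1 \<le> w$1 \<and> N ^ n \<le> (w$1)\<^sup>2 \<and> (w$1)\<^sup>2 < N ^ Suc n \<and> (w$1)\<^sup>2 * \<bar>x - ?f w\<bar> < \<eta>"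
      for x and w :: "real^2"
    have bad_near: "\<bar>x - ?f w\<bar> < \<eta> / N ^ n" if "bad x w" for x w
    proof -
      have "N ^ n * \<bar>x - ?f w\<bar> \<le> (w$1)\<^sup>2 * \<bar>x - ?f w\<bar>" using that by (intro mult_right_mono) (auto simp: bad_def)
      also have "\<dots> < \<eta>" using that by (simp add: bad_def)
      finally show ?thesis using N by (simp add: pos_less_divide_eq mult.commute)
    qed
    have bad_unique: "w = w'" if b: "bad x w" "bad x' w'" and x: "x \<in> {a..b}" "x' \<in> {a..b}" for x x' w w'
    proof (rule ccontr)
      assume "w \<noteq> w'"
      have w: "w \<in> W" "w' \<in> W" "0 < w$1" "0 < w'$1" using b by (auto simp: bad_def)
      have "(w$1 * w'$1)\<^sup>2 < (N ^ Suc n)\<^sup>2"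
        unfolding power_mult_distrib power2_eq_square[of "N ^ Suc n"]
        using b N by (intro mult_strict_mono zero_less_power) (auto simp: bad_def simp del: power_Suc)
      then have "w$1 * w'$1 < N ^ Suc n" by (rule power2_less_imp_less) (use N in \<open>simp del: power_Suc\<close>)
      then have "c / N ^ Suc n < c / (w$1 * w'$1)" using w c N by (intro divide_strict_left_mono mult_pos_pos zero_less_power) auto
      also have "\<dots> \<le> \<bar>?f w - ?f w'\<bar>" by (rule separated_slope[OF W w \<open>w \<noteq> w'\<close>])
      also have "\<dots> \<le> L + l"
      proof -
        have "\<bar>x - x'\<bar> \<le> L" using x by (auto simp: L_def abs_le_iff)
        then show ?thesis using bad_near[OF b(1)] bad_near[OF b(2)] \<eta>l by linarith
      qed
      also have "\<dots> \<le> 2 * L" using l N mult_right_mono[of 1 N l] by linarith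
      also have "\<dots> \<le> 2 * (c / (4 * N) / N ^ n)" unfolding Ln using \<delta>(3) N by (intro mult_left_mono divide_right_mono) auto
      also have "\<dots> = (c / N ^ Suc n) / 2" by (simp add: field_simps)
      finally have "c / N ^ Suc n < c / N ^ Suc n / 2" .
      moreover have "0 < c / N ^ Suc n" using c N by (intro divide_pos_pos zero_less_power) auto
      moreover have "\<not> y < y / 2" if "0 < y" for y :: real using that by simp
      ultimately show False by blast
    qed
    define I where "I = {j. j < m \<and> (\<forall>x\<in>A j. \<forall>w. \<not> bad x w)}"
    \<comment> \<open>Damaged pieces are damaged by the same vector, by \<open>bad_unique\<close>;
      all of them come within l/2 of its slope, which the gaps allow for one piece only.\<close>
    have single: "{..<m} - I \<subseteq> {j}" if jm: "j \<in> {..<m} - I" for j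
    proof
      fix i assume i: "i \<in> {..<m} - I"
      obtain x w where x: "x \<in> A i" "bad x w" using i by (auto simp: I_def)
      obtain y v where y: "y \<in> A j" "bad y v" using jm by (auto simp: I_def)
      have "x \<in> {a..b}" "y \<in> {a..b}" using Asub[of i] Asub[of j] x(1) y(1) i jm by blast+
      then have "w = v" using bad_unique x(2) y(2) by blast
      then have "\<bar>y - ?f w\<bar> < \<eta> / N ^ n" using bad_near[OF y(2)] by simp
      then have "\<bar>x - y\<bar> < l" using bad_near[OF x(2)] \<eta>l by linarith
      then show "i \<in> {j}" using gap[OF x(1) y(1)] by force
    qed
    then have "card ({..<m} - I) \<le> 1"
    proof (cases "{..<m} - I = {}")
      case False
      then obtain j where "j \<in> {..<m} - I" by blast
      then have "{..<m} - I \<subseteq> {j}" by (rule single)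
      then show ?thesis using card_mono[of "{j}"] by simp
    qed (simp only: card.empty)
    moreover have IM: "I \<subseteq> {..<m}" by (auto simp: I_def)
    moreover have "card ({..<m} - I) = m - card I"
      using card_Diff_subset[OF finite_subset[OF IM] IM] by simp
    ultimately have card: "real m - 1 \<le> real (card I)" by linarith
    have "\<exists>j\<in>I. hit_sum s U d (A j) \<le> (1 / (2 * N)) powr s * l powr s"
    proof (rule hit_sum_pick[OF sm])
      show "finite I" using IM finite_subset by blast
      show "A j \<subseteq> {a..b}" if "j \<in> I" for j using that Asub IM by auto
      show "i = j" if ij: "i \<in> I" "j \<in> I" "U k \<inter> A i \<noteq> {}" "U k \<inter> A j \<noteq> {}" for k i j
      proof (rule ccontr)
        assume "i \<noteq> j"
        obtain x y where xy: "x \<in> U k" "x \<in> A i" "y \<in> U k" "y \<in> A j" using ij by blast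
        have "U k \<inter> {a..b} \<noteq> {}" using xy Asub ij IM by blast
        then have "d k \<le> 1 / (2 * N) * L"
          using hit_sum_bound[OF sm s(1) d _ hit] L N by (simp add: L_def)
        also have "\<dots> = l / 2" by (simp add: l_def)
        finally have "d k < l" using l by simp
        moreover have "l \<le> \<bar>x - y\<bar>" using gap xy \<open>i \<noteq> j\<close> by blast
        ultimately show False using U[OF xy(1,3)] by simp
      qed
      show "hit_sum s U d {a..b} \<le> (1 / (2 * N)) powr s * L powr s" using hit by (simp add: L_def)
      have "L powr s = N powr s * l powr s" using l N by (simp add: powr_mult[symmetric])
      also have "\<dots> \<le> real (card I) * l powr s" using mN card by (intro mult_right_mono) auto
      finally show "L powr s \<le> (\<Sum>j\<in>I. l powr s)" by simp
    qed (use L N in auto)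
    then obtain j where j: "j \<in> I" "hit_sum s U d (A j) \<le> (1 / (2 * N)) powr s * l powr s" by blast
    define a' b' where "a' = a + 2 * real j * l" and "b' = a + (2 * real j + 1) * l"
    have Aj: "A j = {a'..b'}" by (simp add: A_def a'_def b'_def)
    have len: "b' - a' = l" by (simp add: a'_def b'_def algebra_simps)
    have "j < m" using j(1) IM by auto
    then have "{a'..b'} \<subseteq> {a..b}" using Asub[of j] unfolding Aj by blast
    then have sub: "a \<le> a'" "b' \<le> b" using len l by auto
    have "P (Suc n) a' b'"
      unfolding P_def
    proof (intro conjI ballI impI)
      fix x w assume x: "x \<in> {a'..b'}" and w: "w \<in> W" "1 \<le> w$1 \<and> (w$1)\<^sup>2 < N ^ Suc n"
      show "\<eta> \<le> (w$1)\<^sup>2 * \<bar>x - ?f w\<bar>"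
      proof (cases "(w$1)\<^sup>2 < N ^ n")
        case True
        have "x \<in> {a..b}" using x sub by auto
        then show ?thesis using P w True unfolding P_def by blast
      next
        case False
        have "\<not> bad x w" using j(1) x Aj by (auto simp: I_def)
        then show ?thesis using w False by (auto simp: bad_def not_less)
      qed
    qed (use P sub len lN in \<open>auto simp: P_def\<close>)
    moreover have "hit_sum s U d {a'..b'} \<le> (1 / (2 * N)) powr s * (b' - a') powr s"
      using j(2) unfolding Aj len .
    ultimately show "\<exists>a' b'. a \<le> a' \<and> b' \<le> b \<and> P (Suc n) a' b' \<and>
        hit_sum s U d {a'..b'} \<le> (1 / (2 * N)) powr s * (b' - a') powr s"
      using sub by blast
  qed (use s N in auto)
qed

section \<open>Haar measure in matrix coordinates\<close>

lemma measurable_entry [measurable]: "(\<lambda>g :: real^2^2. g $ i $ j) \<in> borel_measurable borel"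
  by (intro borel_measurable_continuous_onI continuous_intros)

lemma measurable_mat2 [measurable]:
  assumes [measurable]: "a \<in> borel_measurable M" "b \<in> borel_measurable M" "c \<in> borel_measurable M" "d \<in> borel_measurable M"
  shows "(\<lambda>x. mat2 (a x) (b x) (c x) (d x)) \<in> borel_measurable M"
proof -
  have "mat2 p q r s = p *\<^sub>R mat2 1 0 0 0 + q *\<^sub>R mat2 0 1 0 0 + r *\<^sub>R mat2 0 0 1 0 + s *\<^sub>R mat2 0 0 0 1" for p q r s
    by (simp add: mat2_eq_iff)
  then have "(\<lambda>x. mat2 (a x) (b x) (c x) (d x)) =
      (\<lambda>x. a x *\<^sub>R mat2 1 0 0 0 + b x *\<^sub>R mat2 0 1 0 0 + c x *\<^sub>R mat2 0 0 1 0 + d x *\<^sub>R mat2 0 0 0 1)"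
    by (rule ext)
  also have "\<dots> \<in> borel_measurable M" by measurable
  finally show ?thesis .
qed

lemma mat2_mult: "(g :: real^2^2) ** h = mat2 (g$1$1 * h$1$1 + g$1$2 * h$2$1) (g$1$1 * h$1$2 + g$1$2 * h$2$2)
    (g$2$1 * h$1$1 + g$2$2 * h$2$1) (g$2$1 * h$1$2 + g$2$2 * h$2$2)"
  by (simp add: mat2_eq_iff matrix_mult_component2)

lemma measurable_matrix_mult [measurable]:
  fixes f :: "'a \<Rightarrow> real^2^2"
  assumes f: "f \<in> borel_measurable M"
  shows "(\<lambda>x. \<gamma> ** f x) \<in> borel_measurable M" "(\<lambda>x. f x ** \<gamma>) \<in> borel_measurable M"
proof -
  have "(\<lambda>g :: real^2^2. \<gamma> ** g) \<in> borel_measurable borel" "(\<lambda>g :: real^2^2. g ** \<gamma>) \<in> borel_measurable borel"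
    unfolding mat2_mult by measurable
  then show "(\<lambda>x. \<gamma> ** f x) \<in> borel_measurable M" "(\<lambda>x. f x ** \<gamma>) \<in> borel_measurable M"
    using f by (auto intro: measurable_compose[OF f])
qed

lemma measurable_borel_prod_lborel:
  "f \<in> borel_measurable (borel \<Otimes>\<^sub>M borel) \<Longrightarrow> f \<in> borel_measurable (lborel \<Otimes>\<^sub>M lborel)"
  by (subst measurable_cong_sets[where M'="borel \<Otimes>\<^sub>M borel" and N'=borel]) (auto cong: sets_pair_measure_cong)

lemma nn_integral_swap:
  fixes f :: "real \<Rightarrow> real \<Rightarrow> ennreal"
  assumes "(\<lambda>(x, y). f x y) \<in> borel_measurable (borel \<Otimes>\<^sub>M borel)"
  shows "(\<integral>\<^sup>+x. \<integral>\<^sup>+y. f x y \<partial>lborel \<partial>lborel) = (\<integral>\<^sup>+y. \<integral>\<^sup>+x. f x y \<partial>lborel \<partial>lborel)"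
  using lborel_pair.Fubini[OF measurable_borel_prod_lborel[OF assms]] by simp

lemma nn_integral_cmult_ennreal:
  assumes [measurable]: "f \<in> borel_measurable M" and c: "0 \<le> c"
  shows "ennreal c * (\<integral>\<^sup>+x. ennreal c' * f x \<partial>M) = (\<integral>\<^sup>+x. ennreal (c * c') * f x \<partial>M)"
  using c by (subst nn_integral_cmult[symmetric]) (auto simp: ennreal_mult' mult.assoc)

text \<open>Two one-variable affine substitutions with an exchange of the integrals between them.
  The generic case divides by \<delta>; when \<delta> = 0, the entries \<beta> and \<gamma> serve as
  pivots instead.\<close>

lemma nn_integral_linear_SL2:
  fixes k :: "real \<Rightarrow> real \<Rightarrow> ennreal"
  assumes k [measurable]: "(\<lambda>(x, y). k x y) \<in> borel_measurable (borel \<Otimes>\<^sub>M borel)"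
    and det: "\<alpha> * \<delta> - \<beta> * \<gamma> = 1"
  shows "(\<integral>\<^sup>+x. \<integral>\<^sup>+y. k (\<alpha> * x + \<beta> * y) (\<gamma> * x + \<delta> * y) \<partial>lborel \<partial>lborel) = (\<integral>\<^sup>+x. \<integral>\<^sup>+y. k x y \<partial>lborel \<partial>lborel)"
    (is "?L = ?R")
proof (cases "\<delta> = 0")
  case False
  have "(\<integral>\<^sup>+y. k ((x + \<beta> * y) / \<delta>) y \<partial>lborel) = \<bar>\<delta>\<bar> * (\<integral>\<^sup>+y. k (\<alpha> * x + \<beta> * y) (\<gamma> * x + \<delta> * y) \<partial>lborel)" for x
  proof -
    have "(x + \<beta> * (\<gamma> * x + \<delta> * y)) / \<delta> = \<alpha> * x + \<beta> * y" for y
    proof -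
      have "x + \<beta> * (\<gamma> * x + \<delta> * y) = (\<alpha> * x + \<beta> * y) * \<delta>" using det by algebra
      then show ?thesis using False by simp
    qed
    then show ?thesis by (subst nn_integral_real_affine[OF _ False, of _ "\<gamma> * x"]) simp_all
  qed
  then have "\<bar>\<delta>\<bar> * ?L = (\<integral>\<^sup>+x. \<integral>\<^sup>+y. k ((x + \<beta> * y) / \<delta>) y \<partial>lborel \<partial>lborel)"
    by (simp add: nn_integral_cmult)
  also have "\<dots> = (\<integral>\<^sup>+y. \<integral>\<^sup>+x. k ((x + \<beta> * y) / \<delta>) y \<partial>lborel \<partial>lborel)"
    by (rule nn_integral_swap) measurable
  also have "\<dots> = (\<integral>\<^sup>+y. \<bar>\<delta>\<bar> * (\<integral>\<^sup>+x. k x y \<partial>lborel) \<partial>lborel)"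
  proof (rule nn_integral_cong)
    fix y
    show "(\<integral>\<^sup>+x. k ((x + \<beta> * y) / \<delta>) y \<partial>lborel) = \<bar>\<delta>\<bar> * (\<integral>\<^sup>+x. k x y \<partial>lborel)"
      using False by (subst nn_integral_real_affine[OF _ False, of _ "- \<beta> * y"]) simp_all
  qed
  also have "\<dots> = \<bar>\<delta>\<bar> * (\<integral>\<^sup>+y. \<integral>\<^sup>+x. k x y \<partial>lborel \<partial>lborel)" by (simp add: nn_integral_cmult)
  also have "(\<integral>\<^sup>+y. \<integral>\<^sup>+x. k x y \<partial>lborel \<partial>lborel) = ?R" by (rule nn_integral_swap[symmetric]) measurable
  finally show ?thesis using False by (simp add: ennreal_mult_cancel_left)
next
  case True
  then have bc: "\<beta> \<noteq> 0" "\<gamma> \<noteq> 0" "\<bar>\<gamma>\<bar> * \<bar>\<beta>\<bar> = 1" using det by (auto simp: abs_mult[symmetric] mult.commute)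
  have "\<bar>\<beta>\<bar> * ?L = (\<integral>\<^sup>+x. \<bar>\<beta>\<bar> * (\<integral>\<^sup>+y. k (\<alpha> * x + \<beta> * y) (\<gamma> * x) \<partial>lborel) \<partial>lborel)"
    using True by (simp add: nn_integral_cmult)
  also have "\<dots> = (\<integral>\<^sup>+x. \<integral>\<^sup>+y. k y (\<gamma> * x) \<partial>lborel \<partial>lborel)"
  proof (rule nn_integral_cong)
    fix x
    show "\<bar>\<beta>\<bar> * (\<integral>\<^sup>+y. k (\<alpha> * x + \<beta> * y) (\<gamma> * x) \<partial>lborel) = (\<integral>\<^sup>+y. k y (\<gamma> * x) \<partial>lborel)"
      by (rule nn_integral_real_affine[OF _ bc(1), symmetric]) measurable
  qed
  also have "\<dots> = (\<integral>\<^sup>+y. \<integral>\<^sup>+x. k y (\<gamma> * x) \<partial>lborel \<partial>lborel)"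
    by (rule nn_integral_swap) measurable
  finally have "\<bar>\<gamma>\<bar> * (\<bar>\<beta>\<bar> * ?L) = (\<integral>\<^sup>+y. \<bar>\<gamma>\<bar> * (\<integral>\<^sup>+x. k y (\<gamma> * x) \<partial>lborel) \<partial>lborel)"
    by (simp add: nn_integral_cmult)
  also have "\<dots> = ?R"
  proof (rule nn_integral_cong)
    fix y
    show "\<bar>\<gamma>\<bar> * (\<integral>\<^sup>+x. k y (\<gamma> * x) \<partial>lborel) = (\<integral>\<^sup>+x. k y x \<partial>lborel)"
      using nn_integral_real_affine[OF _ bc(2), of "k y" 0] by simp
  qed
  finally have "ennreal (\<bar>\<gamma>\<bar> * \<bar>\<beta>\<bar>) * ?L = ?R" by (simp add: ennreal_mult mult.assoc)
  then show ?thesis by (simp add: bc(3))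
qed

section \<open>Invariance of Haar measure in matrix coordinates\<close>

definition hmat :: "real \<Rightarrow> real \<Rightarrow> real \<Rightarrow> real^2^2" where
  "hmat A C D = mat2 A ((A * D - 1) / C) C D"

text \<open>Haar measure in the coordinates \<open>A, C, D\<close>; the weight vanishes for \<open>C = 0\<close>, where
  \<open>hmat A C D\<close> need not be unimodular.\<close>

definition haar' :: "(real^2^2) measure" where
  "haar' = distr (density (lborel \<Otimes>\<^sub>M (lborel \<Otimes>\<^sub>M lborel)) (\<lambda>(A, C, D). ennreal (1 / \<bar>C\<bar>))) borel
     (\<lambda>(A, C, D). hmat A C D)"

lemma hmat_SL2: "C \<noteq> 0 \<Longrightarrow> hmat A C D \<in> SL2"
  by (simp add: hmat_def SL2_iff)

lemma hmat_eqI: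
  assumes "g \<in> SL2" "g$2$1 \<noteq> 0"
  shows "g = hmat (g$1$1) (g$2$1) (g$2$2)"
proof -
  have "g$1$1 * g$2$2 - 1 = g$1$2 * g$2$1" using assms(1) unfolding SL2_iff by linarith
  then have "(g$1$1 * g$2$2 - 1) / g$2$1 = g$1$2" using assms(2) by simp
  then show ?thesis by (simp add: hmat_def mat2_eq_iff)
qed

lemma measurable_hmat [measurable]:
  assumes [measurable]: "a \<in> borel_measurable M" "c \<in> borel_measurable M" "d \<in> borel_measurable M"
  shows "(\<lambda>x. hmat (a x) (c x) (d x)) \<in> borel_measurable M"
  unfolding hmat_def by measurable

lemma sets_haar' [simp, measurable_cong]: "sets haar' = sets borel"
  by (simp add: haar'_def)

lemma space_haar' [simp]: "space haar' = UNIV"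
  by (simp add: haar'_def)

lemma nn_integral_haar':
  assumes h [measurable]: "h \<in> borel_measurable borel"
  shows "(\<integral>\<^sup>+g. h g \<partial>haar') = (\<integral>\<^sup>+A. \<integral>\<^sup>+C. \<integral>\<^sup>+D. ennreal (1 / \<bar>C\<bar>) * h (hmat A C D) \<partial>lborel \<partial>lborel \<partial>lborel)"
proof -
  have sf: "sigma_finite_measure (lborel \<Otimes>\<^sub>M lborel :: (real \<times> real) measure)"
    by (simp add: lborel_prod lborel.sigma_finite_measure_axioms)
  let ?M = "lborel \<Otimes>\<^sub>M (lborel \<Otimes>\<^sub>M lborel) :: (real \<times> real \<times> real) measure"
  have "(\<integral>\<^sup>+g. h g \<partial>haar') = (\<integral>\<^sup>+t. (case t of (A, C, D) \<Rightarrow> ennreal (1 / \<bar>C\<bar>)) * h (case t of (A, C, D) \<Rightarrow> hmat A C D) \<partial>?M)"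
    unfolding haar'_def by (subst nn_integral_distr, measurable, subst nn_integral_density, measurable)
  also have "\<dots> = (\<integral>\<^sup>+A. \<integral>\<^sup>+p. (case (A, p) of (A, C, D) \<Rightarrow> ennreal (1 / \<bar>C\<bar>)) * h (case (A, p) of (A, C, D) \<Rightarrow> hmat A C D) \<partial>(lborel \<Otimes>\<^sub>M lborel) \<partial>lborel)"
    by (rule sigma_finite_measure.nn_integral_fst[OF sf, symmetric]) measurable
  also have "\<dots> = (\<integral>\<^sup>+A. \<integral>\<^sup>+C. \<integral>\<^sup>+D. ennreal (1 / \<bar>C\<bar>) * h (hmat A C D) \<partial>lborel \<partial>lborel \<partial>lborel)"
  proof (rule nn_integral_cong)
    fix A
    have "(\<lambda>(C, D). ennreal (1 / \<bar>C\<bar>) * h (hmat A C D)) \<in> borel_measurable (lborel \<Otimes>\<^sub>M lborel)"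
      by measurable
    from lborel.nn_integral_fst[OF this]
    show "(\<integral>\<^sup>+p. (case (A, p) of (A, C, D) \<Rightarrow> ennreal (1 / \<bar>C\<bar>)) * h (case (A, p) of (A, C, D) \<Rightarrow> hmat A C D) \<partial>(lborel \<Otimes>\<^sub>M lborel)) =
      (\<integral>\<^sup>+C. \<integral>\<^sup>+D. ennreal (1 / \<bar>C\<bar>) * h (hmat A C D) \<partial>lborel \<partial>lborel)"
      by (simp add: case_prod_unfold)
  qed
  finally show ?thesis .
qed

lemma AE_lborel_notin: "finite F \<Longrightarrow> AE x in (lborel :: real measure). x \<notin> F"
  by (rule AE_not_in[OF finite_imp_null_set_lborel])

text \<open>Left multiplication acts on the first column (A, C) by an element of SL(2,R). For a
  fixed column it is affine in D with slope C'/C, where C' is the new lower left entry, and this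
  slope compensates the change of the weight 1/|C|.\<close>

lemma nn_integral_haar'_left:
  assumes h [measurable]: "h \<in> borel_measurable borel" and g: "\<gamma> \<in> SL2"
  shows "(\<integral>\<^sup>+g. h (\<gamma> ** g) \<partial>haar') = (\<integral>\<^sup>+g. h g \<partial>haar')"
proof -
  define a b c d where abcd: "a = \<gamma>$1$1" "b = \<gamma>$1$2" "c = \<gamma>$2$1" "d = \<gamma>$2$2"
  have det: "a * d - b * c = 1" using g by (simp add: SL2_iff abcd)
  define k where "k A C = (\<integral>\<^sup>+D. ennreal (1 / \<bar>C\<bar>) * h (hmat A C D) \<partial>lborel)" for A C
  have [measurable]: "(\<lambda>(A, C). k A C) \<in> borel_measurable (borel \<Otimes>\<^sub>M borel)"
    unfolding k_def by measurable
  have inner: "(\<integral>\<^sup>+D. ennreal (1 / \<bar>C\<bar>) * h (\<gamma> ** hmat A C D) \<partial>lborel) = k (a * A + b * C) (c * A + d * C)"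
    if C: "C \<noteq> 0" and C': "c * A + d * C \<noteq> 0" for A C
  proof -
    let ?A = "a * A + b * C" and ?C = "c * A + d * C"
    have eq: "\<gamma> ** hmat A C D = hmat ?A ?C (- c / C + ?C / C * D)" for D
    proof -
      have "\<gamma> ** hmat A C D \<in> SL2" using g C by (intro SL2_mult hmat_SL2)
      moreover have e: "(\<gamma> ** hmat A C D)$1$1 = ?A" "(\<gamma> ** hmat A C D)$2$1 = ?C"
          "(\<gamma> ** hmat A C D)$2$2 = - c / C + ?C / C * D"
        using C by (simp_all add: matrix_mult_component2 hmat_def abcd[symmetric] field_simps)
      ultimately show ?thesis using hmat_eqI[of "\<gamma> ** hmat A C D"] C' by simp
    qed
    have nz: "?C / C \<noteq> 0" using C C' by simp
    have "k ?A ?C = \<bar>?C / C\<bar> * (\<integral>\<^sup>+D. ennreal (1 / \<bar>?C\<bar>) * h (\<gamma> ** hmat A C D) \<partial>lborel)"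
      unfolding k_def eq by (rule nn_integral_real_affine[OF _ nz]) measurable
    also have "\<dots> = (\<integral>\<^sup>+D. ennreal (\<bar>?C / C\<bar> * (1 / \<bar>?C\<bar>)) * h (\<gamma> ** hmat A C D) \<partial>lborel)"
      by (rule nn_integral_cmult_ennreal[OF _ abs_ge_zero]) measurable
    also have "\<bar>?C / C\<bar> * (1 / \<bar>?C\<bar>) = 1 / \<bar>C\<bar>" using C C' by (simp add: abs_divide)
    finally show ?thesis ..
  qed
  have "(\<integral>\<^sup>+g. h (\<gamma> ** g) \<partial>haar') = (\<integral>\<^sup>+A. \<integral>\<^sup>+C. k (a * A + b * C) (c * A + d * C) \<partial>lborel \<partial>lborel)"
  proof (subst nn_integral_haar', measurable, rule nn_integral_cong_AE)
    have "AE A in lborel. A \<notin> {0::real}" by (rule AE_lborel_notin) simp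
    then show "AE A in lborel. (\<integral>\<^sup>+C. \<integral>\<^sup>+D. ennreal (1 / \<bar>C\<bar>) * h (\<gamma> ** hmat A C D) \<partial>lborel \<partial>lborel) =
        (\<integral>\<^sup>+C. k (a * A + b * C) (c * A + d * C) \<partial>lborel)"
    proof eventually_elim
      case (elim A)
      show ?case
      proof (rule nn_integral_cong_AE)
        \<comment> \<open>The excluded values are those where the old or the new lower left entry
          vanishes. If d = 0, the quotient is 0 by convention, which does no harm: the new entry is
          then c A, and it is nonzero.\<close>
        have "AE C in lborel. C \<notin> {0, - c * A / d}" by (rule AE_lborel_notin) simp
        then show "AE C in lborel. (\<integral>\<^sup>+D. ennreal (1 / \<bar>C\<bar>) * h (\<gamma> ** hmat A C D) \<partial>lborel) = k (a * A + b * C) (c * A + d * C)"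
        proof eventually_elim
          case (elim C)
          have "c * A + d * C \<noteq> 0"
          proof (cases "d = 0")
            case True
            then show ?thesis using det \<open>A \<notin> {0}\<close> by auto
          next
            case False
            then show ?thesis using elim by (auto simp: field_simps)
          qed
          then show ?case using elim by (intro inner) auto
        qed
      qed
    qed
  qed
  also have "\<dots> = (\<integral>\<^sup>+A. \<integral>\<^sup>+C. k A C \<partial>lborel \<partial>lborel)"
    by (rule nn_integral_linear_SL2[OF _ det]) measurable
  also have "\<dots> = (\<integral>\<^sup>+g. h g \<partial>haar')" unfolding k_def by (rule nn_integral_haar'[symmetric]) measurable
  finally show ?thesis .
qed

text \<open>The substitution scales A and C by l and D by 1/l; together with the change of the
  weight 1/|C| the factors cancel.\<close>

lemma nn_integral_haar'_right:
  assumes h [measurable]: "h \<in> borel_measurable borel" and l: "0 < l"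
  shows "(\<integral>\<^sup>+g. h (g ** mat2 l 0 0 (1 / l)) \<partial>haar') = (\<integral>\<^sup>+g. h g \<partial>haar')"
proof -
  define k where "k A C = (\<integral>\<^sup>+D. ennreal (1 / \<bar>C\<bar>) * h (hmat A C D) \<partial>lborel)" for A C
  have [measurable]: "(\<lambda>(A, C). k A C) \<in> borel_measurable (borel \<Otimes>\<^sub>M borel)"
    unfolding k_def by measurable
  have eq: "hmat A C D ** mat2 l 0 0 (1 / l) = hmat (l * A) (l * C) (0 + 1 / l * D)" for A C D
    using l by (simp add: mat2_eq_iff matrix_mult_component2 hmat_def)
  have "(\<integral>\<^sup>+D. ennreal (1 / \<bar>C\<bar>) * h (hmat A C D ** mat2 l 0 0 (1 / l)) \<partial>lborel) = ennreal l * (ennreal l * k (l * A) (l * C))" for A C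
  proof -
    have nz: "1 / l \<noteq> 0" using l by simp
    have F: "(\<lambda>D. h (hmat A C D ** mat2 l 0 0 (1 / l))) \<in> borel_measurable lborel" by measurable
    have "k (l * A) (l * C) = \<bar>1 / l\<bar> * (\<integral>\<^sup>+D. ennreal (1 / \<bar>l * C\<bar>) * h (hmat A C D ** mat2 l 0 0 (1 / l)) \<partial>lborel)"
      unfolding k_def eq by (rule nn_integral_real_affine[OF _ nz]) measurable
    also have "\<dots> = (\<integral>\<^sup>+D. ennreal (\<bar>1 / l\<bar> * (1 / \<bar>l * C\<bar>)) * h (hmat A C D ** mat2 l 0 0 (1 / l)) \<partial>lborel)"
      by (rule nn_integral_cmult_ennreal[OF _ abs_ge_zero]) measurable
    finally have "ennreal l * (ennreal l * k (l * A) (l * C)) =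
        (\<integral>\<^sup>+D. ennreal (l * (l * (\<bar>1 / l\<bar> * (1 / \<bar>l * C\<bar>)))) * h (hmat A C D ** mat2 l 0 0 (1 / l)) \<partial>lborel)"
      using l by (simp only: nn_integral_cmult_ennreal[OF F less_imp_le[OF l]])
    also have "l * (l * (\<bar>1 / l\<bar> * (1 / \<bar>l * C\<bar>))) = 1 / \<bar>C\<bar>" using l by (simp add: abs_mult)
    finally show ?thesis ..
  qed
  then have "(\<integral>\<^sup>+g. h (g ** mat2 l 0 0 (1 / l)) \<partial>haar') =
      (\<integral>\<^sup>+A. \<integral>\<^sup>+C. ennreal l * (ennreal l * k (l * A) (l * C)) \<partial>lborel \<partial>lborel)"
    by (subst nn_integral_haar', measurable)
  also have "\<dots> = ennreal l * (\<integral>\<^sup>+A. ennreal l * (\<integral>\<^sup>+C. k (l * A) (l * C) \<partial>lborel) \<partial>lborel)"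
    by (simp add: nn_integral_cmult)
  also have "\<dots> = ennreal l * (\<integral>\<^sup>+A. (\<integral>\<^sup>+C. k (l * A) C \<partial>lborel) \<partial>lborel)"
  proof -
    have "ennreal l * (\<integral>\<^sup>+C. k (l * A) (l * C) \<partial>lborel) = (\<integral>\<^sup>+C. k (l * A) C \<partial>lborel)" for A
      using nn_integral_real_affine[of "k (l * A)" l 0] l by simp
    then show ?thesis by simp
  qed
  also have "\<dots> = (\<integral>\<^sup>+A. (\<integral>\<^sup>+C. k A C \<partial>lborel) \<partial>lborel)"
    using nn_integral_real_affine[of "\<lambda>A. \<integral>\<^sup>+C. k A C \<partial>lborel" l 0] l by simp
  also have "\<dots> = (\<integral>\<^sup>+g. h g \<partial>haar')" unfolding k_def by (rule nn_integral_haar'[symmetric]) measurable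
  finally show ?thesis .
qed

lemma emeasure_haar'_left:
  assumes X: "X \<in> sets borel" and g: "\<gamma> \<in> SL2"
  shows "emeasure haar' {g. \<gamma> ** g \<in> X} = emeasure haar' X"
proof -
  have "{g. \<gamma> ** g \<in> X} \<in> sets borel" using X by measurable
  then have "emeasure haar' {g. \<gamma> ** g \<in> X} = (\<integral>\<^sup>+g. indicator X (\<gamma> ** g) \<partial>haar')"
    by (subst nn_integral_indicator[symmetric], simp, intro nn_integral_cong) (simp add: indicator_def)
  also have "\<dots> = emeasure haar' X" using X g by (subst nn_integral_haar'_left) auto
  finally show ?thesis .
qed

lemma emeasure_haar'_right:
  assumes X: "X \<in> sets borel" and l: "0 < l"
  shows "emeasure haar' {g. g ** mat2 l 0 0 (1 / l) \<in> X} = emeasure haar' X"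
proof -
  have "{g. g ** mat2 l 0 0 (1 / l) \<in> X} \<in> sets borel" using X by measurable
  then have "emeasure haar' {g. g ** mat2 l 0 0 (1 / l) \<in> X} = (\<integral>\<^sup>+g. indicator X (g ** mat2 l 0 0 (1 / l)) \<partial>haar')"
    by (subst nn_integral_indicator[symmetric], simp, intro nn_integral_cong) (simp add: indicator_def)
  also have "\<dots> = emeasure haar' X" using X l by (subst nn_integral_haar'_right) auto
  finally show ?thesis .
qed

section \<open>Comparison with the Iwasawa coordinates\<close>

lemma nn_integral_jacobian:
  fixes F :: "real^2 \<Rightarrow> real^2"
  assumes S: "S \<in> sets borel" and J: "J \<in> borel_measurable borel"
    and der: "\<And>z. z \<in> S \<Longrightarrow> (F has_derivative F' z) (at z within S)"
    and det: "\<And>z. z \<in> S \<Longrightarrow> \<bar>det (matrix (F' z))\<bar> = J z" and J0: "\<And>z. 0 \<le> J z"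
    and inj: "inj_on F S" and FS: "F ` S \<in> sets borel"
  shows "(\<integral>\<^sup>+z. ennreal (J z) * indicator S z \<partial>lborel) = emeasure lborel (F ` S)"
proof -
  have S': "S \<in> sets lebesgue" using S by simp
  have cong: "(\<lambda>z. \<bar>det (matrix (F' z))\<bar>) integrable_on S \<longleftrightarrow> J integrable_on S"
    by (intro integrable_cong det)
  have em: "emeasure lborel (F ` S) = emeasure lebesgue (F ` S)" using FS by simp
  show ?thesis
  \<comment> \<open>The image has finite measure exactly when J is integrable; otherwise both sides
    are infinite.\<close>
  proof (cases "J integrable_on S")
    case True
    then have lm: "F ` S \<in> lmeasurable"
      using measurable_differentiable_image_eq[OF S' der inj] cong by simp
    have "measure lebesgue (F ` S) = integral S (\<lambda>z. \<bar>det (matrix (F' z))\<bar>)"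
      using measure_differentiable_image_eq[OF S' der inj] True cong by simp
    also have "\<dots> = integral S J" by (intro integral_cong det)
    finally have "measure lebesgue (F ` S) = integral S J" .
    moreover have "emeasure lebesgue (F ` S) = ennreal (measure lebesgue (F ` S))"
      using fmeasurableD2[OF lm] by (intro emeasure_eq_ennreal_measure) simp
    moreover have "(\<integral>\<^sup>+z. ennreal (J z) * indicator S z \<partial>lborel) = ennreal (integral S J)"
      by (rule nn_integral_has_integral_lebesgue'[OF J0 integrable_integral[OF True]])
    ultimately show ?thesis using em by simp
  next
    case False
    then have "F ` S \<notin> lmeasurable"
      using measurable_differentiable_image_eq[OF S' der inj] cong by simp
    then have inf: "emeasure lborel (F ` S) = \<infinity>"
    proof -
      have "\<not> emeasure lebesgue (F ` S) < \<infinity>" using \<open>F ` S \<notin> lmeasurable\<close> FS unfolding fmeasurable_def by simp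
      then show ?thesis unfolding em by (simp add: less_top[symmetric])
    qed
    have "(\<integral>\<^sup>+z. ennreal (J z) * indicator S z \<partial>lborel) = \<infinity>"
    proof (rule ccontr)
      assume "\<not> ?thesis"
      then have "(\<integral>\<^sup>+z. ennreal (J z * indicator S z) \<partial>lborel) < \<infinity>"
        by (simp add: ennreal_mult' J0 less_top ennreal_indicator)
      then have "(\<lambda>z. J z * indicator S z) integrable_on UNIV"
        using S J J0 by (intro nn_integral_integrable_on) auto
      also have "(\<lambda>z. J z * indicator S z) = (\<lambda>z. if z \<in> S then J z else 0)" by (auto simp: fun_eq_iff indicator_def)
      finally have "J integrable_on S" by (simp add: integrable_restrict_UNIV)
      then show False using False by simp
    qed
    then show ?thesis using inf by simp
  qed
qed

definition pair_of :: "real^2 \<Rightarrow> real \<times> real" where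
  "pair_of z = (z$1, z$2)"

lemma measurable_pair_of [measurable]: "pair_of \<in> borel_measurable borel"
  unfolding pair_of_def by (intro borel_measurable_continuous_onI continuous_intros)

lemma lborel_pair_of: "distr lborel borel pair_of = lborel"
proof (rule lborel_eqI[symmetric])
  fix l u :: "real \<times> real" assume lu: "\<And>b. b \<in> Basis \<Longrightarrow> l \<bullet> b \<le> u \<bullet> b"
  have le: "fst l \<le> fst u" "snd l \<le> snd u"
    using lu[of "(1, 0)"] lu[of "(0, 1)"] by (auto simp: Basis_prod_def inner_prod_def)
  have "pair_of -` box l u = box (vector [fst l, snd l]) (vector [fst u, snd u])"
    by (auto simp: pair_of_def mem_box_cart forall_2 box_prod mem_box Basis_prod_def inner_prod_def)
  moreover have "emeasure lborel (box (vector [fst l, snd l]) (vector [fst u, snd u]) :: (real^2) set) =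
      ennreal ((fst u - fst l) * (snd u - snd l))"
  proof -
    have B: "(Basis :: (real^2) set) = {axis 1 1, axis 2 1}" by (auto simp: Basis_vec_def UNIV_2)
    show ?thesis using le by (subst emeasure_lborel_box) (auto simp: B inner_axis axis_eq_axis)
  qed
  ultimately have "emeasure (distr lborel borel pair_of) (box l u) = ennreal ((fst u - fst l) * (snd u - snd l))"
    by (subst emeasure_distr) auto
  also have "\<dots> = ennreal (\<Prod>b\<in>Basis. (u - l) \<bullet> b)"
    by (simp add: Basis_prod_def inner_prod_def mult.commute)
  finally show "emeasure (distr lborel borel pair_of) (box l u) = ennreal (\<Prod>b\<in>Basis. (u - l) \<bullet> b)" .
qed simp

text \<open>The bottom row of \<open>iwasawa (x, y, \<theta>)\<close> for z = (y, \<theta>): polar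
  coordinates of radius 1 / sqrt y, with the angle measured from the second axis.\<close>

definition polar :: "real^2 \<Rightarrow> real^2" where
  "polar z = vector [sin (z$2) / sqrt (z$1), cos (z$2) / sqrt (z$1)]"

definition polar_der :: "real^2 \<Rightarrow> real^2 \<Rightarrow> real^2" where
  "polar_der z h = vector
     [cos (z$2) / sqrt (z$1) * h$2 - sin (z$2) / (2 * z$1 * sqrt (z$1)) * h$1,
      - sin (z$2) / sqrt (z$1) * h$2 - cos (z$2) / (2 * z$1 * sqrt (z$1)) * h$1]"

lemma has_derivative_vec2I:
  fixes f :: "'a::real_normed_vector \<Rightarrow> real^2"
  assumes "((\<lambda>x. f x $ 1) has_derivative (\<lambda>h. f' h $ 1)) (at x within S)"
    "((\<lambda>x. f x $ 2) has_derivative (\<lambda>h. f' h $ 2)) (at x within S)"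
  shows "(f has_derivative f') (at x within S)"
proof -
  have "((\<lambda>x. f x $ 1 *\<^sub>R axis 1 1 + f x $ 2 *\<^sub>R (axis 2 1 :: real^2)) has_derivative
      (\<lambda>h. f' h $ 1 *\<^sub>R axis 1 1 + f' h $ 2 *\<^sub>R axis 2 1)) (at x within S)"
    by (intro has_derivative_add has_derivative_scaleR_left assms)
  moreover have "v $ 1 *\<^sub>R axis 1 1 + v $ 2 *\<^sub>R axis 2 1 = v" for v :: "real^2"
    by (simp add: vec2_eq_iff axis_def)
  ultimately show ?thesis by simp
qed

lemma polar_has_derivative:
  assumes "0 < z$1"
  shows "(polar has_derivative polar_der z) (at z within S)"
proof -
  have nth: "((\<lambda>z :: real^2. z $ i) has_derivative (\<lambda>h. h $ i)) (at z within S)" for i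
    by (rule bounded_linear.has_derivative[OF bounded_linear_vec_nth has_derivative_ident])
  have sq: "sqrt (z$1) * sqrt (z$1) = z$1" "sqrt (z$1) > 0" using assms by auto
  show ?thesis
  proof (rule has_derivative_vec2I)
    have "((\<lambda>z. sin (z$2) / sqrt (z$1)) has_derivative
      (\<lambda>h. cos (z$2) / sqrt (z$1) * h$2 - sin (z$2) / (2 * z$1 * sqrt (z$1)) * h$1)) (at z within S)"
      using assms by (auto intro!: derivative_eq_intros nth simp: fun_eq_iff field_simps)
    then show "((\<lambda>z. polar z $ 1) has_derivative (\<lambda>h. polar_der z h $ 1)) (at z within S)"
      by (simp add: polar_def polar_der_def)
    have "((\<lambda>z. cos (z$2) / sqrt (z$1)) has_derivative
      (\<lambda>h. - sin (z$2) / sqrt (z$1) * h$2 - cos (z$2) / (2 * z$1 * sqrt (z$1)) * h$1)) (at z within S)"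
      using assms by (auto intro!: derivative_eq_intros nth simp: fun_eq_iff field_simps)
    then show "((\<lambda>z. polar z $ 2) has_derivative (\<lambda>h. polar_der z h $ 2)) (at z within S)"
      by (simp add: polar_def polar_der_def)
  qed
qed

lemma polar_det:
  assumes "0 < z$1"
  shows "\<bar>det (matrix (polar_der z))\<bar> = 1 / (2 * (z$1)\<^sup>2)"
proof -
  define s where "s = sqrt (z$1)"
  have s: "s > 0" "z$1 = s\<^sup>2" using assms by (auto simp: s_def)
  have "det (matrix (polar_der z)) = (sin (z$2))\<^sup>2 / (2 * z$1 * s * s) + (cos (z$2))\<^sup>2 / (2 * z$1 * s * s)"
    by (simp add: det_2 matrix_def polar_der_def axis_def s_def[symmetric] power2_eq_square)
  also have "\<dots> = ((sin (z$2))\<^sup>2 + (cos (z$2))\<^sup>2) / (2 * z$1 * s * s)" by (simp only: add_divide_distrib)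
  also have "\<dots> = 1 / (2 * z$1 * s * s)" by (simp only: sin_cos_squared_add)
  also have "\<dots> = 1 / (2 * (z$1)\<^sup>2)" by (simp add: s(2) power2_eq_square mult.assoc)
  finally show ?thesis by simp
qed

lemma polar_inj: "inj_on polar {z. 0 < z$1 \<and> 0 \<le> z$2 \<and> z$2 < 2 * pi}"
proof (rule inj_onI)
  fix z w :: "real^2"
  assume z: "z \<in> {z. 0 < z$1 \<and> 0 \<le> z$2 \<and> z$2 < 2 * pi}" and w: "w \<in> {z. 0 < z$1 \<and> 0 \<le> z$2 \<and> z$2 < 2 * pi}"
    and eq: "polar z = polar w"
  have norm: "(polar v $ 1)\<^sup>2 + (polar v $ 2)\<^sup>2 = 1 / v$1" if "0 < v$1" for v
    using that by (simp add: polar_def power_divide add_divide_distrib[symmetric])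
  have 1: "z$1 = w$1" using norm[of z] norm[of w] z w eq by simp
  have "sin (z$2) = sin (w$2) \<and> cos (z$2) = cos (w$2)"
    using eq z w 1 by (auto simp: polar_def vec2_eq_iff)
  then obtain n :: int where n: "z$2 = w$2 + 2 * pi * n" using sin_cos_eq_iff by blast
  have "\<bar>2 * pi * n\<bar> < 2 * pi" using n z w by auto
  then have "\<bar>real_of_int n\<bar> < 1" by (simp add: abs_mult)
  then have "n = 0" by linarith
  then show "z = w" using n 1 by (simp add: vec2_eq_iff)
qed

lemma polar_image: "polar ` {z. 0 < z$1 \<and> 0 \<le> z$2 \<and> z$2 < 2 * pi} = - {0}"
proof (intro equalityI subsetI)
  fix v :: "real^2" assume "v \<in> - {0}"
  then have nz: "(v$1)\<^sup>2 + (v$2)\<^sup>2 > 0" by (auto simp: vec2_eq_iff sum_power2_gt_zero_iff)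
  define r where "r = sqrt ((v$1)\<^sup>2 + (v$2)\<^sup>2)"
  have r: "r > 0" "r\<^sup>2 = (v$1)\<^sup>2 + (v$2)\<^sup>2" using nz by (auto simp: r_def)
  have "(v$2 / r)\<^sup>2 + (v$1 / r)\<^sup>2 = ((v$1)\<^sup>2 + (v$2)\<^sup>2) / r\<^sup>2" by (simp add: power_divide add_divide_distrib)
  also have "\<dots> = 1" using r(1) unfolding r(2)[symmetric] by simp
  finally obtain t where t: "0 \<le> t" "t < 2 * pi" "v$2 / r = cos t" "v$1 / r = sin t" by (rule sincos_total_2pi)
  define z :: "real^2" where "z = vector [1 / r\<^sup>2, t]"
  have z: "z$1 = 1 / r\<^sup>2" "z$2 = t" by (simp_all add: z_def)
  have "sqrt (z$1) = 1 / r" using r(1) by (simp add: z real_sqrt_divide)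
  moreover have "v$1 = sin t * r" "v$2 = cos t * r" using t(3,4) r(1) by (simp_all add: field_simps)
  ultimately have "polar z = v" by (simp add: polar_def z(2) vec2_eq_iff)
  moreover have "0 < z$1" using r(1) by (simp add: z)
  ultimately show "v \<in> polar ` {z. 0 < z$1 \<and> 0 \<le> z$2 \<and> z$2 < 2 * pi}" using t z by force
next
  fix v assume "v \<in> polar ` {z. 0 < z$1 \<and> 0 \<le> z$2 \<and> z$2 < 2 * pi}"
  then obtain z where z: "0 < z$1" "v = polar z" by blast
  have "(v$1)\<^sup>2 + (v$2)\<^sup>2 = 1 / z$1"
    using z by (simp add: polar_def power_divide add_divide_distrib[symmetric])
  then show "v \<in> - {0}" using z by auto
qed

definition polar_weight :: "real \<times> real \<Rightarrow> ennreal" where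
  "polar_weight = (\<lambda>(y, \<theta>). indicator {(y, \<theta>). 0 < y \<and> 0 \<le> \<theta> \<and> \<theta> < 2 * pi} (y, \<theta>) * ennreal (1 / y\<^sup>2))"

lemma measurable_polar_weight [measurable]: "polar_weight \<in> borel_measurable borel"
proof -
  have "polar_weight \<in> borel_measurable (borel \<Otimes>\<^sub>M borel)" unfolding polar_weight_def by measurable
  then show ?thesis by (simp add: borel_prod)
qed

text \<open>The Jacobian of the bottom row is 1 / (2 y^2), half of the hyperbolic density, which
  explains the factor 2. The only row that is missed is the origin, a null set.\<close>

lemma polar_distr:
  "distr (density lborel polar_weight) borel (\<lambda>(y, \<theta>). (sin \<theta> / sqrt y, cos \<theta> / sqrt y)) = density lborel (\<lambda>_. 2)"
    (is "distr _ _ ?f = _")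
proof (rule measure_eqI)
  fix X assume "X \<in> sets (distr (density lborel polar_weight) borel ?f)"
  then have X [measurable]: "X \<in> sets borel" by simp
  have f [measurable]: "?f \<in> borel_measurable borel"
  proof -
    have "?f \<in> borel_measurable (borel \<Otimes>\<^sub>M borel)" by measurable
    then show ?thesis by (simp add: borel_prod)
  qed
  let ?T = "{z :: real^2. 0 < z$1 \<and> 0 \<le> z$2 \<and> z$2 < 2 * pi}"
  define S where "S = {z \<in> ?T. ?f (pair_of z) \<in> X}"
  have nth [measurable]: "(\<lambda>z :: real^2. z $ i) \<in> borel_measurable borel" for i
    by (intro borel_measurable_continuous_onI continuous_intros)
  have S [measurable]: "S \<in> sets borel" unfolding S_def by measurable
  have pf: "pair_of (polar z) = ?f (pair_of z)" for z by (simp add: pair_of_def polar_def)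
  have img: "polar ` S = pair_of -` X - {0}"
  proof (intro equalityI subsetI)
    fix v assume "v \<in> polar ` S"
    then obtain z where z: "z \<in> ?T" "?f (pair_of z) \<in> X" "v = polar z" by (auto simp: S_def)
    then have "v \<in> - {0}" using polar_image by blast
    then show "v \<in> pair_of -` X - {0}" using z pf by auto
  next
    fix v assume v: "v \<in> pair_of -` X - {0}"
    then obtain z where z: "z \<in> ?T" "v = polar z" using polar_image by blast
    then show "v \<in> polar ` S" using v pf by (auto simp: S_def)
  qed
  have vX [measurable]: "pair_of -` X \<in> sets borel" using measurable_sets[OF measurable_pair_of X] by simp
  have imgs: "polar ` S \<in> sets borel" unfolding img by measurable
  have "emeasure (distr (density lborel polar_weight) borel ?f) X = (\<integral>\<^sup>+q. polar_weight q * indicator X (?f q) \<partial>lborel)"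
  proof -
    have fX: "?f -` X \<in> sets borel" using measurable_sets[OF f X] by simp
    have "emeasure (distr (density lborel polar_weight) borel ?f) X = emeasure (density lborel polar_weight) (?f -` X)"
      by (subst emeasure_distr) auto
    also have "\<dots> = (\<integral>\<^sup>+q. polar_weight q * indicator (?f -` X) q \<partial>lborel)"
      using fX by (subst emeasure_density) auto
    finally show ?thesis by (simp add: indicator_def)
  qed
  also have "\<dots> = (\<integral>\<^sup>+z. polar_weight (pair_of z) * indicator X (?f (pair_of z)) \<partial>lborel)"
    by (subst lborel_pair_of[symmetric], subst nn_integral_distr) measurable
  also have "\<dots> = (\<integral>\<^sup>+z. 2 * (ennreal (1 / (2 * (z$1)\<^sup>2)) * indicator S z) \<partial>lborel)"
  proof (rule nn_integral_cong)
    fix z :: "real^2"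
    have "2 * ennreal (1 / (2 * (z$1)\<^sup>2)) = ennreal (2 * (1 / (2 * (z$1)\<^sup>2)))" by (subst ennreal_mult) auto
    then have "2 * ennreal (1 / (2 * (z$1)\<^sup>2)) = ennreal (1 / (z$1)\<^sup>2)" by simp
    then show "polar_weight (pair_of z) * indicator X (?f (pair_of z)) = 2 * (ennreal (1 / (2 * (z$1)\<^sup>2)) * indicator S z)"
      by (auto simp: polar_weight_def pair_of_def S_def indicator_def mult.assoc[symmetric])
  qed
  also have "\<dots> = 2 * (\<integral>\<^sup>+z. ennreal (1 / (2 * (z$1)\<^sup>2)) * indicator S z \<partial>lborel)"
    by (rule nn_integral_cmult) measurable
  also have "(\<integral>\<^sup>+z. ennreal (1 / (2 * (z$1)\<^sup>2)) * indicator S z \<partial>lborel) = emeasure lborel (polar ` S)"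
  proof (rule nn_integral_jacobian[where F'=polar_der])
    show "inj_on polar S" by (rule inj_on_subset[OF polar_inj]) (auto simp: S_def)
  qed (use imgs polar_has_derivative polar_det in \<open>auto simp: S_def\<close>)
  also have "\<dots> = emeasure lborel (pair_of -` X)"
    unfolding img by (rule emeasure_Diff_null_set) auto
  also have "\<dots> = emeasure (distr lborel borel pair_of) X" by (subst emeasure_distr) auto
  also have "\<dots> = emeasure lborel X" by (simp only: lborel_pair_of)
  also have "2 * emeasure lborel X = emeasure (density lborel (\<lambda>_. 2)) X" by (simp add: emeasure_density_const)
  finally show "emeasure (distr (density lborel polar_weight) borel ?f) X = emeasure (density lborel (\<lambda>_. 2)) X" .
qed simp

lemma nn_integral_rotate:
  fixes f :: "real \<Rightarrow> real \<Rightarrow> real \<Rightarrow> ennreal"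
  assumes f: "(\<lambda>(x, y, z). f x y z) \<in> borel_measurable (borel \<Otimes>\<^sub>M (borel \<Otimes>\<^sub>M borel))"
  shows "(\<integral>\<^sup>+x. \<integral>\<^sup>+y. \<integral>\<^sup>+z. f x y z \<partial>lborel \<partial>lborel \<partial>lborel) = (\<integral>\<^sup>+y. \<integral>\<^sup>+z. \<integral>\<^sup>+x. f x y z \<partial>lborel \<partial>lborel \<partial>lborel)"
proof -
  have [measurable]: "(\<lambda>t. f (a t) (b t) (c t)) \<in> borel_measurable M"
    if "a \<in> borel_measurable M" "b \<in> borel_measurable M" "c \<in> borel_measurable M" for a b c and M :: "'z measure"
    using measurable_compose[OF measurable_Pair[OF that(1) measurable_Pair[OF that(2,3)]] f] by simp
  have "(\<integral>\<^sup>+x. \<integral>\<^sup>+y. \<integral>\<^sup>+z. f x y z \<partial>lborel \<partial>lborel \<partial>lborel) = (\<integral>\<^sup>+y. \<integral>\<^sup>+x. \<integral>\<^sup>+z. f x y z \<partial>lborel \<partial>lborel \<partial>lborel)"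
    by (rule nn_integral_swap) measurable
  also have "\<dots> = (\<integral>\<^sup>+y. \<integral>\<^sup>+z. \<integral>\<^sup>+x. f x y z \<partial>lborel \<partial>lborel \<partial>lborel)"
    by (intro nn_integral_cong nn_integral_swap) measurable
  finally show ?thesis .
qed

text \<open>The Iwasawa product expressed by x and its bottom row (C, D), for which C^2 + D^2 =
  1/y.\<close>

definition gmat :: "real \<Rightarrow> real \<Rightarrow> real \<Rightarrow> real^2^2" where
  "gmat x C D = mat2 (D / (C\<^sup>2 + D\<^sup>2) + x * C) (x * D - C / (C\<^sup>2 + D\<^sup>2)) C D"

lemma measurable_gmat [measurable]:
  assumes [measurable]: "x \<in> borel_measurable M" "c \<in> borel_measurable M" "d \<in> borel_measurable M"
  shows "(\<lambda>t. gmat (x t) (c t) (d t)) \<in> borel_measurable M"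
  unfolding gmat_def by measurable

lemma gmat_hmat:
  assumes "C \<noteq> 0"
  shows "gmat x C D = hmat (D / (C\<^sup>2 + D\<^sup>2) + C * x) C D"
proof -
  have "C\<^sup>2 + D\<^sup>2 \<noteq> 0" using assms by (simp add: sum_power2_eq_zero_iff)
  then have "((D / (C\<^sup>2 + D\<^sup>2) + C * x) * D - 1) = C * (x * D - C / (C\<^sup>2 + D\<^sup>2))"
    by (simp add: field_simps power2_eq_square)
  then show ?thesis using assms by (simp add: gmat_def hmat_def mat2_eq_iff mult.commute)
qed

lemma iwasawa_mat2:
  "iwasawa (x, y, \<theta>) = mat2 (sqrt y * cos \<theta> + x * (sin \<theta> / sqrt y)) (x * (cos \<theta> / sqrt y) - sqrt y * sin \<theta>)
     (sin \<theta> / sqrt y) (cos \<theta> / sqrt y)"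
  by (simp add: iwasawa_def umat_def amat_def kmat_def mat2_eq_iff matrix_mult_component2 algebra_simps)

lemma iwasawa_gmat:
  assumes "0 < y"
  shows "iwasawa (x, y, \<theta>) = gmat x (sin \<theta> / sqrt y) (cos \<theta> / sqrt y)"
proof -
  have "(sin \<theta> / sqrt y)\<^sup>2 + (cos \<theta> / sqrt y)\<^sup>2 = 1 / y"
    using assms by (simp add: power_divide add_divide_distrib[symmetric])
  moreover have "y / sqrt y = sqrt y" using assms by (simp add: real_div_sqrt)
  ultimately show ?thesis
    by (simp add: iwasawa_mat2 gmat_def mat2_eq_iff) (metis mult.commute times_divide_eq_right)
qed

lemma measurable_iwasawa [measurable]: "iwasawa \<in> borel_measurable borel"
proof -
  have "iwasawa = (\<lambda>(x, y, \<theta>). mat2 (sqrt y * cos \<theta> + x * (sin \<theta> / sqrt y)) (x * (cos \<theta> / sqrt y) - sqrt y * sin \<theta>)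
     (sin \<theta> / sqrt y) (cos \<theta> / sqrt y))"
    by (auto simp: fun_eq_iff iwasawa_mat2)
  also have "\<dots> \<in> borel_measurable (borel \<Otimes>\<^sub>M (borel \<Otimes>\<^sub>M borel))" by measurable
  finally show ?thesis by (simp add: borel_prod)
qed

text \<open>Replacing (y, \<theta>) by the bottom row contributes the constant 2. For a given row
  the entry A is affine in x with slope C, and this Jacobian is exactly the weight 1/|C| of
  \<open>haar'\<close>.\<close>

lemma nn_integral_haar_SL2:
  assumes h [measurable]: "h \<in> borel_measurable borel"
  shows "(\<integral>\<^sup>+g. h g \<partial>haar_SL2) = 2 * (\<integral>\<^sup>+g. h g \<partial>haar')"
proof -
  let ?f = "\<lambda>(y, \<theta>). (sin \<theta> / sqrt y, cos \<theta> / sqrt y) :: real \<times> real"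
  have f [measurable]: "?f \<in> borel_measurable borel"
  proof -
    have "?f \<in> borel_measurable (borel \<Otimes>\<^sub>M borel)" by measurable
    then show ?thesis by (simp add: borel_prod)
  qed
  have w [measurable]: "(\<lambda>p :: real \<times> real \<times> real. polar_weight (snd p)) \<in> borel_measurable borel"
    by (rule measurable_compose[OF _ measurable_polar_weight]) (simp add: borel_prod[symmetric])
  have H [measurable]: "(\<lambda>q. h (gmat x (fst q) (snd q))) \<in> borel_measurable borel" for x
  proof -
    have "(\<lambda>q. h (gmat x (fst q) (snd q))) \<in> borel_measurable (borel \<Otimes>\<^sub>M borel)" by measurable
    then show ?thesis by (simp add: borel_prod)
  qed
  have eq: "haar_SL2 = distr (density lborel (\<lambda>p. polar_weight (snd p))) borel iwasawa"
    unfolding haar_SL2_def polar_weight_def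
    by (intro arg_cong[where f="\<lambda>w. distr (density lborel w) borel iwasawa"]) (auto simp: fun_eq_iff indicator_def)
  have "(\<integral>\<^sup>+g. h g \<partial>haar_SL2) = (\<integral>\<^sup>+p. h (iwasawa p) \<partial>(density lborel (\<lambda>p. polar_weight (snd p))))"
    unfolding eq by (rule nn_integral_distr) simp_all
  also have "\<dots> = (\<integral>\<^sup>+p. polar_weight (snd p) * h (iwasawa p) \<partial>lborel)"
    by (rule nn_integral_density) simp_all
  also have "\<dots> = (\<integral>\<^sup>+p. polar_weight (snd p) * h (iwasawa p) \<partial>(lborel \<Otimes>\<^sub>M lborel))"
    by (simp add: lborel_prod)
  also have "\<dots> = (\<integral>\<^sup>+x. \<integral>\<^sup>+q. polar_weight q * h (iwasawa (x, q)) \<partial>lborel \<partial>lborel)"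
  proof -
    have "(\<lambda>p. polar_weight (snd p) * h (iwasawa p)) \<in> borel_measurable (lborel \<Otimes>\<^sub>M lborel)"
      unfolding lborel_prod by measurable
    from lborel.nn_integral_fst[OF this] show ?thesis by simp
  qed
  also have "\<dots> = (\<integral>\<^sup>+x. \<integral>\<^sup>+q. polar_weight q * h (gmat x (fst (?f q)) (snd (?f q))) \<partial>lborel \<partial>lborel)"
    by (intro nn_integral_cong) (auto simp: polar_weight_def iwasawa_gmat indicator_def)
  also have "\<dots> = (\<integral>\<^sup>+x. \<integral>\<^sup>+q. 2 * h (gmat x (fst q) (snd q)) \<partial>lborel \<partial>lborel)"
  proof (rule nn_integral_cong)
    fix x
    have m: "(\<lambda>q. h (gmat x (fst (?f q)) (snd (?f q)))) \<in> borel_measurable lborel"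
      using measurable_compose[OF f H] by simp
    have "(\<integral>\<^sup>+q. polar_weight q * h (gmat x (fst (?f q)) (snd (?f q))) \<partial>lborel) =
        (\<integral>\<^sup>+q. h (gmat x (fst (?f q)) (snd (?f q))) \<partial>(density lborel polar_weight))"
      by (rule nn_integral_density[OF _ m, symmetric]) simp
    also have "\<dots> = (\<integral>\<^sup>+q. h (gmat x (fst q) (snd q)) \<partial>(distr (density lborel polar_weight) borel ?f))"
      by (rule nn_integral_distr[symmetric]) simp_all
    also have "\<dots> = (\<integral>\<^sup>+q. 2 * h (gmat x (fst q) (snd q)) \<partial>lborel)"
      unfolding polar_distr by (subst nn_integral_density) simp_all
    finally show "(\<integral>\<^sup>+q. polar_weight q * h (gmat x (fst (?f q)) (snd (?f q))) \<partial>lborel) = (\<integral>\<^sup>+q. 2 * h (gmat x (fst q) (snd q)) \<partial>lborel)" .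
  qed
  also have "\<dots> = (\<integral>\<^sup>+x. 2 * (\<integral>\<^sup>+C. \<integral>\<^sup>+D. h (gmat x C D) \<partial>lborel \<partial>lborel) \<partial>lborel)"
  proof (rule nn_integral_cong)
    fix x
    have "(\<lambda>q. h (gmat x (fst q) (snd q))) \<in> borel_measurable (lborel \<Otimes>\<^sub>M lborel)" by measurable
    from lborel.nn_integral_fst[OF this]
    have "(\<integral>\<^sup>+q. h (gmat x (fst q) (snd q)) \<partial>lborel) = (\<integral>\<^sup>+C. \<integral>\<^sup>+D. h (gmat x C D) \<partial>lborel \<partial>lborel)"
      by (simp add: lborel_prod)
    then show "(\<integral>\<^sup>+q. 2 * h (gmat x (fst q) (snd q)) \<partial>lborel) = 2 * (\<integral>\<^sup>+C. \<integral>\<^sup>+D. h (gmat x C D) \<partial>lborel \<partial>lborel)"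
      by (simp add: nn_integral_cmult)
  qed
  also have "\<dots> = 2 * (\<integral>\<^sup>+x. \<integral>\<^sup>+C. \<integral>\<^sup>+D. h (gmat x C D) \<partial>lborel \<partial>lborel \<partial>lborel)"
    by (rule nn_integral_cmult) measurable
  also have "(\<integral>\<^sup>+x. \<integral>\<^sup>+C. \<integral>\<^sup>+D. h (gmat x C D) \<partial>lborel \<partial>lborel \<partial>lborel) =
      (\<integral>\<^sup>+C. \<integral>\<^sup>+D. \<integral>\<^sup>+x. h (gmat x C D) \<partial>lborel \<partial>lborel \<partial>lborel)"
    by (rule nn_integral_rotate) measurable
  also have "\<dots> = (\<integral>\<^sup>+C. \<integral>\<^sup>+D. \<integral>\<^sup>+A. ennreal (1 / \<bar>C\<bar>) * h (hmat A C D) \<partial>lborel \<partial>lborel \<partial>lborel)"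
  proof (rule nn_integral_cong_AE)
    have "AE C in lborel. C \<notin> {0::real}" by (rule AE_lborel_notin) simp
    then show "AE C in lborel. (\<integral>\<^sup>+D. \<integral>\<^sup>+x. h (gmat x C D) \<partial>lborel \<partial>lborel) = (\<integral>\<^sup>+D. \<integral>\<^sup>+A. ennreal (1 / \<bar>C\<bar>) * h (hmat A C D) \<partial>lborel \<partial>lborel)"
    proof eventually_elim
      case (elim C)
      then have C: "C \<noteq> 0" by simp
      show ?case
      proof (rule nn_integral_cong)
        fix D
        have "(\<integral>\<^sup>+A. ennreal (1 / \<bar>C\<bar>) * h (hmat A C D) \<partial>lborel) =
            \<bar>C\<bar> * (\<integral>\<^sup>+x. ennreal (1 / \<bar>C\<bar>) * h (gmat x C D) \<partial>lborel)"
          unfolding gmat_hmat[OF C] by (rule nn_integral_real_affine[OF _ C]) measurable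
        also have "\<dots> = (\<integral>\<^sup>+x. ennreal (\<bar>C\<bar> * (1 / \<bar>C\<bar>)) * h (gmat x C D) \<partial>lborel)"
          by (rule nn_integral_cmult_ennreal[OF _ abs_ge_zero]) measurable
        finally show "(\<integral>\<^sup>+x. h (gmat x C D) \<partial>lborel) = (\<integral>\<^sup>+A. ennreal (1 / \<bar>C\<bar>) * h (hmat A C D) \<partial>lborel)"
          using C by simp
      qed
    qed
  qed
  also have "\<dots> = (\<integral>\<^sup>+A. \<integral>\<^sup>+C. \<integral>\<^sup>+D. ennreal (1 / \<bar>C\<bar>) * h (hmat A C D) \<partial>lborel \<partial>lborel \<partial>lborel)"
    by (rule nn_integral_rotate[symmetric]) measurable
  also have "\<dots> = (\<integral>\<^sup>+g. h g \<partial>haar')" by (rule nn_integral_haar'[symmetric]) measurable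
  finally show ?thesis .
qed

lemma sets_haar_SL2 [simp]: "sets haar_SL2 = sets borel"
  by (simp add: haar_SL2_def)

lemma emeasure_haar_SL2:
  assumes X: "X \<in> sets borel"
  shows "emeasure haar_SL2 X = 2 * emeasure haar' X"
  using nn_integral_haar_SL2[of "indicator X"] X by simp

section \<open>Recurrence to the cusps\<close>

text \<open>With \<open>cb\<close> this gives the two coordinates of g^(-1) w for g in SL(2,R); as
  polynomials in the entries they are continuous everywhere.\<close>

definition ca :: "real^2^2 \<Rightarrow> real^2 \<Rightarrow> real" where "ca g w = g$2$2 * w$1 - g$1$2 * w$2"
definition cb :: "real^2^2 \<Rightarrow> real^2 \<Rightarrow> real" where "cb g w = g$1$1 * w$2 - g$2$1 * w$1"

lemma coords_invariant:
  assumes "\<gamma> \<in> SL2"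
  shows "ca (\<gamma> ** g) (\<gamma> *v w) = ca g w" "cb (\<gamma> ** g) (\<gamma> *v w) = cb g w"
proof -
  have "ca (\<gamma> ** g) (\<gamma> *v w) = (\<gamma>$1$1 * \<gamma>$2$2 - \<gamma>$1$2 * \<gamma>$2$1) * ca g w"
    "cb (\<gamma> ** g) (\<gamma> *v w) = (\<gamma>$1$1 * \<gamma>$2$2 - \<gamma>$1$2 * \<gamma>$2$1) * cb g w"
    by (simp_all add: ca_def cb_def matrix_mult_component2 matrix_vector_component2 algebra_simps)
  then show "ca (\<gamma> ** g) (\<gamma> *v w) = ca g w" "cb (\<gamma> ** g) (\<gamma> *v w) = cb g w"
    using assms by (simp_all add: SL2_iff)
qed

lemma coords_diag:
  "ca (g ** mat2 l 0 0 (1 / l)) w = ca g w / l" "cb (g ** mat2 l 0 0 (1 / l)) w = l * cb g w"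
  by (simp_all add: ca_def cb_def matrix_mult_component2 algebra_simps diff_divide_distrib)

lemma continuous_coords: "continuous_on UNIV (\<lambda>g. ca g w)" "continuous_on UNIV (\<lambda>g. cb g w)"
  unfolding ca_def cb_def by (intro continuous_intros)+

lemma discrete_set_countable:
  assumes "discrete_set \<Gamma>"
  shows "countable \<Gamma>"
proof -
  obtain e where e: "\<And>g. g \<in> \<Gamma> \<Longrightarrow> e g > 0" "\<And>g h. g \<in> \<Gamma> \<Longrightarrow> h \<in> \<Gamma> \<Longrightarrow> dist h g < e g \<Longrightarrow> h = g"
    using assms unfolding discrete_set_def by metis
  define \<F> where "\<F> = (\<lambda>g. ball g (e g)) ` \<Gamma>"
  obtain \<F>' where \<F>': "\<F>' \<subseteq> \<F>" "countable \<F>'" "\<Union>\<F>' = \<Union>\<F>"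
    by (rule Lindelof[of \<F>]) (auto simp: \<F>_def)
  have "countable (\<Gamma> \<inter> B)" if B: "B \<in> \<F>'" for B
  proof -
    obtain g where g: "g \<in> \<Gamma>" "B = ball g (e g)" using B \<F>'(1) unfolding \<F>_def by blast
    have "h = g" if "h \<in> \<Gamma> \<inter> B" for h using that e(2)[OF g(1), of h] by (simp add: g(2) dist_commute)
    then have "\<Gamma> \<inter> B \<subseteq> {g}" by blast
    then show ?thesis by (rule countable_subset) simp
  qed
  then have "countable (\<Union>B\<in>\<F>'. \<Gamma> \<inter> B)" using \<F>'(2) by (intro countable_UN)
  moreover have "\<Gamma> \<subseteq> (\<Union>B\<in>\<F>'. \<Gamma> \<inter> B)"
  proof
    fix g assume "g \<in> \<Gamma>"
    moreover from this have "g \<in> ball g (e g)" using e(1) by simp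
    ultimately have "g \<in> \<Union>\<F>" unfolding \<F>_def by blast
    then have "g \<in> \<Union>\<F>'" using \<F>'(3) by simp
    then show "g \<in> (\<Union>B\<in>\<F>'. \<Gamma> \<inter> B)" using \<open>g \<in> \<Gamma>\<close> by blast
  qed
  ultimately show ?thesis by (rule countable_subset[rotated])
qed

lemma closed_SL2: "closed SL2"
proof -
  have eq: "SL2 = {g. g$1$1 * g$2$2 - g$1$2 * g$2$1 = 1}" by (auto simp: SL2_iff)
  show ?thesis unfolding eq by (intro closed_Collect_eq continuous_intros)
qed

section \<open>Recurrence of the diagonal flow modulo the lattice\<close>

locale lattice_orbit =
  fixes \<Gamma> :: "(real^2^2) set" and F :: "(real^2^2) set" and W :: "(real^2) set"
  assumes sub: "mat_subgroup \<Gamma>" and count: "countable \<Gamma>"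
    and F: "F \<in> sets borel" "F \<subseteq> SL2" "\<And>g. g \<in> SL2 \<Longrightarrow> \<exists>!\<gamma>. \<gamma> \<in> \<Gamma> \<and> matrix_inv \<gamma> ** g \<in> F"
    and F_finite: "emeasure haar' F < \<infinity>"
    and W: "\<And>\<gamma> w. \<gamma> \<in> \<Gamma> \<Longrightarrow> w \<in> W \<Longrightarrow> \<gamma> *v w \<in> W"
begin

lemma lattice_SL2: "\<gamma> \<in> \<Gamma> \<Longrightarrow> \<gamma> \<in> SL2"
  using sub by (auto simp: mat_subgroup_def)

lemma lattice_inv: "\<gamma> \<in> \<Gamma> \<Longrightarrow> matrix_inv \<gamma> \<in> \<Gamma>"
  using sub by (auto simp: mat_subgroup_def)

text \<open>The total mass of a \<open>\<Gamma>\<close>-invariant set in the quotient is preserved by the right action of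
  the diagonal group, since the translate of a fundamental domain is again one.\<close>

lemma emeasure_translate:
  assumes B: "B \<in> sets borel" "B \<subseteq> SL2" and inv_B: "\<And>\<gamma> g. \<gamma> \<in> \<Gamma> \<Longrightarrow> g \<in> B \<Longrightarrow> \<gamma> ** g \<in> B" and l: "0 < l"
  shows "emeasure haar' {g\<in>F. g ** mat2 l 0 0 (1 / l) \<in> B} = emeasure haar' (F \<inter> B)"
proof -
  let ?a = "mat2 l 0 0 (1 / l)" and ?b = "mat2 (1 / l) 0 0 l"
  have a: "?a \<in> SL2" "?b \<in> SL2" "?a ** ?b = mat 1" "?b ** ?a = mat 1"
    using l by (auto simp: SL2_iff mat2_eq_iff matrix_mult_component2 mat_def)
  define F' where "F' = {g. g ** ?b \<in> F}"
  have F'_sets: "F' \<in> sets borel" unfolding F'_def using F(1) by measurable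
  have inF': "g ** ?a \<in> F' \<longleftrightarrow> g \<in> F" for g
    by (simp add: F'_def a matrix_mul_assoc[symmetric])
  have "{g\<in>F. g ** ?a \<in> B} = {g. g ** ?a \<in> F' \<inter> B}" by (auto simp: inF')
  then have 1: "emeasure haar' {g\<in>F. g ** ?a \<in> B} = emeasure haar' (F' \<inter> B)"
    using emeasure_haar'_right[OF _ l, of "F' \<inter> B"] F'_sets B(1) by simp
  \<comment> \<open>Each of the two fundamental domains is cut into countably many pieces by the
    translates of the other, and \<gamma> carries the piece \<open>H \<gamma>\<close> of F onto the
    piece \<open>G \<gamma>\<close> of F'.\<close>
  define G where "G \<gamma> = {g\<in>F' \<inter> B. matrix_inv \<gamma> ** g \<in> F}" for \<gamma>
  define H where "H \<gamma> = {g\<in>F \<inter> B. \<gamma> ** g \<in> F'}" for \<gamma>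
  have G_sets: "G \<gamma> \<in> sets borel" for \<gamma> unfolding G_def using F'_sets B(1) F(1) by measurable
  have H_sets: "H \<gamma> \<in> sets borel" for \<gamma> unfolding H_def using F'_sets B(1) F(1) by measurable
  have GH: "emeasure haar' (H \<gamma>) = emeasure haar' (G \<gamma>)" if g: "\<gamma> \<in> \<Gamma>" for \<gamma>
  proof -
    have c: "matrix_inv \<gamma> ** (\<gamma> ** x) = x" for x by (rule SL2_inv_cancel(3)[OF lattice_SL2[OF g]])
    have "H \<gamma> = {x. \<gamma> ** x \<in> G \<gamma>}"
      using inv_B[OF g] inv_B[OF lattice_inv[OF g]] by (auto simp: H_def G_def c) (metis c)
    then show ?thesis using emeasure_haar'_left[OF G_sets lattice_SL2[OF g]] by simp
  qed
  have UG: "F' \<inter> B = (\<Union>\<gamma>\<in>\<Gamma>. G \<gamma>)"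
  proof
    show "F' \<inter> B \<subseteq> (\<Union>\<gamma>\<in>\<Gamma>. G \<gamma>)" using F(3) B(2) by (fastforce simp: G_def)
  qed (auto simp: G_def)
  have disjG: "disjoint_family_on G \<Gamma>"
    unfolding disjoint_family_on_def using F(3) B(2) by (fastforce simp: G_def)
  have key: "\<exists>!\<gamma>. \<gamma> \<in> \<Gamma> \<and> \<gamma> ** g \<in> F'" if g: "g \<in> SL2" for g
  proof -
    have eq: "\<gamma> ** g \<in> F' \<longleftrightarrow> \<gamma> ** (g ** ?b) \<in> F" for \<gamma> by (simp add: F'_def matrix_mul_assoc)
    obtain \<gamma> where \<gamma>: "\<gamma> \<in> \<Gamma>" "matrix_inv \<gamma> ** (g ** ?b) \<in> F"
      "\<And>\<delta>. \<delta> \<in> \<Gamma> \<Longrightarrow> matrix_inv \<delta> ** (g ** ?b) \<in> F \<Longrightarrow> \<delta> = \<gamma>"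
      using F(3)[OF SL2_mult[OF g a(2)]] by blast
    show ?thesis
    proof (rule ex1I[of _ "matrix_inv \<gamma>"])
      show "matrix_inv \<gamma> \<in> \<Gamma> \<and> matrix_inv \<gamma> ** g \<in> F'" using \<gamma>(1,2) lattice_inv[OF \<gamma>(1)] eq by blast
      fix \<delta> assume d: "\<delta> \<in> \<Gamma> \<and> \<delta> ** g \<in> F'"
      then have "matrix_inv (matrix_inv \<delta>) ** (g ** ?b) \<in> F" using eq SL2_inv_cancel(5)[OF lattice_SL2] by simp
      then have "matrix_inv \<delta> = \<gamma>" using \<gamma>(3) lattice_inv d by blast
      then show "\<delta> = matrix_inv \<gamma>" using SL2_inv_cancel(5)[OF lattice_SL2] d by metis
    qed
  qed
  have UH: "F \<inter> B = (\<Union>\<gamma>\<in>\<Gamma>. H \<gamma>)"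
  proof
    show "F \<inter> B \<subseteq> (\<Union>\<gamma>\<in>\<Gamma>. H \<gamma>)" using key B(2) by (fastforce simp: H_def)
  qed (auto simp: H_def)
  have disjH: "disjoint_family_on H \<Gamma>"
    unfolding disjoint_family_on_def using key B(2) by (fastforce simp: H_def)
  have "emeasure haar' (F' \<inter> B) = (\<integral>\<^sup>+\<gamma>. emeasure haar' (G \<gamma>) \<partial>count_space \<Gamma>)"
    unfolding UG by (rule emeasure_UN_countable[OF _ count disjG]) (simp add: G_sets)
  also have "\<dots> = (\<integral>\<^sup>+\<gamma>. emeasure haar' (H \<gamma>) \<partial>count_space \<Gamma>)"
    by (intro nn_integral_cong) (simp add: GH)
  also have "\<dots> = emeasure haar' (F \<inter> B)"
    unfolding UH by (rule emeasure_UN_countable[OF _ count disjH, symmetric]) (simp add: H_sets)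
  finally show ?thesis using 1 by simp
qed

text \<open>Poincare recurrence. The sets of points of F that are in B at time n all have the
  measure of F \<inter> B, yet no point lies in infinitely many of them. Continuity from above,
  available since F has finite measure, makes F \<inter> B null, and countably many translates of it
  cover B.\<close>

lemma null_if_transient:
  assumes B: "B \<in> sets borel" "B \<subseteq> SL2" and inv_B: "\<And>\<gamma> g. \<gamma> \<in> \<Gamma> \<Longrightarrow> g \<in> B \<Longrightarrow> \<gamma> ** g \<in> B"
    and l: "\<And>n :: nat. 0 < l n"
    and trans: "\<And>g. g \<in> SL2 \<Longrightarrow> \<exists>N. \<forall>n\<ge>N. g ** mat2 (l n) 0 0 (1 / l n) \<notin> B"
  shows "B \<in> null_sets haar'"
proof -
  define Fn where "Fn n = {g\<in>F. g ** mat2 (l n) 0 0 (1 / l n) \<in> B}" for n :: nat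
  have Fn: "Fn n \<in> sets borel" for n unfolding Fn_def using F(1) B(1) by measurable
  have em: "emeasure haar' (Fn n) = emeasure haar' (F \<inter> B)" for n
    unfolding Fn_def by (rule emeasure_translate[OF B inv_B l])
  define U where "U N = (\<Union>n\<in>{N..}. Fn n)" for N
  have U: "U N \<in> sets haar'" for N unfolding U_def using Fn by auto
  have "(\<lambda>N. emeasure haar' (U N)) \<longlonglongrightarrow> emeasure haar' (\<Inter>N. U N)"
  proof (rule Lim_emeasure_decseq)
    show "decseq U" by (rule decseq_SucI) (force simp: U_def)
    have "emeasure haar' (U N) \<le> emeasure haar' F" for N
      using F(1) by (intro emeasure_mono) (auto simp: U_def Fn_def)
    then show "emeasure haar' (U N) \<noteq> \<infinity>" for N using F_finite by (metis infinity_ennreal_def not_less top_greatest)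
  qed (use U in auto)
  moreover have "(\<Inter>N. U N) = {}"
  proof (rule ccontr)
    assume "(\<Inter>N. U N) \<noteq> {}"
    then obtain g where g: "\<And>N. g \<in> U N" by blast
    then have "g \<in> SL2" using F(2) by (force simp: U_def Fn_def)
    then obtain N where "\<forall>n\<ge>N. g ** mat2 (l n) 0 0 (1 / l n) \<notin> B" using trans by blast
    then show False using g[of N] by (auto simp: U_def Fn_def)
  qed
  ultimately have lim: "(\<lambda>N. emeasure haar' (U N)) \<longlonglongrightarrow> 0" by simp
  have "emeasure haar' (F \<inter> B) \<le> emeasure haar' (U N)" for N
    unfolding em[of N, symmetric] using U by (intro emeasure_mono) (auto simp: U_def)
  then have "emeasure haar' (F \<inter> B) \<le> 0" by (intro LIMSEQ_le_const[OF lim]) auto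
  then have FB: "emeasure haar' (F \<inter> B) = 0" by simp
  have "(\<Union>\<gamma>\<in>\<Gamma>. {g. matrix_inv \<gamma> ** g \<in> F \<inter> B}) \<in> null_sets haar'" (is "?N \<in> _")
  proof (rule null_sets_UN'[OF count])
    fix \<gamma> assume g: "\<gamma> \<in> \<Gamma>"
    have "F \<inter> B \<in> sets borel" using F(1) B(1) by auto
    from emeasure_haar'_left[OF this lattice_SL2[OF lattice_inv[OF g]]]
    have "emeasure haar' {g. matrix_inv \<gamma> ** g \<in> F \<inter> B} = 0" unfolding FB .
    moreover have "{g. matrix_inv \<gamma> ** g \<in> F \<inter> B} \<in> sets borel" using F(1) B(1) by measurable
    ultimately show "{g. matrix_inv \<gamma> ** g \<in> F \<inter> B} \<in> null_sets haar'" by (simp add: null_sets_def)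
  qed
  moreover have "B \<in> sets haar'" using B(1) by simp
  moreover have "B \<subseteq> (\<Union>\<gamma>\<in>\<Gamma>. {g. matrix_inv \<gamma> ** g \<in> F \<inter> B})"
  proof
    fix g assume g: "g \<in> B"
    then obtain \<gamma> where "\<gamma> \<in> \<Gamma>" "matrix_inv \<gamma> ** g \<in> F" using F(3) B(2) by blast
    then show "g \<in> (\<Union>\<gamma>\<in>\<Gamma>. {g. matrix_inv \<gamma> ** g \<in> F \<inter> B})" using inv_B[OF lattice_inv g] by blast
  qed
  ultimately show ?thesis by (rule null_sets_subset)
qed

text \<open>Points of the cuspidal region \<open>\<bar>a\<bar>, \<bar>b\<bar> < \<epsilon>\<close> whose forward orbit under the diagonal flow
  eventually avoids that region.\<close>

definition escaping :: "real \<Rightarrow> (real^2^2) set" where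
  "escaping \<epsilon> = {g\<in>SL2. (\<exists>w\<in>W. \<bar>ca g w\<bar> < \<epsilon> \<and> \<bar>cb g w\<bar> < \<epsilon>) \<and>
     (\<exists>\<mu>>0. \<forall>w\<in>W. \<mu> \<le> \<bar>cb g w\<bar> \<or> \<epsilon>\<^sup>2 \<le> \<bar>ca g w\<bar> * \<bar>cb g w\<bar>)}"

lemma escaping_sets: "escaping \<epsilon> \<in> sets borel"
proof -
  have "open (\<Union>w\<in>W. {g. \<bar>ca g w\<bar> < \<epsilon>} \<inter> {g. \<bar>cb g w\<bar> < \<epsilon>})"
    by (intro open_UN ballI open_Int open_Collect_less continuous_intros continuous_coords)
  moreover have "closed (\<Inter>w\<in>W. {g. 1 / real (Suc n) \<le> \<bar>cb g w\<bar>} \<union> {g. \<epsilon>\<^sup>2 \<le> \<bar>ca g w\<bar> * \<bar>cb g w\<bar>})" for n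
    by (intro closed_INT ballI closed_Un closed_Collect_le continuous_intros continuous_coords)
  moreover have "escaping \<epsilon> = SL2 \<inter> (\<Union>w\<in>W. {g. \<bar>ca g w\<bar> < \<epsilon>} \<inter> {g. \<bar>cb g w\<bar> < \<epsilon>}) \<inter>
      (\<Union>n. \<Inter>w\<in>W. {g. 1 / real (Suc n) \<le> \<bar>cb g w\<bar>} \<union> {g. \<epsilon>\<^sup>2 \<le> \<bar>ca g w\<bar> * \<bar>cb g w\<bar>})"
  proof -
    have iff: "(\<exists>\<mu>>0. \<forall>w\<in>W. \<mu> \<le> \<bar>cb g w\<bar> \<or> Q w) \<longleftrightarrow> (\<exists>n. \<forall>w\<in>W. 1 / real (Suc n) \<le> \<bar>cb g w\<bar> \<or> Q w)" for g Q
    proof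
      assume "\<exists>\<mu>>0. \<forall>w\<in>W. \<mu> \<le> \<bar>cb g w\<bar> \<or> Q w"
      then obtain \<mu> where \<mu>: "\<mu> > 0" "\<forall>w\<in>W. \<mu> \<le> \<bar>cb g w\<bar> \<or> Q w" by blast
      obtain n where "1 / real (Suc n) < \<mu>" using nat_approx_posE[OF \<mu>(1)] by blast
      then show "\<exists>n. \<forall>w\<in>W. 1 / real (Suc n) \<le> \<bar>cb g w\<bar> \<or> Q w" using \<mu>(2) by (meson less_imp_le order_trans)
    next
      assume "\<exists>n. \<forall>w\<in>W. 1 / real (Suc n) \<le> \<bar>cb g w\<bar> \<or> Q w"
      then obtain n where "\<forall>w\<in>W. 1 / real (Suc n) \<le> \<bar>cb g w\<bar> \<or> Q w" by blast
      then show "\<exists>\<mu>>0. \<forall>w\<in>W. \<mu> \<le> \<bar>cb g w\<bar> \<or> Q w" by (intro exI[of _ "1 / real (Suc n)"]) auto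
    qed
    show ?thesis
    proof (rule set_eqI)
      fix g
      show "g \<in> escaping \<epsilon> \<longleftrightarrow> g \<in> SL2 \<inter> (\<Union>w\<in>W. {g. \<bar>ca g w\<bar> < \<epsilon>} \<inter> {g. \<bar>cb g w\<bar> < \<epsilon>}) \<inter>
          (\<Union>n. \<Inter>w\<in>W. {g. 1 / real (Suc n) \<le> \<bar>cb g w\<bar>} \<union> {g. \<epsilon>\<^sup>2 \<le> \<bar>ca g w\<bar> * \<bar>cb g w\<bar>})"
        using iff[of g "\<lambda>w. \<epsilon>\<^sup>2 \<le> \<bar>ca g w\<bar> * \<bar>cb g w\<bar>"] by (simp add: escaping_def conj_assoc)
    qed
  qed
  ultimately show ?thesis using closed_SL2 by (auto intro!: sets.Int sets.countable_UN borel_open borel_closed)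
qed

text \<open>The flow divides \<open>ca\<close> and multiplies \<open>cb\<close> by the same factor,
  so their product is invariant. Once 2^n \<mu> exceeds \<epsilon>, a vector in the cuspidal region
  would need product at least \<epsilon>^2 although both coordinates are below \<epsilon>. A point
  that admits no \<mu> has no translate that admits one, so its orbit avoids the set
  altogether.\<close>

lemma escaping_null:
  shows "escaping \<epsilon> \<in> null_sets haar'"
proof (rule null_if_transient[OF escaping_sets, where l="\<lambda>n. 2 ^ n"])
  show "escaping \<epsilon> \<subseteq> SL2" by (auto simp: escaping_def)
  fix \<gamma> g assume \<gamma>: "\<gamma> \<in> \<Gamma>" and g: "g \<in> escaping \<epsilon>"
  have co: "ca (\<gamma> ** g) w = ca g (matrix_inv \<gamma> *v w)" "cb (\<gamma> ** g) w = cb g (matrix_inv \<gamma> *v w)" for w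
    using coords_invariant[OF lattice_SL2[OF \<gamma>], of g "matrix_inv \<gamma> *v w"] SL2_inv_cancel(2)[OF lattice_SL2[OF \<gamma>]]
    by (simp_all add: matrix_vector_mul_assoc)
  obtain w where w: "w \<in> W" "\<bar>ca g w\<bar> < \<epsilon>" "\<bar>cb g w\<bar> < \<epsilon>" using g by (auto simp: escaping_def)
  have "\<gamma> *v w \<in> W" "\<bar>ca (\<gamma> ** g) (\<gamma> *v w)\<bar> < \<epsilon> \<and> \<bar>cb (\<gamma> ** g) (\<gamma> *v w)\<bar> < \<epsilon>"
    using w W[OF \<gamma>] coords_invariant[OF lattice_SL2[OF \<gamma>]] by auto
  moreover obtain \<mu> where "\<mu> > 0" "\<forall>w\<in>W. \<mu> \<le> \<bar>cb g w\<bar> \<or> \<epsilon>\<^sup>2 \<le> \<bar>ca g w\<bar> * \<bar>cb g w\<bar>"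
    using g by (auto simp: escaping_def)
  then have "\<mu> > 0 \<and> (\<forall>w\<in>W. \<mu> \<le> \<bar>cb (\<gamma> ** g) w\<bar> \<or> \<epsilon>\<^sup>2 \<le> \<bar>ca (\<gamma> ** g) w\<bar> * \<bar>cb (\<gamma> ** g) w\<bar>)"
    unfolding co using W[OF lattice_inv[OF \<gamma>]] by blast
  moreover have "\<gamma> ** g \<in> SL2" using g lattice_SL2[OF \<gamma>] by (intro SL2_mult) (auto simp: escaping_def)
  ultimately show "\<gamma> ** g \<in> escaping \<epsilon>" unfolding escaping_def by blast
next
  fix g :: "real^2^2" assume g: "g \<in> SL2"
  show "\<exists>N. \<forall>n\<ge>N. g ** mat2 (2 ^ n) 0 0 (1 / 2 ^ n) \<notin> escaping \<epsilon>"
  proof (cases "\<exists>\<mu>>0. \<forall>w\<in>W. \<mu> \<le> \<bar>cb g w\<bar> \<or> \<epsilon>\<^sup>2 \<le> \<bar>ca g w\<bar> * \<bar>cb g w\<bar>")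
    case True
    then obtain \<mu> where \<mu>: "\<mu> > 0" "\<And>w. w \<in> W \<Longrightarrow> \<mu> \<le> \<bar>cb g w\<bar> \<or> \<epsilon>\<^sup>2 \<le> \<bar>ca g w\<bar> * \<bar>cb g w\<bar>" by blast
    obtain N where N: "\<epsilon> / \<mu> < 2 ^ N" using real_arch_pow[of 2 "\<epsilon> / \<mu>"] by auto
    have "g ** mat2 (2 ^ n) 0 0 (1 / 2 ^ n) \<notin> escaping \<epsilon>" if n: "n \<ge> N" for n
    proof
      assume "g ** mat2 (2 ^ n) 0 0 (1 / 2 ^ n) \<in> escaping \<epsilon>"
      then obtain w where w: "w \<in> W" "\<bar>ca g w / 2 ^ n\<bar> < \<epsilon>" "\<bar>2 ^ n * cb g w\<bar> < \<epsilon>"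
        by (auto simp: escaping_def coords_diag)
      have "(2::real) ^ N \<le> 2 ^ n" using n by (rule power_increasing) simp
      then have "2 ^ N * \<mu> \<le> 2 ^ n * \<mu>" using \<mu>(1) by (intro mult_right_mono) auto
      moreover have "\<epsilon> < 2 ^ N * \<mu>" using N \<mu>(1) by (simp add: pos_divide_less_eq)
      ultimately have "\<epsilon> < 2 ^ n * \<mu>" by linarith
      moreover have b: "2 ^ n * \<bar>cb g w\<bar> < \<epsilon>" using w(3) by (simp add: abs_mult)
      ultimately have "2 ^ n * \<bar>cb g w\<bar> < 2 ^ n * \<mu>" by linarith
      then have "\<bar>cb g w\<bar> < \<mu>" by simp
      then have "\<epsilon>\<^sup>2 \<le> \<bar>ca g w\<bar> * \<bar>cb g w\<bar>" using \<mu>(2)[OF w(1)] by auto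
      also have "\<dots> = (\<bar>ca g w\<bar> / 2 ^ n) * (2 ^ n * \<bar>cb g w\<bar>)" by simp
      also have "\<dots> < \<epsilon> * \<epsilon>" using w(2) b by (intro mult_strict_mono) (auto intro: le_less_trans[rotated])
      finally show False by (simp add: power2_eq_square)
    qed
    then show ?thesis by blast
  next
    case False
    have "g ** mat2 (2 ^ n) 0 0 (1 / 2 ^ n) \<notin> escaping \<epsilon>" for n
    proof
      assume "g ** mat2 (2 ^ n) 0 0 (1 / 2 ^ n) \<in> escaping \<epsilon>"
      then have "\<exists>\<mu>>0. \<forall>w\<in>W. \<mu> \<le> \<bar>2 ^ n * cb g w\<bar> \<or> \<epsilon>\<^sup>2 \<le> \<bar>ca g w / 2 ^ n\<bar> * \<bar>2 ^ n * cb g w\<bar>"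
        unfolding escaping_def mem_Collect_eq coords_diag by (elim conjE)
      then obtain \<mu> where \<mu>: "\<mu> > 0" "\<And>w. w \<in> W \<Longrightarrow> \<mu> \<le> \<bar>2 ^ n * cb g w\<bar> \<or> \<epsilon>\<^sup>2 \<le> \<bar>ca g w / 2 ^ n\<bar> * \<bar>2 ^ n * cb g w\<bar>"
        by blast
      have "\<mu> / 2 ^ n \<le> \<bar>cb g w\<bar> \<or> \<epsilon>\<^sup>2 \<le> \<bar>ca g w\<bar> * \<bar>cb g w\<bar>" if "w \<in> W" for w
        using \<mu>(2)[OF that] by (auto simp: abs_mult abs_divide pos_divide_le_eq mult.commute)
      moreover have "0 < \<mu> / 2 ^ n" using \<mu>(1) by simp
      ultimately show False using False by blast
    qed
    then show ?thesis by blast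
  qed
qed simp

end

section \<open>From null sets of matrices to null sets of directions\<close>

lemma null_sets_haar'_iff:
  assumes N [measurable]: "N \<in> sets borel"
  shows "N \<in> null_sets haar' \<longleftrightarrow> (AE A in lborel. AE C in lborel. AE D in lborel. C \<noteq> 0 \<longrightarrow> hmat A C D \<notin> N)"
proof -
  let ?f = "\<lambda>A C D. ennreal (1 / \<bar>C\<bar>) * indicator N (hmat A C D) :: ennreal"
  have zero: "?f A C D = 0 \<longleftrightarrow> (C \<noteq> 0 \<longrightarrow> hmat A C D \<notin> N)" for A C D
    by (auto simp: indicator_def ennreal_eq_0_iff divide_le_0_iff)
  have "N \<in> null_sets haar' \<longleftrightarrow> (\<integral>\<^sup>+g. indicator N g \<partial>haar') = 0" by (simp add: null_sets_def)
  also have "(\<integral>\<^sup>+g. indicator N g \<partial>haar') = (\<integral>\<^sup>+A. \<integral>\<^sup>+C. \<integral>\<^sup>+D. ?f A C D \<partial>lborel \<partial>lborel \<partial>lborel)"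
    by (rule nn_integral_haar') measurable
  also have "\<dots> = 0 \<longleftrightarrow> (AE A in lborel. (\<integral>\<^sup>+C. \<integral>\<^sup>+D. ?f A C D \<partial>lborel \<partial>lborel) = 0)"
    by (rule nn_integral_0_iff_AE) measurable
  also have "\<dots> \<longleftrightarrow> (AE A in lborel. AE C in lborel. AE D in lborel. ?f A C D = 0)"
  proof -
    have "(\<integral>\<^sup>+C. \<integral>\<^sup>+D. ?f A C D \<partial>lborel \<partial>lborel) = 0 \<longleftrightarrow> (AE C in lborel. (\<integral>\<^sup>+D. ?f A C D \<partial>lborel) = 0)" for A
      by (rule nn_integral_0_iff_AE) measurable
    moreover have "(\<integral>\<^sup>+D. ?f A C D \<partial>lborel) = 0 \<longleftrightarrow> (AE D in lborel. ?f A C D = 0)" for A C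
      by (rule nn_integral_0_iff_AE) measurable
    ultimately show ?thesis by (simp only:)
  qed
  finally show ?thesis unfolding zero .
qed

lemma AE_lborel_scale:
  fixes c :: real
  assumes c: "c \<noteq> 0" and P: "{x. P x} \<in> sets borel" and AE: "AE x in lborel. P x"
  shows "AE x in lborel. P (c * x)"
proof -
  have N [measurable]: "{x. \<not> P x} \<in> sets borel" using P by (simp add: Collect_neg_eq)
  have N': "{x. \<not> P (c * x)} \<in> sets borel"
  proof -
    have "(\<lambda>x. c * x) -` {x. \<not> P x} \<inter> space borel \<in> sets borel" by (rule measurable_sets[OF _ N]) measurable
    then show ?thesis by (simp add: vimage_def)
  qed
  have "{x. \<not> P x} \<in> null_sets lborel" using AE AE_iff_null_sets[of "{x. \<not> P x}" lborel] N by simp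
  then have "(\<integral>\<^sup>+x. indicator {x. \<not> P x} x \<partial>lborel) = 0" by (simp add: null_sets_def)
  then have "\<bar>c\<bar> * (\<integral>\<^sup>+x. indicator {x. \<not> P x} (0 + c * x) \<partial>lborel) = 0"
    by (subst (asm) nn_integral_real_affine[OF _ c, of _ 0]) measurable
  then have "(\<integral>\<^sup>+x. indicator {x. \<not> P x} (c * x) \<partial>lborel) = 0" using c by simp
  moreover have "(\<integral>\<^sup>+x. indicator {x. \<not> P x} (c * x) \<partial>lborel) = emeasure lborel {x. \<not> P (c * x)}"
  proof -
    have "(\<integral>\<^sup>+x. indicator {x. \<not> P x} (c * x) \<partial>lborel) = (\<integral>\<^sup>+x. indicator {x. \<not> P (c * x)} x \<partial>lborel)"
      by (intro nn_integral_cong) (simp add: indicator_def)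
    also have "\<dots> = emeasure lborel {x. \<not> P (c * x)}" using N' by (intro nn_integral_indicator) simp
    finally show ?thesis .
  qed
  ultimately have "{x. \<not> P (c * x)} \<in> null_sets lborel" using N' by (simp add: null_sets_def)
  then show ?thesis by (rule AE_I') auto
qed

lemma AE_lborel_interval:
  fixes a b :: real
  assumes "AE x in lborel. P x" "a < b"
  obtains x where "a < x" "x < b" "P x"
proof -
  have "\<exists>x. a < x \<and> x < b \<and> P x"
  proof (rule ccontr)
    assume "\<not> ?thesis"
    then have "AE x in lborel. x \<notin> {a<..<b}" using assms(1) by (auto elim: eventually_mono)
    then have "emeasure lborel {a<..<b} = 0" by (subst (asm) AE_iff_null_sets[symmetric]) (auto simp: null_sets_def)
    then show False using assms(2) by simp
  qed
  then show ?thesis using that by blast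
qed

lemma ca_eq:
  assumes "g \<in> SL2" "g$1$1 \<noteq> 0"
  shows "g$1$1 * ca g w = w$1 - g$1$2 * cb g w"
proof -
  have "g$1$1 * ca g w - (w$1 - g$1$2 * cb g w) = (g$1$1 * g$2$2 - g$1$2 * g$2$1 - 1) * w$1"
    by (simp add: ca_def cb_def algebra_simps)
  then show ?thesis using assms(1) by (simp add: SL2_iff)
qed

context lattice_orbit
begin

text \<open>The condition of exponent one with the constant \<nu> kept fixed, since the recurrence
  argument works for one constant at a time; the union over positive \<nu> is the set given by
  \<open>dir_dioph W 1\<close>.\<close>

definition bad_dir :: "real \<Rightarrow> real set" where
  "bad_dir \<nu> = {\<xi>. \<exists>\<mu>>0. \<forall>w\<in>W. \<mu> \<le> \<bar>w$2 - \<xi> * w$1\<bar> \<or> \<nu> \<le> \<bar>w$1\<bar> * \<bar>w$2 - \<xi> * w$1\<bar>}"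

lemma bad_dir_sets [measurable]: "bad_dir \<nu> \<in> sets borel"
proof -
  have "closed (\<Inter>w\<in>W. {\<xi>. 1 / real (Suc n) \<le> \<bar>w$2 - \<xi> * w$1\<bar>} \<union> {\<xi>. \<nu> \<le> \<bar>w$1\<bar> * \<bar>w$2 - \<xi> * w$1\<bar>})" for n
    by (intro closed_INT ballI closed_Un closed_Collect_le continuous_intros)
  moreover have "bad_dir \<nu> = (\<Union>n. \<Inter>w\<in>W. {\<xi>. 1 / real (Suc n) \<le> \<bar>w$2 - \<xi> * w$1\<bar>} \<union> {\<xi>. \<nu> \<le> \<bar>w$1\<bar> * \<bar>w$2 - \<xi> * w$1\<bar>})"
    (is "_ = ?R")
  proof (intro equalityI subsetI)
    fix \<xi> assume "\<xi> \<in> bad_dir \<nu>"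
    then obtain \<mu> where \<mu>: "\<mu> > 0" "\<forall>w\<in>W. \<mu> \<le> \<bar>w$2 - \<xi> * w$1\<bar> \<or> \<nu> \<le> \<bar>w$1\<bar> * \<bar>w$2 - \<xi> * w$1\<bar>"
      by (auto simp: bad_dir_def)
    obtain n where "1 / real (Suc n) < \<mu>" using nat_approx_posE[OF \<mu>(1)] by blast
    then have "\<forall>w\<in>W. 1 / real (Suc n) \<le> \<bar>w$2 - \<xi> * w$1\<bar> \<or> \<nu> \<le> \<bar>w$1\<bar> * \<bar>w$2 - \<xi> * w$1\<bar>"
      using \<mu>(2) by (meson less_imp_le order_trans)
    then show "\<xi> \<in> ?R" by blast
  next
    fix \<xi> assume "\<xi> \<in> ?R"
    then obtain n where "\<forall>w\<in>W. 1 / real (Suc n) \<le> \<bar>w$2 - \<xi> * w$1\<bar> \<or> \<nu> \<le> \<bar>w$1\<bar> * \<bar>w$2 - \<xi> * w$1\<bar>" by blast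
    then show "\<xi> \<in> bad_dir \<nu>" unfolding bad_dir_def mem_Collect_eq by (intro exI[of _ "1 / real (Suc n)"]) auto
  qed
  ultimately show ?thesis by (auto intro!: sets.countable_UN borel_closed)
qed

text \<open>By \<open>ca_eq\<close>, w1 and A ca differ by a multiple of cb. Hence |w1| |w2 - \<xi>
  w1| exceeds |ca| |cb| by at most \<epsilon>^2 once |cb| is small; this loss is the reason for the
  factor 2 in the constant for directions.\<close>

lemma bad_dir_escaping:
  assumes \<epsilon>: "0 < \<epsilon>" and AC: "A \<noteq> 0" "C \<noteq> 0" and \<xi>: "C / A \<in> bad_dir (2 * \<epsilon>\<^sup>2)"
    and w: "w \<in> W" "\<bar>ca (hmat A C D) w\<bar> < \<epsilon>" "\<bar>cb (hmat A C D) w\<bar> < \<epsilon>"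
  shows "hmat A C D \<in> escaping \<epsilon>"
proof -
  define g where "g = hmat A C D"
  define q where "q = g$1$2"
  have g: "g \<in> SL2" "g$1$1 = A" using AC hmat_SL2 by (auto simp: g_def hmat_def)
  obtain \<mu> where \<mu>: "\<mu> > 0" "\<And>w. w \<in> W \<Longrightarrow> \<mu> \<le> \<bar>w$2 - C / A * w$1\<bar> \<or> 2 * \<epsilon>\<^sup>2 \<le> \<bar>w$1\<bar> * \<bar>w$2 - C / A * w$1\<bar>"
    using \<xi> by (auto simp: bad_dir_def)
  have b: "cb g w = A * (w$2 - C / A * w$1)" for w using AC by (simp add: cb_def g_def hmat_def right_diff_distrib)
  have a: "A * ca g w = w$1 - q * cb g w" for w using ca_eq[of g w] g AC by (simp add: q_def)
  define \<mu>' where "\<mu>' = min (\<mu> * \<bar>A\<bar>) (min 1 (\<epsilon>\<^sup>2 * \<bar>A\<bar> / (\<bar>q\<bar> + 1)))"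
  have \<mu>': "\<mu>' > 0" using \<mu> AC \<epsilon> by (simp add: \<mu>'_def add_nonneg_pos)
  have "\<mu>' \<le> \<bar>cb g w\<bar> \<or> \<epsilon>\<^sup>2 \<le> \<bar>ca g w\<bar> * \<bar>cb g w\<bar>" if w: "w \<in> W" for w
  proof (cases "\<mu>' \<le> \<bar>cb g w\<bar>")
    case False
    then have lt: "\<bar>cb g w\<bar> < \<mu> * \<bar>A\<bar>" "\<bar>cb g w\<bar> < 1" "\<bar>cb g w\<bar> < \<epsilon>\<^sup>2 * \<bar>A\<bar> / (\<bar>q\<bar> + 1)" by (auto simp: \<mu>'_def)
    define \<beta> where "\<beta> = \<bar>w$2 - C / A * w$1\<bar>"
    have bb: "\<bar>cb g w\<bar> = \<bar>A\<bar> * \<beta>" by (simp add: b \<beta>_def abs_mult)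
    have "\<beta> < \<mu>" using lt(1) AC by (simp add: bb mult.commute)
    then have w1: "2 * \<epsilon>\<^sup>2 \<le> \<bar>w$1\<bar> * \<beta>" using \<mu>(2)[OF w] by (auto simp: \<beta>_def)
    have "(\<bar>q\<bar> + 1) * \<bar>cb g w\<bar> < \<epsilon>\<^sup>2 * \<bar>A\<bar>" using lt(3) by (simp add: pos_less_divide_eq mult.commute add_nonneg_pos)
    then have "\<bar>A\<bar> * ((\<bar>q\<bar> + 1) * \<beta>) \<le> \<bar>A\<bar> * \<epsilon>\<^sup>2" by (simp add: bb mult_ac)
    then have q\<beta>: "(\<bar>q\<bar> + 1) * \<beta> \<le> \<epsilon>\<^sup>2" using AC by simp
    have \<beta>0: "0 \<le> \<beta>" by (simp add: \<beta>_def)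
    have "\<bar>w$1\<bar> \<le> \<bar>A * ca g w\<bar> + \<bar>q * cb g w\<bar>" using a[of w] by linarith
    then have "\<bar>w$1\<bar> * \<beta> \<le> (\<bar>A\<bar> * \<bar>ca g w\<bar> + \<bar>q\<bar> * \<bar>cb g w\<bar>) * \<beta>"
      using \<beta>0 by (intro mult_right_mono) (auto simp: abs_mult)
    also have "\<dots> = \<bar>ca g w\<bar> * \<bar>cb g w\<bar> + \<bar>cb g w\<bar> * (\<bar>q\<bar> * \<beta>)" by (simp add: bb algebra_simps)
    also have "\<bar>cb g w\<bar> * (\<bar>q\<bar> * \<beta>) \<le> 1 * \<epsilon>\<^sup>2"
    proof (rule mult_mono)
      show "\<bar>q\<bar> * \<beta> \<le> \<epsilon>\<^sup>2" using q\<beta> \<beta>0 by (simp add: distrib_right)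
    qed (use lt \<beta>0 in auto)
    finally show ?thesis using w1 by simp
  qed simp
  then show ?thesis using g(1) w \<mu>' unfolding escaping_def g_def[symmetric] by blast
qed

text \<open>For given A and C, \<open>cb\<close> of w0 is independent of D while \<open>ca\<close>
  of w0 is affine in D. If C / A is bad and |cb| < \<epsilon>, a whole interval of D therefore gives
  escaping matrices, which a null set permits for almost no (A, C).\<close>

lemma AE_not_bad_dir:
  assumes w0: "w0 \<in> W" "w0 \<noteq> 0" and \<epsilon>: "0 < \<epsilon>"
  shows "AE \<xi> in lborel. \<xi> \<notin> bad_dir (2 * \<epsilon>\<^sup>2)"
proof -
  have AE: "AE A in lborel. AE C in lborel. AE D in lborel. C \<noteq> 0 \<longrightarrow> hmat A C D \<notin> escaping \<epsilon>"
    using escaping_null[of \<epsilon>] null_sets_haar'_iff[OF escaping_sets] by simp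
  let ?P = "\<lambda>A C. C \<noteq> 0 \<longrightarrow> A * w0$2 - C * w0$1 \<noteq> 0 \<longrightarrow> \<bar>A * w0$2 - C * w0$1\<bar> < \<epsilon> \<longrightarrow> C / A \<notin> bad_dir (2 * \<epsilon>\<^sup>2)"
  have P: "?P A C" if AE: "AE D in lborel. C \<noteq> 0 \<longrightarrow> hmat A C D \<notin> escaping \<epsilon>" and A: "A \<noteq> 0" for A C
  proof (intro impI notI)
    assume C: "C \<noteq> 0" and b: "A * w0$2 - C * w0$1 \<noteq> 0" "\<bar>A * w0$2 - C * w0$1\<bar> < \<epsilon>" and bad: "C / A \<in> bad_dir (2 * \<epsilon>\<^sup>2)"
    define e where "e = (A * w0$2 - C * w0$1) / C"
    have e: "e \<noteq> 0" using b C by (simp add: e_def)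
    have ca: "ca (hmat A C D) w0 = w0$2 / C - e * D" for D
      using C by (simp add: ca_def hmat_def e_def field_simps)
    \<comment> \<open>\<open>ca\<close> of w0 vanishes at D0 and stays below \<epsilon> within
      distance \<open>\<eta>\<close>.\<close>
    define D0 where "D0 = w0$2 / C / e"
    define \<eta> where "\<eta> = \<epsilon> / \<bar>e\<bar>"
    have \<eta>: "\<eta> > 0" using \<epsilon> e by (simp add: \<eta>_def)
    obtain D where D: "D0 - \<eta> < D" "D < D0 + \<eta>" "C \<noteq> 0 \<longrightarrow> hmat A C D \<notin> escaping \<epsilon>"
      using AE_lborel_interval[OF AE, of "D0 - \<eta>" "D0 + \<eta>"] \<eta> by auto
    have "\<bar>D0 - D\<bar> < \<eta>" using D by auto
    then have "\<bar>e\<bar> * \<bar>D0 - D\<bar> < \<epsilon>" using e by (simp add: \<eta>_def pos_less_divide_eq mult.commute)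
    moreover have "e * (D0 - D) = ca (hmat A C D) w0" using e by (simp add: ca D0_def right_diff_distrib)
    ultimately have "\<bar>ca (hmat A C D) w0\<bar> < \<epsilon>" by (simp flip: abs_mult)
    moreover have "\<bar>cb (hmat A C D) w0\<bar> < \<epsilon>" using b(2) by (simp add: cb_def hmat_def)
    ultimately have "hmat A C D \<in> escaping \<epsilon>" using bad_dir_escaping[OF \<epsilon> A C bad w0(1)] by blast
    then show False using D(3) C by blast
  qed
  have part: "AE \<xi> in lborel. \<bar>\<xi>\<bar> \<le> real K \<longrightarrow> \<xi> \<notin> bad_dir (2 * \<epsilon>\<^sup>2)" for K
  proof -
    \<comment> \<open>M bounds |w0$2 - \<xi> w0$1| for all |\<xi>| <= K, so that a first entry A
      below \<epsilon> / M keeps \<open>cb\<close> of w0 under \<epsilon> for all these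
      directions.\<close>
    define M where "M = \<bar>w0$2\<bar> + real K * \<bar>w0$1\<bar> + 1"
    have M: "M > 0" by (simp add: M_def add_nonneg_pos)
    then have "0 < \<epsilon> / M" using \<epsilon> by simp
    from AE_lborel_interval[OF AE this]
    obtain A where A: "0 < A" "A < \<epsilon> / M" and AE': "AE C in lborel. AE D in lborel. C \<noteq> 0 \<longrightarrow> hmat A C D \<notin> escaping \<epsilon>"
      by blast
    have "AE C in lborel. ?P A C" using AE' by (rule eventually_mono) (use P A in blast)
    moreover have "{C. ?P A C} \<in> sets borel" by measurable
    ultimately have "AE \<xi> in lborel. ?P A (A * \<xi>)"
      using AE_lborel_scale[of A "?P A"] A by simp
    moreover have "AE \<xi> in lborel. \<xi> \<notin> {0, w0$2 / w0$1}" by (rule AE_lborel_notin) simp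
    ultimately show ?thesis
    proof eventually_elim
      case (elim \<xi>)
      show ?case
      proof
        assume K: "\<bar>\<xi>\<bar> \<le> real K"
        have eq: "A * w0$2 - A * \<xi> * w0$1 = A * (w0$2 - \<xi> * w0$1)" by (simp add: algebra_simps)
        have "w0$2 - \<xi> * w0$1 \<noteq> 0"
        proof (cases "w0$1 = 0")
          case True
          then show ?thesis using w0(2) by (auto simp: vec2_eq_iff)
        next
          case False
          then show ?thesis using elim(2) by (auto simp: eq_divide_eq)
        qed
        then have nz: "A * w0$2 - A * \<xi> * w0$1 \<noteq> 0" using A unfolding eq by simp
        have "\<bar>w0$2 - \<xi> * w0$1\<bar> \<le> \<bar>w0$2\<bar> + \<bar>\<xi>\<bar> * \<bar>w0$1\<bar>" by (metis abs_mult abs_triangle_ineq4)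
        also have "\<dots> \<le> M" using K by (simp add: M_def mult_right_mono add_increasing2)
        finally have "A * \<bar>w0$2 - \<xi> * w0$1\<bar> \<le> A * M" using A by (intro mult_left_mono) auto
        also have "\<dots> < \<epsilon>" using A M by (simp add: pos_less_divide_eq)
        finally have "\<bar>A * w0$2 - A * \<xi> * w0$1\<bar> < \<epsilon>" unfolding eq using A by (simp add: abs_mult)
        then show "\<xi> \<notin> bad_dir (2 * \<epsilon>\<^sup>2)" using elim nz A by simp
      qed
    qed
  qed
  have "AE \<xi> in lborel. \<forall>K::nat. \<bar>\<xi>\<bar> \<le> real K \<longrightarrow> \<xi> \<notin> bad_dir (2 * \<epsilon>\<^sup>2)"
    unfolding AE_all_countable by (intro allI part)
  then show ?thesis by (rule eventually_mono) (meson real_arch_simple)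
qed

lemma AE_not_dir_dioph:
  assumes w0: "w0 \<in> W" "w0 \<noteq> 0"
  shows "AE \<xi> in lborel. \<not> dir_dioph W 1 \<xi>"
proof -
  have "AE \<xi> in lborel. \<forall>n::nat. \<xi> \<notin> bad_dir (2 * (1 / real (Suc n))\<^sup>2)"
    unfolding AE_all_countable by (intro allI AE_not_bad_dir[OF w0]) simp
  then show ?thesis
  proof (rule eventually_mono, intro notI)
    fix \<xi> assume n: "\<forall>n::nat. \<xi> \<notin> bad_dir (2 * (1 / real (Suc n))\<^sup>2)" and d: "dir_dioph W 1 \<xi>"
    obtain \<mu> \<nu> where \<mu>: "\<mu> > 0" "\<nu> > 0" "\<forall>w\<in>W. \<mu> \<le> \<bar>w$2 - \<xi> * w$1\<bar> \<or> \<nu> \<le> \<bar>w$1\<bar> * \<bar>w$2 - \<xi> * w$1\<bar>"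
      using d unfolding dir_dioph_def by auto
    define e where "e = sqrt (\<nu> / 2)"
    have e: "e > 0" "2 * e\<^sup>2 = \<nu>" using \<mu> by (auto simp: e_def)
    obtain n where "1 / real (Suc n) < e" using nat_approx_posE[OF e(1)] by blast
    then have "(1 / real (Suc n))\<^sup>2 \<le> e\<^sup>2" by (intro power_mono) auto
    then have "2 * (1 / real (Suc n))\<^sup>2 \<le> \<nu>" using e(2) by linarith
    then have "\<forall>w\<in>W. \<mu> \<le> \<bar>w$2 - \<xi> * w$1\<bar> \<or> 2 * (1 / real (Suc n))\<^sup>2 \<le> \<bar>w$1\<bar> * \<bar>w$2 - \<xi> * w$1\<bar>"
      using \<mu>(3) by (meson order_trans)
    then have "\<xi> \<in> bad_dir (2 * (1 / real (Suc n))\<^sup>2)" unfolding bad_dir_def using \<mu>(1) by blast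
    then show False using n by blast
  qed
qed

end

text \<open>A single integer replaces both thresholds, which exhibits the condition as a countable
  union of closed ones.\<close>

lemma dioph_for_coords:
  "dioph_for W \<kappa> g \<longleftrightarrow> (\<exists>n. \<forall>w\<in>W. 1 / real (Suc n) \<le> \<bar>cb g w\<bar> \<or> 1 / real (Suc n) \<le> \<bar>ca g w\<bar> powr \<kappa> * \<bar>cb g w\<bar>)"
proof
  assume "dioph_for W \<kappa> g"
  then obtain \<mu> \<nu> where \<mu>: "\<mu> > 0" "\<nu> > 0" "\<forall>w\<in>W. \<mu> \<le> \<bar>cb g w\<bar> \<or> \<nu> \<le> \<bar>ca g w\<bar> powr \<kappa> * \<bar>cb g w\<bar>"
    by (auto simp: dioph_for_def ca_def cb_def)
  then have "0 < min \<mu> \<nu>" by simp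
  from nat_approx_posE[OF this] obtain n where "1 / real (Suc n) < min \<mu> \<nu>" by blast
  then have "1 / real (Suc n) \<le> \<mu>" "1 / real (Suc n) \<le> \<nu>" by auto
  then show "\<exists>n. \<forall>w\<in>W. 1 / real (Suc n) \<le> \<bar>cb g w\<bar> \<or> 1 / real (Suc n) \<le> \<bar>ca g w\<bar> powr \<kappa> * \<bar>cb g w\<bar>"
    using \<mu>(3) by (meson order_trans)
next
  assume "\<exists>n. \<forall>w\<in>W. 1 / real (Suc n) \<le> \<bar>cb g w\<bar> \<or> 1 / real (Suc n) \<le> \<bar>ca g w\<bar> powr \<kappa> * \<bar>cb g w\<bar>"
  then obtain n where n: "\<forall>w\<in>W. 1 / real (Suc n) \<le> \<bar>cb g w\<bar> \<or> 1 / real (Suc n) \<le> \<bar>ca g w\<bar> powr \<kappa> * \<bar>cb g w\<bar>" by blast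
  have "0 < 1 / real (Suc n)" by simp
  then show "dioph_for W \<kappa> g" unfolding dioph_for_def using n unfolding ca_def cb_def by blast
qed

lemma dioph_for_sets:
  assumes \<kappa>: "0 < \<kappa>"
  shows "{g. dioph_for W \<kappa> g} \<in> sets borel"
proof -
  have "closed (\<Inter>w\<in>W. {g. 1 / real (Suc n) \<le> \<bar>cb g w\<bar>} \<union> {g. 1 / real (Suc n) \<le> \<bar>ca g w\<bar> powr \<kappa> * \<bar>cb g w\<bar>})" for n
    using \<kappa> by (intro closed_INT ballI closed_Un closed_Collect_le continuous_intros continuous_coords continuous_on_powr') auto
  moreover have "{g. dioph_for W \<kappa> g} =
      (\<Union>n. \<Inter>w\<in>W. {g. 1 / real (Suc n) \<le> \<bar>cb g w\<bar>} \<union> {g. 1 / real (Suc n) \<le> \<bar>ca g w\<bar> powr \<kappa> * \<bar>cb g w\<bar>})"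
    by (simp add: set_eq_iff dioph_for_coords)
  ultimately show ?thesis by (auto intro!: sets.countable_UN borel_closed)
qed

lemma (in lattice_orbit) dioph_for_null:
  assumes w0: "w0 \<in> W" "w0 \<noteq> 0"
  shows "{g\<in>SL2. dioph_for W 1 g} \<in> null_sets haar'"
proof -
  have sets: "{g\<in>SL2. dioph_for W 1 g} \<in> sets borel"
  proof -
    have "SL2 \<inter> {g. dioph_for W 1 g} \<in> sets borel" using dioph_for_sets[of 1] closed_SL2 by auto
    then show ?thesis by (simp add: Int_def)
  qed
  have dir: "{\<xi>. \<not> dir_dioph W 1 \<xi>} \<in> sets borel"
  proof -
    have "dir_dioph W 1 \<xi> \<longleftrightarrow> dioph_for W 1 (chart (1, \<xi>, 0))" for \<xi>
      using dioph_for_iff_dir[OF chart_SL2[of 1 \<xi> 0], of 1 W] by (simp add: chart_def)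
    moreover have "(\<lambda>\<xi>. chart (1, \<xi>, 0)) \<in> borel_measurable borel" unfolding chart_def by measurable
    then have "(\<lambda>\<xi>. chart (1, \<xi>, 0)) -` {g. dioph_for W 1 g} \<inter> space borel \<in> sets borel"
      by (rule measurable_sets) (simp add: dioph_for_sets)
    ultimately have "{\<xi>. dir_dioph W 1 \<xi>} \<in> sets borel" by (simp add: vimage_def)
    then show ?thesis by (simp add: Collect_neg_eq)
  qed
  have "AE A in lborel. A \<notin> {0::real}" by (rule AE_lborel_notin) simp
  then have "AE A in lborel. AE C in lborel. AE D in lborel. C \<noteq> 0 \<longrightarrow> hmat A C D \<notin> {g\<in>SL2. dioph_for W 1 g}"
  proof (rule eventually_mono)
    fix A :: real assume "A \<notin> {0}"
    then have A: "A \<noteq> 0" by simp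
    have "AE C in lborel. \<not> dir_dioph W 1 (1 / A * C)"
      by (rule AE_lborel_scale[OF _ dir AE_not_dir_dioph[OF w0]]) (use A in simp)
    then show "AE C in lborel. AE D in lborel. C \<noteq> 0 \<longrightarrow> hmat A C D \<notin> {g\<in>SL2. dioph_for W 1 g}"
    proof (rule eventually_mono)
      fix C assume C: "\<not> dir_dioph W 1 (1 / A * C)"
      have "C \<noteq> 0 \<longrightarrow> hmat A C D \<notin> {g\<in>SL2. dioph_for W 1 g}" for D
        using C A dioph_for_iff_dir[of "hmat A C D" 1 W] by (auto simp: hmat_def)
      then show "AE D in lborel. C \<noteq> 0 \<longrightarrow> hmat A C D \<notin> {g\<in>SL2. dioph_for W 1 g}" by simp
    qed
  qed
  then show ?thesis using null_sets_haar'_iff[OF sets] by simp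
qed

section \<open>Dimensions\<close>

text \<open>A direction that is no slope and fails the condition of exponent one lies within 1 /
  (w1)^2 of w2 / w1 for vectors with arbitrarily large w1. These balls form a Vitali cover of almost
  all of the interval, so finitely many disjoint ones fill half of it.\<close>

lemma vitali_packing:
  assumes W: "separated c W" and AE: "AE \<xi> in lborel. \<not> dir_dioph W 1 \<xi>"
    and ab: "a < b" and \<eta>: "0 < \<eta>"
  defines "f \<equiv> \<lambda>w :: real^2. w$2 / w$1" and "r \<equiv> \<lambda>w :: real^2. 1 / (w$1)\<^sup>2"
  shows "\<exists>I. finite I \<and> I \<subseteq> {w\<in>W. 1 \<le> w$1} \<and>
      (\<forall>w\<in>I. r w < \<eta> \<and> cball (f w) (r w) \<subseteq> {a..b}) \<and>
      (\<forall>w\<in>I. \<forall>w'\<in>I. w \<noteq> w' \<longrightarrow> cball (f w) (r w) \<inter> cball (f w') (r w') = {}) \<and>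
      (b - a) / 4 \<le> (\<Sum>w\<in>I. r w)"
proof -
  define S where "S = {x\<in>{a<..<b}. \<not> dir_dioph W 1 x \<and> x \<notin> f ` W}"
  define K where "K = {w\<in>W. 1 \<le> w$1 \<and> r w < \<eta> \<and> cball (f w) (r w) \<subseteq> {a..b}}"
  have rK: "0 < r w" if "w \<in> K" for w using that by (simp add: K_def r_def)
  have cov: "\<exists>w. w \<in> K \<and> x \<in> cball (f w) (r w) \<and> r w < d" if x: "x \<in> S" and d: "0 < d" for x d
  proof -
    \<comment> \<open>A ball that contains x and has radius below m is smaller than d and \<eta> and
      stays inside [a, b].\<close>
    define m where "m = min (min d \<eta>) (min (x - a) (b - x) / 2)"
    have m: "0 < m" using x d \<eta> by (auto simp: m_def S_def)
    define R where "R = max 1 (1 / m + 1)"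
    have nd: "\<not> dir_dioph W 1 x" "x \<notin> (\<lambda>w. w$2 / w$1) ` W" using x by (auto simp: S_def f_def)
    obtain w where w: "w \<in> W" "R \<le> w$1" "\<bar>w$2 - x * w$1\<bar> < 1" "\<bar>w$1\<bar> powr 1 * \<bar>w$2 - x * w$1\<bar> < 1"
      by (rule not_dir_dioph_large[OF W nd zero_less_one, of R])
    have w1: "1 \<le> w$1" "1 / m < w$1" using w(2) by (auto simp: R_def)
    have "1 / m < (w$1)\<^sup>2"
    proof -
      have "w$1 * 1 \<le> w$1 * w$1" using w1 by (intro mult_left_mono) auto
      then show ?thesis using w1(2) by (simp add: power2_eq_square)
    qed
    then have rm: "r w < m" using m w1 by (simp add: r_def field_simps)
    have "\<bar>x - f w\<bar> \<le> r w"
    proof -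
      have "w$1 * (x - f w) = - (w$2 - x * w$1)" using w1 by (simp add: f_def right_diff_distrib)
      then have "w$1 * \<bar>x - f w\<bar> = \<bar>w$2 - x * w$1\<bar>" using w1 by (metis abs_minus_cancel abs_mult abs_of_nonneg order_trans zero_le_one)
      then have "w$1 * (w$1 * \<bar>x - f w\<bar>) < 1" using w(4) w1 by simp
      then have "(w$1)\<^sup>2 * \<bar>x - f w\<bar> < 1" by (simp add: power2_eq_square mult.assoc)
      then show ?thesis using w1 by (simp add: r_def pos_le_divide_eq mult.commute)
    qed
    moreover have "r w < d" "r w < \<eta>" "2 * r w \<le> x - a" "2 * r w \<le> b - x" using rm by (auto simp: m_def)
    ultimately have "w \<in> K \<and> x \<in> cball (f w) (r w) \<and> r w < d"
      using w(1) w1 unfolding K_def cball_eq_atLeastAtMost abs_le_iff by auto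
    then show ?thesis ..
  qed
  obtain C where C: "countable C" "C \<subseteq> K"
    "pairwise (\<lambda>i j. disjnt (cball (f i) (r i)) (cball (f j) (r j))) C"
    "negligible (S - (\<Union>i\<in>C. cball (f i) (r i)))"
    by (rule Vitali_covering_theorem_cballs[of K r S f, OF rK cov])
  let ?U = "\<Union>i\<in>C. cball (f i) (r i)"
  have U: "?U \<in> sets borel" using C(1) by (intro sets.countable_UN') auto
  have "AE x in lborel. x \<notin> f ` W"
    by (intro AE_not_in countable_imp_null_set_lborel countable_image separated_countable[OF W])
  then have "AE x in lebesgue. x \<notin> f ` W" by (rule AE_completion)
  moreover have "AE x in lebesgue. \<not> dir_dioph W 1 x" using AE by (rule AE_completion)
  moreover have "AE x in lebesgue. x \<notin> S - ?U" using C(4) by (intro AE_not_in) (simp add: negligible_iff_null_sets)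
  ultimately have "AE x in lebesgue. x \<in> {a<..<b} \<longrightarrow> x \<in> ?U"
    by eventually_elim (auto simp: S_def)
  then have "emeasure lebesgue {a<..<b} \<le> emeasure lebesgue ?U" using U by (intro emeasure_mono_AE) auto
  then have bU: "ennreal (b - a) \<le> emeasure lborel ?U" using U ab by simp
  have "C \<noteq> {}" using bU ab by auto
  define e where "e = from_nat_into C"
  have e: "range e = C" unfolding e_def by (rule range_from_nat_into[OF \<open>C \<noteq> {}\<close> C(1)])
  define Vn where "Vn n = (\<Union>i\<in>e ` {..<n}. cball (f i) (r i))" for n
  have "(\<Union>n. Vn n) = ?U" unfolding Vn_def e[symmetric] by blast
  moreover have "(SUP n. emeasure lborel (Vn n)) = emeasure lborel (\<Union>n. Vn n)"
  proof (rule SUP_emeasure_incseq)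
    show "range Vn \<subseteq> sets lborel" unfolding Vn_def by (auto intro!: sets.finite_UN)
    show "incseq Vn" unfolding Vn_def by (intro incseq_SucI) (auto simp: less_Suc_eq)
  qed
  \<comment> \<open>Half of the length is captured by finitely many balls; as a ball has length 2 r,
    the radii sum to a quarter.\<close>
  ultimately have "ennreal ((b - a) / 2) < (SUP n. emeasure lborel (Vn n))"
    using bU ab by (auto intro: less_le_trans[of _ "ennreal (b - a)"] simp: ennreal_less_iff)
  then obtain n where n: "ennreal ((b - a) / 2) < emeasure lborel (Vn n)" by (auto simp: less_SUP_iff)
  define I where "I = e ` {..<n}"
  have I: "finite I" "I \<subseteq> C" using e by (auto simp: I_def)
  have "emeasure lborel (Vn n) \<le> (\<Sum>i\<in>I. emeasure lborel (cball (f i) (r i)))"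
    unfolding Vn_def I_def[symmetric] by (rule emeasure_subadditive_finite) (use I in auto)
  also have "\<dots> = (\<Sum>i\<in>I. ennreal (2 * r i))"
    using I C(2) rK by (intro sum.cong) (auto simp: cball_eq_atLeastAtMost less_imp_le subset_iff)
  also have "\<dots> = ennreal (\<Sum>i\<in>I. 2 * r i)"
    by (rule sum_ennreal) (simp add: r_def)
  finally have "ennreal ((b - a) / 2) < ennreal (\<Sum>i\<in>I. 2 * r i)" using n by (rule less_le_trans[rotated])
  then have "(b - a) / 2 < (\<Sum>i\<in>I. 2 * r i)" using ab by (simp add: ennreal_less_iff)
  then have "(b - a) / 4 \<le> (\<Sum>i\<in>I. r i)" by (simp add: sum_distrib_left[symmetric])
  moreover have "cball (f w) (r w) \<inter> cball (f w') (r w') = {}" if "w \<in> I" "w' \<in> I" "w \<noteq> w'" for w w'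
    using that I(2) C(3) unfolding pairwise_def disjnt_def by blast
  moreover have "I \<subseteq> K" using I(2) C(2) by blast
  ultimately show ?thesis using I(1) unfolding K_def by (intro exI[of _ I]) blast
qed

text \<open>The exponent \<tau> is put strictly between (\<kappa>+1)/2 and 1/s. Below 1/s mass
  transference applies; above (\<kappa>+1)/2 the radius r^\<tau> is smaller than w1^(-(\<kappa>+1))
  by a factor tending to zero, which defeats every constant \<nu>.\<close>

lemma not_hnull_not_dir_dioph:
  assumes W: "separated c W" and AE: "AE \<xi> in lborel. \<not> dir_dioph W 1 \<xi>"
    and \<kappa>: "1 \<le> \<kappa>" and s: "0 < s" "s < 2 / (\<kappa> + 1)"
  shows "\<not> hnull s {\<xi>\<in>{0..1}. \<not> dir_dioph W \<kappa> \<xi>}"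
proof
  assume hn: "hnull s {\<xi>\<in>{0..1}. \<not> dir_dioph W \<kappa> \<xi>}"
  let ?f = "\<lambda>w :: real^2. w$2 / w$1" and ?r = "\<lambda>w :: real^2. 1 / (w$1)\<^sup>2"
  define \<tau> where "\<tau> = ((\<kappa> + 1) / 2 + 1 / s) / 2"
  have lt: "(\<kappa> + 1) / 2 < 1 / s" using s \<kappa> by (simp add: field_simps)
  have \<tau>: "(\<kappa> + 1) / 2 < \<tau>" "\<tau> < 1 / s" 
  proof -
    have "x < (x + y) / 2 \<and> (x + y) / 2 < y" if "x < y" for x y :: real using that by simp
    from this[OF lt] show "(\<kappa> + 1) / 2 < \<tau>" "\<tau> < 1 / s" by (simp_all only: \<tau>_def)
  qed
  define \<delta> where "\<delta> = \<tau> - (\<kappa> + 1) / 2"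
  have \<delta>: "0 < \<delta>" using \<tau> by (simp add: \<delta>_def)
  have "\<not> hnull s {x\<in>{0..1}. \<forall>\<eta>>0. \<exists>w\<in>{w\<in>W. 1 \<le> w$1}. ?r w < \<eta> \<and> \<bar>x - ?f w\<bar> \<le> ?r w powr \<tau>}" (is "\<not> hnull s ?E")
  proof (rule not_hnull_limsup[OF s(1)])
    show "1 \<le> \<tau>" using \<tau> \<kappa> by simp
    show "s * \<tau> < 1" using \<tau>(2) s(1) by (simp add: pos_less_divide_eq mult.commute)
    show "0 < ?r w" if "w \<in> {w\<in>W. 1 \<le> w$1}" for w using that by simp
    fix a b \<eta> :: real assume "a < b" "0 < \<eta>"
    then show "\<exists>I. finite I \<and> I \<subseteq> {w\<in>W. 1 \<le> w$1} \<and> (\<forall>w\<in>I. ?r w < \<eta> \<and> cball (?f w) (?r w) \<subseteq> {a..b}) \<and>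
      (\<forall>w\<in>I. \<forall>w'\<in>I. w \<noteq> w' \<longrightarrow> cball (?f w) (?r w) \<inter> cball (?f w') (?r w') = {}) \<and>
      (b - a) / 4 \<le> (\<Sum>w\<in>I. ?r w)" by (rule vitali_packing[OF W AE])
  qed
  moreover have "?E \<subseteq> {\<xi>\<in>{0..1}. \<not> dir_dioph W \<kappa> \<xi>}"
  proof (intro subsetI CollectI conjI)
    fix x assume x: "x \<in> ?E"
    then show "x \<in> {0..1}" by simp
    show "\<not> dir_dioph W \<kappa> x"
    proof
      assume "dir_dioph W \<kappa> x"
      then obtain \<mu> \<nu> where \<mu>: "\<mu> > 0" "\<nu> > 0" "\<And>w. w \<in> W \<Longrightarrow> \<mu> \<le> \<bar>w$2 - x * w$1\<bar> \<or> \<nu> \<le> \<bar>w$1\<bar> powr \<kappa> * \<bar>w$2 - x * w$1\<bar>"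
        unfolding dir_dioph_def by blast
      \<comment> \<open>For r below this bound the gained factor r^\<delta> is smaller than both
        constants.\<close>
      define \<eta> where "\<eta> = (min \<mu> \<nu>) powr (1 / \<delta>)"
      have "0 < \<eta>" using \<mu> by (simp add: \<eta>_def)
      then obtain w where w: "w \<in> W" "1 \<le> w$1" "?r w < \<eta>" "\<bar>x - ?f w\<bar> \<le> ?r w powr \<tau>" using x by blast
      define y where "y = w$1"
      have y: "1 \<le> y" using w by (simp add: y_def)
      have "w$2 - x * w$1 = - (y * (x - ?f w))" using w(2) by (simp add: y_def right_diff_distrib)
      then have b: "\<bar>w$2 - x * w$1\<bar> = y * \<bar>x - ?f w\<bar>" using y by (simp add: abs_mult)
      have r: "?r w = y powr (-2)" using y by (simp add: y_def powr_minus_divide)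
      have "y powr \<kappa> * \<bar>w$2 - x * w$1\<bar> \<le> y powr \<kappa> * (y * ?r w powr \<tau>)"
        unfolding b using w(4) y by (intro mult_left_mono) auto
      also have "\<dots> = y powr (\<kappa> + 1 - 2 * \<tau>)"
      proof -
        have "y powr \<kappa> * (y * ?r w powr \<tau>) = y powr \<kappa> * (y powr 1 * y powr (-2 * \<tau>))"
          using y unfolding r powr_powr by simp
        also have "\<dots> = y powr (\<kappa> + (1 + -2 * \<tau>))" by (simp only: powr_add)
        also have "\<kappa> + (1 + -2 * \<tau>) = \<kappa> + 1 - 2 * \<tau>" by simp
        finally show ?thesis .
      qed
      also have "\<kappa> + 1 - 2 * \<tau> = -2 * \<delta>" by (simp add: \<delta>_def)
      also have "y powr (-2 * \<delta>) = ?r w powr \<delta>" unfolding r powr_powr ..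
      also have "\<dots> < \<eta> powr \<delta>" using w(3) \<delta> by (intro powr_less_mono2) auto
      also have "\<dots> = min \<mu> \<nu>" using \<mu> \<delta> by (simp add: \<eta>_def powr_powr)
      finally have lt: "y powr \<kappa> * \<bar>w$2 - x * w$1\<bar> < min \<mu> \<nu>" .
      have "1 * \<bar>w$2 - x * w$1\<bar> \<le> y powr \<kappa> * \<bar>w$2 - x * w$1\<bar>"
        using y \<kappa> by (intro mult_right_mono ge_one_powr_ge_zero) auto
      then have "\<bar>w$2 - x * w$1\<bar> < \<mu>" using lt by simp
      moreover have "\<bar>w$1\<bar> powr \<kappa> * \<bar>w$2 - x * w$1\<bar> < \<nu>" using lt y by (simp add: y_def)
      ultimately show False using \<mu>(3)[OF w(1)] by simp
    qed
  qed
  ultimately show False using hn hnull_subset by blast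
qed

text \<open>If |w2 - \<xi> w1| is below \<nu>, the inequality of exponent one forces |w1| to be at
  least one, and there a larger exponent only helps.\<close>

lemma dir_dioph_exponent_mono:
  assumes "dir_dioph W 1 \<xi>" "W' \<subseteq> W" "1 \<le> \<kappa>"
  shows "dir_dioph W' \<kappa> \<xi>"
proof -
  obtain \<mu> \<nu> where \<mu>: "\<mu> > 0" "\<nu> > 0" "\<And>w. w \<in> W \<Longrightarrow> \<mu> \<le> \<bar>w$2 - \<xi> * w$1\<bar> \<or> \<nu> \<le> \<bar>w$1\<bar> powr 1 * \<bar>w$2 - \<xi> * w$1\<bar>"
    using assms(1) unfolding dir_dioph_def by blast
  have "min \<mu> \<nu> \<le> \<bar>w$2 - \<xi> * w$1\<bar> \<or> \<nu> \<le> \<bar>w$1\<bar> powr \<kappa> * \<bar>w$2 - \<xi> * w$1\<bar>" if "w \<in> W'" for w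
  proof (cases "min \<mu> \<nu> \<le> \<bar>w$2 - \<xi> * w$1\<bar>")
    case False
    let ?b = "\<bar>w$2 - \<xi> * w$1\<bar>"
    have b: "?b < \<mu>" "?b < \<nu>" using False by auto
    then have \<nu>: "\<nu> \<le> \<bar>w$1\<bar> * ?b" using \<mu>(3)[of w] that assms(2) by auto
    have "1 \<le> \<bar>w$1\<bar>"
    proof (rule ccontr)
      assume "\<not> ?thesis"
      then have "\<bar>w$1\<bar> * ?b \<le> 1 * ?b" by (intro mult_right_mono) auto
      then show False using \<nu> b by simp
    qed
    then have "\<bar>w$1\<bar> powr 1 \<le> \<bar>w$1\<bar> powr \<kappa>" using assms(3) by (intro powr_mono) auto
    then have "\<bar>w$1\<bar> * ?b \<le> \<bar>w$1\<bar> powr \<kappa> * ?b" by (intro mult_right_mono) auto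
    then show ?thesis using \<nu> by simp
  qed simp
  then show ?thesis unfolding dir_dioph_def using \<mu>(1,2) by (intro exI[of _ "min \<mu> \<nu>"] exI[of _ \<nu>] conjI ballI) auto
qed

section \<open>From directions back to matrices\<close>

definition rot :: "real^2^2" where "rot = mat2 0 (-1) 1 0"

lemma rot_SL2: "rot \<in> SL2"
  by (simp add: rot_def SL2_iff)

lemma matrix_inv_rot: "matrix_inv rot = mat2 0 1 (-1) 0"
  unfolding matrix_inv_SL2[OF rot_SL2] by (simp add: rot_def)

text \<open>Rotating by \<open>rot\<close> brings the matrices with vanishing first entry into the domain of the chart.\<close>

lemma hnull_SL2_cases:
  assumes s: "0 < s" and 1: "hnull s {g\<in>SL2. g$1$1 \<noteq> 0 \<and> P g}" and 2: "hnull s {g\<in>SL2. g$1$1 \<noteq> 0 \<and> Q g}"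
    and PQ: "\<And>g. g \<in> SL2 \<Longrightarrow> P g \<Longrightarrow> Q (rot ** g)"
  shows "hnull s {g\<in>SL2. P g}"
proof -
  have "hnull s ((\<lambda>g. matrix_inv rot ** g) ` {g\<in>SL2. g$1$1 \<noteq> 0 \<and> Q g})"
  proof (rule hnull_lipschitz_image[OF _ _ 2, of 4])
    fix x y :: "real^2^2"
    have "dist (matrix_inv rot ** x) (matrix_inv rot ** y) \<le> \<bar>x$2$1 - y$2$1\<bar> + \<bar>x$2$2 - y$2$2\<bar> + \<bar>y$1$1 - x$1$1\<bar> + \<bar>y$1$2 - x$1$2\<bar>"
      using norm_mat2_le[of "matrix_inv rot ** x - matrix_inv rot ** y"]
      by (simp add: dist_norm matrix_inv_rot matrix_mult_component2)
    also have "\<dots> \<le> dist x y + dist x y + dist x y + dist x y"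
      using mat2_component_dist[of x _ _ y] mat2_component_dist[of y _ _ x] by (intro add_mono) (auto simp: dist_commute)
    finally show "dist (matrix_inv rot ** x) (matrix_inv rot ** y) \<le> 4 * dist x y" by simp
  qed simp
  from hnull_Un[OF s 1 this]
  show ?thesis
  proof (rule hnull_subset, intro subsetI)
    fix g assume g: "g \<in> {g\<in>SL2. P g}"
    show "g \<in> {g\<in>SL2. g$1$1 \<noteq> 0 \<and> P g} \<union> (\<lambda>g. matrix_inv rot ** g) ` {g\<in>SL2. g$1$1 \<noteq> 0 \<and> Q g}"
    proof (cases "g$1$1 = 0")
      case True
      have "g$2$1 \<noteq> 0" using g True by (auto simp: SL2_iff)
      then have "(rot ** g)$1$1 \<noteq> 0" by (simp add: rot_def matrix_mult_component2)
      then have "rot ** g \<in> {g\<in>SL2. g$1$1 \<noteq> 0 \<and> Q g}" using g PQ SL2_mult[OF rot_SL2] by auto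
      moreover have "g = matrix_inv rot ** (rot ** g)" by (rule SL2_inv_cancel(3)[OF rot_SL2, symmetric])
      ultimately show ?thesis by blast
    qed (use g in auto)
  qed
qed

lemma separated_rot:
  assumes "separated c W"
  shows "separated c ((*v) rot ` W)"
proof -
  have "- (rot *v w) = rot *v (- w)" for w :: "real^2"
    by (simp add: vec2_eq_iff matrix_vector_component2)
  then show ?thesis
    using assms SL2_apply_nonzero[OF rot_SL2] unfolding separated_def
    by (auto simp: det2_SL2[OF rot_SL2]) metis
qed

lemma dioph_for_rot: "dioph_for ((*v) rot ` W) \<kappa> (rot ** g) \<longleftrightarrow> dioph_for W \<kappa> g"
  unfolding dioph_for_coords by (simp add: coords_invariant[OF rot_SL2])

lemma hnull_not_dioph_for:
  assumes W: "separated c W" and \<kappa>: "0 < \<kappa>" and s: "2 + 2 / (\<kappa> + 1) < s"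
  shows "hnull s {g\<in>SL2. \<not> dioph_for W \<kappa> g}"
proof -
  have s0: "0 < s - 2" "2 / (\<kappa> + 1) < s - 2" 
  proof -
    have "0 < 2 / (\<kappa> + 1)" using \<kappa> by simp
    then show "0 < s - 2" "2 / (\<kappa> + 1) < s - 2" using s by linarith+
  qed
  have *: "hnull s {g\<in>SL2. g$1$1 \<noteq> 0 \<and> \<not> dioph_for W' \<kappa> g}" if "separated c W'" for W'
  proof (rule hnull_subset)
    show "hnull s {g\<in>SL2. g$1$1 \<noteq> 0 \<and> g$2$1 / g$1$1 \<in> {\<xi>. \<not> dir_dioph W' \<kappa> \<xi>}}"
      using hnull_fibered[OF s0(1) hnull_not_dir_dioph[OF that \<kappa> s0(2)]] by simp
  qed (auto simp: dioph_for_iff_dir \<kappa>)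
  show ?thesis
    by (rule hnull_SL2_cases[OF _ *[OF W] *[OF separated_rot[OF W]]]) (use s0 in \<open>auto simp: dioph_for_rot\<close>)
qed

lemma hnull_real:
  assumes s: "1 < s"
  shows "hnull s (UNIV :: real set)"
proof -
  have unit: "hnull s {0..1::real}"
  proof (rule hnull_countableI[where ?'i = nat])
    fix \<epsilon> :: real assume \<epsilon>: "\<epsilon> > 0"
    \<comment> \<open>Gives the n + 1 intervals of length 1/n a total content of at most 2 n^(1-s),
      which is at most \<epsilon>.\<close>
    obtain n :: nat where n: "(2 / \<epsilon>) powr (1 / (s - 1)) < real n" using reals_Archimedean2 by blast
    have n0: "0 < real n" using n by (meson le_less_trans powr_ge_zero)
    have "2 / \<epsilon> = ((2 / \<epsilon>) powr (1 / (s - 1))) powr (s - 1)" using s \<epsilon> by (simp add: powr_powr)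
    also have "\<dots> \<le> real n powr (s - 1)" using n s by (intro powr_mono2) auto
    finally have le: "2 / \<epsilon> \<le> real n powr (s - 1)" .
    have tot: "real (card {..n}) * (1 / real n) powr s \<le> \<epsilon>"
    proof -
      have "real (card {..n}) * (1 / real n) powr s \<le> (2 * real n) * (1 / real n) powr s"
        using n0 by (intro mult_right_mono) auto
      also have "\<dots> = 2 / real n powr (s - 1)"
        using n0 by (simp add: powr_divide powr_diff)
      also have "\<dots> \<le> 2 / (2 / \<epsilon>)" using le \<epsilon> n0 by (intro divide_left_mono) auto
      finally show ?thesis by simp
    qed
    define U where "U i = {real i / real n .. real i / real n + 1 / real n}" for i
    have "{0..1} \<subseteq> (\<Union>i\<in>{..n}. U i)"
    proof
      fix x :: real assume x: "x \<in> {0..1}"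
      have nx: "0 \<le> real n * x" "real n * x \<le> real n * 1" using x n0 by (auto intro: mult_left_mono)
      define i where "i = nat \<lfloor>real n * x\<rfloor>"
      have i: "real i \<le> real n * x" "real n * x \<le> real i + 1" "i \<le> n" using nx unfolding i_def by linarith+
      have "real i / real n \<le> x" "x \<le> (real i + 1) / real n"
        using i n0 by (auto simp: pos_divide_le_eq pos_le_divide_eq mult.commute)
      then have "x \<in> U i" by (simp add: U_def add_divide_distrib)
      then show "x \<in> (\<Union>i\<in>{..n}. U i)" using i(3) by blast
    qed
    moreover have "dist x y \<le> 1 / real n" if "x \<in> U i" "y \<in> U i" for x y i
      using that by (auto simp: U_def dist_real_def)
    moreover have "(\<Sum>i\<in>G. (1 / real n) powr s) \<le> \<epsilon>" if "finite G" "G \<subseteq> {..n}" for G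
    proof -
      have "(\<Sum>i\<in>G. (1 / real n) powr s) \<le> (\<Sum>i\<in>{..n}. (1 / real n) powr s)"
        using that by (intro sum_mono2) auto
      then show ?thesis using tot by simp
    qed
    ultimately show "\<exists>(I::nat set) U d. countable I \<and> {0..1::real} \<subseteq> (\<Union>i\<in>I. U i) \<and>
      (\<forall>i\<in>I. 0 < d i \<and> (\<forall>x\<in>U i. \<forall>y\<in>U i. dist x y \<le> d i)) \<and>
      (\<forall>F. finite F \<longrightarrow> F \<subseteq> I \<longrightarrow> (\<Sum>i\<in>F. d i powr s) \<le> \<epsilon>)"
      using n0 by (intro exI[of _ "{..n}"] exI[of _ U] exI[of _ "\<lambda>_. 1 / real n"]) auto
  qed (use s in simp)
  have "hnull s ((\<lambda>x. (2 * x - 1) * real k) ` {0..1})" for k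
  proof (rule hnull_lipschitz_image[OF _ _ unit])
    show "0 < 2 * real k + 1" by simp
    fix x y :: real
    have "(2 * x - 1) * real k - (2 * y - 1) * real k = (2 * real k) * (x - y)" by (simp add: algebra_simps)
    then have "dist ((2 * x - 1) * real k) ((2 * y - 1) * real k) = (2 * real k) * dist x y"
      by (simp add: dist_real_def abs_mult)
    also have "\<dots> \<le> (2 * real k + 1) * dist x y" by (intro mult_right_mono) auto
    finally show "dist ((2 * x - 1) * real k) ((2 * y - 1) * real k) \<le> (2 * real k + 1) * dist x y" .
  qed
  then have "hnull s (\<Union>k. (\<lambda>x. (2 * x - 1) * real k) ` {0..1})" using s by (intro hnull_Union) auto
  moreover have "x \<in> (\<Union>k. (\<lambda>x. (2 * x - 1) * real k) ` {0..1})" for x :: real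
  proof -
    obtain k :: nat where k: "\<bar>x\<bar> < real k" using reals_Archimedean2 by blast
    then have "\<bar>x / real k\<bar> \<le> 1" by simp
    then have "(x / real k + 1) / 2 \<in> {0..1}" unfolding abs_le_iff by auto
    moreover have "2 * ((y + 1) / 2) - 1 = y" for y :: real by (simp add: add_divide_distrib)
    from this[of "x / real k"] have "x = (2 * ((x / real k + 1) / 2) - 1) * real k" using k by simp
    ultimately show ?thesis by blast
  qed
  ultimately show ?thesis by (metis UNIV_eq_I)
qed

lemma hnull_SL2:
  assumes s: "3 < s"
  shows "hnull s SL2"
proof -
  have "hnull (s - 2) (UNIV :: real set)" using s by (intro hnull_real) simp
  from hnull_fibered[OF _ this] s have "hnull s {g\<in>SL2. g$1$1 \<noteq> 0 \<and> True}" by simp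
  from hnull_SL2_cases[OF _ this this] s show ?thesis by simp
qed

theorem theorem7p1:
  fixes \<Gamma> :: "(real^2^2) set" and k :: nat and \<sigma> :: "nat \<Rightarrow> real^2^2" and \<kappa> :: "nat \<Rightarrow> real"
  assumes "nonuniform_lattice \<Gamma>"
    and "0 < k"
    and "complete_cusp_system \<Gamma> k \<sigma>"
    and "\<forall>j<k. 1 \<le> \<kappa> j"
  shows "hausdorff_dim (SL2 - dioph_set \<Gamma> k \<sigma> \<kappa>) = ereal (2 + 2 / Min ((\<lambda>j. \<kappa> j + 1) ` {..<k}))
       \<and> (Min (\<kappa> ` {..<k}) = 1 \<longrightarrow>
           dioph_set \<Gamma> k \<sigma> \<kappa> \<in> null_sets haar_SL2 \<and> hausdorff_dim (dioph_set \<Gamma> k \<sigma> \<kappa>) = 3)"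
proof -
  have \<Gamma>: "mat_subgroup \<Gamma>" "- mat 1 \<in> \<Gamma>" "discrete_set \<Gamma>" "finite_covolume \<Gamma>"
    using assms(1) by (auto simp: nonuniform_lattice_def)
  have \<kappa>: "1 \<le> \<kappa> j" "0 < \<kappa> j" if "j < k" for j using assms(4) that by (auto intro: less_le_trans[of 0 1])
  define W where "W j = orbit \<Gamma> (\<sigma> j)" for j
  \<comment> \<open>One constant for the union of all orbits, because full dimension needs
    directions badly approximable by every orbit at once.\<close>
  obtain c where c: "separated c (\<Union>j<k. W j)"
    using orbit_separated[OF \<Gamma>(1,3,2) assms(3)] unfolding W_def by blast
  have sepW: "separated c (W j)" if "j < k" for j
    by (rule separated_subset[OF c]) (use that orbit_uminus[OF \<Gamma>(1,2)] in \<open>auto simp: W_def\<close>)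
  have dioph: "dioph_set \<Gamma> k \<sigma> \<kappa> = {g\<in>SL2. \<forall>j<k. dioph_for (W j) (\<kappa> j) g}"
    by (auto simp: dioph_set_def diophantine_iff W_def)
  obtain F where F: "F \<in> sets borel" "F \<subseteq> SL2" "\<forall>g\<in>SL2. \<exists>!\<gamma>. \<gamma> \<in> \<Gamma> \<and> matrix_inv \<gamma> ** g \<in> F"
    "emeasure haar_SL2 F < \<infinity>" using \<Gamma>(4) by (auto simp: finite_covolume_def)
  have lat: "lattice_orbit \<Gamma> F (W j)" for j
  proof
    show "emeasure haar' F < \<infinity>"
      using F(4) emeasure_haar_SL2[OF F(1)] by (auto simp: ennreal_mult_less_top)
    show "\<gamma> *v w \<in> W j" if g: "\<gamma> \<in> \<Gamma>" and w: "w \<in> W j" for \<gamma> w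
    proof -
      obtain \<delta> where d: "\<delta> \<in> \<Gamma>" "w = (\<delta> ** \<sigma> j) *v e1" using w by (auto simp: W_def orbit_def)
      have "\<gamma> *v w = ((\<gamma> ** \<delta>) ** \<sigma> j) *v e1" by (simp add: d matrix_vector_mul_assoc matrix_mul_assoc)
      moreover have "\<gamma> ** \<delta> \<in> \<Gamma>" using \<Gamma>(1) g d by (simp add: mat_subgroup_def)
      ultimately show ?thesis unfolding W_def orbit_def by blast
    qed
  qed (use \<Gamma> F discrete_set_countable in auto)
  have w0: "\<exists>w\<in>W j. w \<noteq> 0" if "j < k" for j
  proof -
    have "mat 1 \<in> \<Gamma>" using \<Gamma>(1) by (simp add: mat_subgroup_def)
    then have "(mat 1 ** \<sigma> j) *v e1 \<in> W j" unfolding W_def orbit_def by blast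
    moreover have "0 \<notin> W j" using sepW[OF that] by (simp add: separated_def)
    ultimately show ?thesis by metis
  qed
  have "Min (\<kappa> ` {..<k}) \<in> \<kappa> ` {..<k}" using assms(2) by (intro Min_in) auto
  \<comment> \<open>The least exponent has the largest exceptional set of directions, so the
    dimension is decided at this cusp.\<close>
  then obtain j0 where j0: "j0 < k" "\<kappa> j0 = Min (\<kappa> ` {..<k})" by force
  have j0_le: "\<kappa> j0 \<le> \<kappa> j" if "j < k" for j using that j0 by simp
  have min_eq: "Min ((\<lambda>j. \<kappa> j + 1) ` {..<k}) = \<kappa> j0 + 1"
    using j0(1) j0_le by (intro Min_eqI) auto
  let ?d = "2 / (\<kappa> j0 + 1)"
  have d: "0 < ?d" using \<kappa>[OF j0(1)] by simp
  have slice: "\<not> hnull s X"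
    if s: "0 < s" "s < 2 + t" and t: "0 < t" and E: "\<And>s'. 0 < s' \<Longrightarrow> s' < t \<Longrightarrow> \<not> hnull s' E"
      and EX: "\<And>p \<xi> q. p \<in> {1..2} \<Longrightarrow> \<xi> \<in> E \<Longrightarrow> chart (p, \<xi>, q) \<in> X" for s t :: real and E :: "real set" and X
  proof
    assume X: "hnull s X"
    \<comment> \<open>Here s may be at most 2, while slicing requires a positive exponent for
      directions; s is therefore raised to s' + 2 with 0 < s' < t.\<close>
    define m where "m = max (s - 2) 0"
    define s' where "s' = (m + t) / 2"
    have "0 \<le> m" "s - 2 \<le> m" "m < t" using s t by (auto simp: m_def)
    then have s': "0 < s'" "s' < t" "s \<le> s' + 2" by (auto simp: s'_def field_simps)
    have "hnull (s' + 2) X" by (rule hnull_exponent_mono[OF s(1) s'(3) X])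
    then have "hnull s' E" by (rule hnull_slice[OF s'(1)]) (rule EX)
    then show False using E s' by blast
  qed
  have chart_dir: "chart (p, \<xi>, q) \<in> SL2" "dioph_for W' \<kappa>' (chart (p, \<xi>, q)) \<longleftrightarrow> dir_dioph W' \<kappa>' \<xi>"
    if "p \<in> {1..2}" "0 < \<kappa>'" for p \<xi> q W' \<kappa>'
  proof -
    have p: "p \<noteq> 0" using that by auto
    then show 1: "chart (p, \<xi>, q) \<in> SL2" by (rule chart_SL2)
    show "dioph_for W' \<kappa>' (chart (p, \<xi>, q)) \<longleftrightarrow> dir_dioph W' \<kappa>' \<xi>"
      using dioph_for_iff_dir[OF 1, of \<kappa>' W'] p that(2) by (simp add: chart_def)
  qed
  have "hausdorff_dim (SL2 - dioph_set \<Gamma> k \<sigma> \<kappa>) = ereal (2 + ?d)"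
  proof (rule hausdorff_dim_eqI)
    show "0 < 2 + ?d" using d by linarith
    fix s assume s: "2 + ?d < s"
    have s0: "0 < s" using s d by linarith
    have "hnull s (\<Union>j. if j < k then {g\<in>SL2. \<not> dioph_for (W j) (\<kappa> j) g} else {})"
    proof (rule hnull_Union[OF s0])
      fix j
      show "hnull s (if j < k then {g\<in>SL2. \<not> dioph_for (W j) (\<kappa> j) g} else {})"
      proof (cases "j < k")
        case True
        have "2 / (\<kappa> j + 1) \<le> ?d" using j0_le[OF True] \<kappa>[OF j0(1)] by (intro divide_left_mono) auto
        then have "hnull s {g\<in>SL2. \<not> dioph_for (W j) (\<kappa> j) g}"
          using s True by (intro hnull_not_dioph_for[OF sepW \<kappa>(2)]) auto
        then show ?thesis using True by simp
      qed (simp add: hnull_empty s0)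
    qed
    then show "hnull s (SL2 - dioph_set \<Gamma> k \<sigma> \<kappa>)"
      by (rule hnull_subset) (force simp: dioph)
  next
    fix s assume s: "0 < s" "s < 2 + ?d"
    interpret lattice_orbit \<Gamma> F "W j0" by (rule lat)
    obtain w where w: "w \<in> W j0" "w \<noteq> 0" using w0[OF j0(1)] by blast
    \<comment> \<open>Failing the condition at the single cusp j0 already puts a matrix into the
      complement.\<close>
    show "\<not> hnull s (SL2 - dioph_set \<Gamma> k \<sigma> \<kappa>)"
    proof (rule slice[OF s d])
      show "\<not> hnull s' {\<xi>\<in>{0..1}. \<not> dir_dioph (W j0) (\<kappa> j0) \<xi>}" if "0 < s'" "s' < ?d" for s'
        using that by (intro not_hnull_not_dir_dioph[OF sepW[OF j0(1)] AE_not_dir_dioph[OF w] \<kappa>(1)[OF j0(1)]])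
      fix p \<xi> q assume "p \<in> {1..2::real}" "\<xi> \<in> {\<xi>\<in>{0..1}. \<not> dir_dioph (W j0) (\<kappa> j0) \<xi>}"
      then show "chart (p, \<xi>, q) \<in> SL2 - dioph_set \<Gamma> k \<sigma> \<kappa>"
        using chart_dir[of p "\<kappa> j0"] \<kappa>(2)[OF j0(1)] j0(1) by (auto simp: dioph)
    qed
  qed
  moreover have "dioph_set \<Gamma> k \<sigma> \<kappa> \<in> null_sets haar_SL2 \<and> hausdorff_dim (dioph_set \<Gamma> k \<sigma> \<kappa>) = 3"
    if "Min (\<kappa> ` {..<k}) = 1"
  proof
    have \<kappa>1: "\<kappa> j0 = 1" using j0 that by simp
    interpret lattice_orbit \<Gamma> F "W j0" by (rule lat)
    obtain w where w: "w \<in> W j0" "w \<noteq> 0" using w0[OF j0(1)] by blast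
    have "SL2 \<inter> (\<Inter>j\<in>{..<k}. {g. dioph_for (W j) (\<kappa> j) g}) \<in> sets borel"
      using \<kappa>(2) assms(2) closed_SL2 by (intro sets.Int sets.finite_INT dioph_for_sets borel_closed) auto
    moreover have "dioph_set \<Gamma> k \<sigma> \<kappa> = SL2 \<inter> (\<Inter>j\<in>{..<k}. {g. dioph_for (W j) (\<kappa> j) g})"
      by (auto simp: dioph)
    ultimately have sets: "dioph_set \<Gamma> k \<sigma> \<kappa> \<in> sets borel" by simp
    have sub_j0: "dioph_set \<Gamma> k \<sigma> \<kappa> \<subseteq> {g\<in>SL2. dioph_for (W j0) 1 g}"
      using j0(1) \<kappa>1 by (force simp: dioph)
    have "dioph_set \<Gamma> k \<sigma> \<kappa> \<in> null_sets haar'"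
      by (rule null_sets_subset[OF dioph_for_null[OF w] _ sub_j0]) (simp add: sets)
    then show "dioph_set \<Gamma> k \<sigma> \<kappa> \<in> null_sets haar_SL2"
      using sets by (simp add: null_sets_def emeasure_haar_SL2)
    have "hausdorff_dim (dioph_set \<Gamma> k \<sigma> \<kappa>) = ereal 3"
    proof (rule hausdorff_dim_eqI)
      show "hnull s (dioph_set \<Gamma> k \<sigma> \<kappa>)" if "3 < s" for s
        by (rule hnull_subset[OF hnull_SL2[OF that]]) (auto simp: dioph)
      fix s :: real assume s: "0 < s" "s < 3"
      \<comment> \<open>Exponent one for the union of all orbits is the strongest of the conditions,
        since every \<kappa> j is at least one; the directions satisfying it still have full
        dimension.\<close>
      show "\<not> hnull s (dioph_set \<Gamma> k \<sigma> \<kappa>)"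
      proof (rule slice[where t=1])
        show "\<not> hnull s' {\<xi>\<in>{0..1}. dir_dioph (\<Union>j<k. W j) 1 \<xi>}" if "0 < s'" "s' < 1" for s'
          by (rule not_hnull_dir_dioph[OF c that])
        fix p \<xi> q assume p: "p \<in> {1..2::real}" and \<xi>: "\<xi> \<in> {\<xi>\<in>{0..1}. dir_dioph (\<Union>j<k. W j) 1 \<xi>}"
        have "dioph_for (W j) (\<kappa> j) (chart (p, \<xi>, q))" if j: "j < k" for j
        proof -
          have "dir_dioph (W j) (\<kappa> j) \<xi>"
            by (rule dir_dioph_exponent_mono[OF _ _ \<kappa>(1)[OF j], of "\<Union>j<k. W j"]) (use \<xi> j in auto)
          then show ?thesis using chart_dir(2)[OF p \<kappa>(2)[OF j]] by simp
        qed
        then show "chart (p, \<xi>, q) \<in> dioph_set \<Gamma> k \<sigma> \<kappa>"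
          using chart_dir(1)[OF p, of 1] by (simp add: dioph)
      qed (use s in auto)
    qed simp
    then show "hausdorff_dim (dioph_set \<Gamma> k \<sigma> \<kappa>) = 3" by simp
  qed
  ultimately show ?thesis using min_eq by simp
qed

end
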